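(* Let $n\geq 2$ and let $K\subset\mathbb{R}^n$ be an anti-blocking convex body. (i) For any integer $p\geq 1$ and any integers $0\leq k\leq n$ and $0\leq k_i\leq n$, $i=1,\dots,p$, with $k_1+\cdots+k_p=k$, one has $$V(-\Delta_pK[k],\iota_1K[n-k_1],\dots,\iota_pK[n-k_p])\leq \binom{n}{k}\binom{k}{k_1,\dots,k_p}\frac{(n!)^p}{(pn)!}\,\mathrm{vol}_n(K)^p .$$ Moreover, if $k_i<n$ for all $i$, $0<k$, and $K$ has non-empty interior, then equality holds if and only if $K$ is a simplex. (ii) Consequently, for any integers $0\leq k\leq n$ and $p\geq 1$ one has $$V(-\Delta_pK[k],K^p[pn-k])\leq \binom{n}{k}\,\mathrm{vol}_n(K)^p .$$ Moreover, if $0<k$ and $K$ has non-empty interior, then equality holds if and only if $K$ is a simplex.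
   Context: A convex body in $\mathbb{R}^n$ is a (non-empty) compact convex subset. For $\sigma\subset\{1,\dots,n\}$ let $E_\sigma=\mathrm{span}\{e_i\mid i\in\sigma\}$ be the corresponding coordinate subspace of $\mathbb{R}^n$ ($E_\emptyset=\{0\}$), where $e_1,\dots,e_n$ is the standard basis. A convex body $K\subset\mathbb{R}^n$ is anti-blocking if $K\subset\mathbb{R}^n_{\geq 0}$ and for each $\sigma\subset\{1,\dots,n\}$ the orthogonal projection of $K$ to $E_\sigma$ equals $K\cap E_\sigma$; equivalently, $K\subset\mathbb{R}^n_{\ge0}$ and whenever $y\in K$ and $x\in\mathbb{R}^n_{\geq0}$ satisfy $x_i\leq y_i$ for all $i$, then $x\in K$. $\Delta_p:\mathbb{R}^n\to(\mathbb{R}^n)^p=\mathbb{R}^{pn}$ is the diagonal embedding $\Delta_p(x)=(x,\dots,x)$, $\iota_j:\mathbb{R}^n\to(\mathbb{R}^n)^p$ is the inclusion into the $j$-th factor (the other components being $0$), $\Delta_pK$ and $\iota_jK$ denote images of $K$, $-A=\{-a\mid a\in A\}$, and $K^p=K\times\cdots\times K\subset\mathbb{R}^{pn}$ ($p$ factors). $\mathrm{vol}_m$ is Lebesgue measure on $\mathbb{R}^m$. $V$ denotes the mixed volume in $\mathbb{R}^{m}$ with $m=pn$: for convex bodies $K_1,\dots,K_{m}\subset\mathbb{R}^{m}$, $$V(K_1,\dots,K_{m})=\frac{1}{m!}\frac{\partial^{m}}{\partial\lambda_1\cdots\partial\lambda_{m}}\mathrm{vol}_{m}(\lambda_1K_1+\cdots+\lambda_{m}K_{m}),$$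 where $+$ is Minkowski sum and the volume is a homogeneous polynomial in $\lambda_i>0$. The notation $K[j]$ in an argument of $V$ means that $K$ is repeated $j$ times. $\binom{k}{k_1,\dots,k_p}=\frac{k!}{k_1!\cdots k_p!}$. A simplex in $\mathbb{R}^n$ is the convex hull of $n+1$ affinely independent points.
   Formalization: In (ii), the equality characterization excludes the case p = 1, k = n, where both sides equal vol_n(K), so equality holds for every K (e.g. the cube [0,1]^n, not a simplex); the inequality is still claimed there. *)

theory Defs
  imports "HOL-Analysis.Analysis"
begin

definition convex_body :: "'a::euclidean_space set \<Rightarrow> bool" where
  "convex_body K \<longleftrightarrow> K \<noteq> {} \<and> compact K \<and> convex K"

definition coord_subspace :: "'n set \<Rightarrow> (real ^ 'n::finite) set" where
  "coord_subspace \<sigma> = span ((\<lambda>i. axis i 1) ` \<sigma>)"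

definition orth_proj :: "'a::euclidean_space set \<Rightarrow> 'a \<Rightarrow> 'a" where
  "orth_proj E x = (THE y. y \<in> E \<and> (\<forall>z\<in>E. orthogonal (x - y) z))"

definition anti_blocking :: "(real ^ 'n::finite) set \<Rightarrow> bool" where
  "anti_blocking K \<longleftrightarrow>
     K \<subseteq> {x. \<forall>i. 0 \<le> x $ i} \<and>
     (\<forall>\<sigma>. orth_proj (coord_subspace \<sigma>) ` K = K \<inter> coord_subspace \<sigma>)"

text \<open>
  The product of \<open>p\<close> copies of \<open>n\<close>-space is \<^typ>\<open>real ^ 'n ^ 'p\<close>, with \<open>CARD('n) = n\<close> and
  \<open>CARD('p) = p\<close>. Its Euclidean structure (hence its Lebesgue measure) is that of \<open>pn\<close>-space, and
  the inclusion of the \<open>j\<close>-th factor is \<^term>\<open>axis j\<close>.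
\<close>

definition diag :: "real ^ 'n \<Rightarrow> real ^ 'n ^ 'p" where
  "diag x = (\<chi> j. x)"

definition body_power :: "(real ^ 'n) set \<Rightarrow> (real ^ 'n ^ 'p) set" where
  "body_power K = {x. \<forall>j. x $ j \<in> K}"

definition partial_deriv :: "nat \<Rightarrow> ((nat \<Rightarrow> real) \<Rightarrow> real) \<Rightarrow> (nat \<Rightarrow> real) \<Rightarrow> real" where
  "partial_deriv i f l = deriv (\<lambda>t. f (l(i := t))) (l i)"

definition minkowski_comb :: "'a::real_vector set list \<Rightarrow> (nat \<Rightarrow> real) \<Rightarrow> 'a set" where
  "minkowski_comb Ks l = (\<Sum>i<length Ks. (\<lambda>x. l i *\<^sub>R x) ` (Ks ! i))"

text \<open>
  The mixed volume of a list of \<open>m = DIM('a)\<close> convex bodies; other list lengths are meaningless.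
  The volume of \<open>l\<^sub>0 K\<^sub>0 + \<dots> + l\<^sub>m\<^sub>-\<^sub>1 K\<^sub>m\<^sub>-\<^sub>1\<close> is a homogeneous polynomial of degree \<open>m\<close> on
  \<^emph>\<open>positive\<close> \<open>l\<close> only. There the derivative in all \<open>m\<close> variables is constant, so it is
  taken at the point \<open>(1, \<dots>, 1)\<close>.
\<close>

definition mixed_volume :: "'a::euclidean_space set list \<Rightarrow> real" where
  "mixed_volume Ks =
     foldr partial_deriv [0..<length Ks] (\<lambda>l. measure lebesgue (minkowski_comb Ks l)) (\<lambda>_. 1)
       / fact (length Ks)"

text \<open>
  The list of \<open>\<iota>\<^sub>1 K [n - k\<^sub>1], \<dots>, \<iota>\<^sub>p K [n - k\<^sub>p]\<close>; the linear order on \<open>'p\<close> is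
  needed only to list the factors.
\<close>

definition factor_copies ::
    "(real ^ 'n) set \<Rightarrow> ('p \<Rightarrow> nat) \<Rightarrow> (real ^ 'n ^ 'p::{finite,linorder}) set list" where
  "factor_copies K ks =
     concat (map (\<lambda>j. replicate (CARD('n) - ks j) (axis j ` K)) (sorted_list_of_set UNIV))"

definition multinomial :: "('p::finite \<Rightarrow> nat) \<Rightarrow> real" where
  "multinomial ks = fact (\<Sum>j\<in>UNIV. ks j) / (\<Prod>j\<in>UNIV. fact (ks j))"

end

theory Submission
  imports Defs
begin

text \<open>
  Write \<open>K\<^sub>S\<close> for the section of \<open>K\<close> by the coordinate subspace of \<open>S\<close> and \<open>v(S)\<close> for
  \<open>|S|! vol(K\<^sub>S)\<close>, which is the integral of \<open>exp(-N)\<close> over the orthant of \<open>S\<close>, with \<open>N\<close> the gauge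
  of \<open>K\<close>. A point \<open>z\<close> of \<open>- l \<Delta> K + m\<^sub>1 K \<times> \<dots> \<times> m\<^sub>p K\<close> is cut up coordinate by coordinate,
  according to which of its \<open>p\<close> components is the most negative one, if any; a unimodular shear turns
  each piece into a product of sections. So the volume is a sum over the maps \<open>c\<close> from the coordinates
  to \<open>{None, Some 1, \<dots>, Some p}\<close> of products of section volumes, and both parts of the theorem reduce to
  the dual Loomis-Whitney inequality: the product over \<open>b\<close> of \<open>v(- c\<^sup>-\<^sup>1 b)\<close> is at most \<open>v(UNIV)^p\<close>.

  For this inequality let \<open>G\<^sub>b\<close> be the marginal of \<open>exp(-N)\<close> on the block \<open>c\<^sup>-\<^sup>1 b\<close>, and put
  \<open>\<psi>\<^sub>b = ln G\<^sub>b(0) - ln G\<^sub>b\<close>. Integrating \<open>exp(-\<Psi>) \<ge> exp(-N) (1 + N - \<Psi>)\<close> with \<open>\<Psi> = \<Sum>\<^sub>b \<psi>\<^sub>b\<close>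
  gives the claim, because the integral of \<open>N exp(-N)\<close> is \<open>n\<close> times that of \<open>exp(-N)\<close>, while that of
  \<open>\<psi>\<^sub>b exp(-N)\<close> is at most \<open>|c\<^sup>-\<^sup>1 b|\<close> times it: \<open>\<psi>\<^sub>b\<close> is convex along rays, since marginals of
  log-concave functions are log-concave. Equality forces \<open>N = \<Psi>\<close>, so that \<open>N\<close> is additive over the
  blocks; if this happens for all maps \<open>c\<close> with given fiber sizes, then \<open>N\<close> is linear on the orthant and
  \<open>K\<close> is a simplex.
\<close>

section \<open>Product measures on orthants\<close>

text \<open>On the piece of c, the diagonal summand occupies the columns with a negative component,
  and the i-th factor those where component i is not the most negative one. So every coordinate lies
  in exactly p of the p + 1 index sets; this uniform covering explains the complements of fibers and
  the exponent p.

  The exponential is preferred to the indicator of K because it turns sections into marginals at 0,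
  and homogeneity of N into the exact first moment n. The factor |S|! also absorbs factorials left
  by differentiation, so all pieces share one bound, and the binomial and multinomial coefficients
  count maps c, in (ii) with weights.

  Equality of N and \<Psi> is obtained only almost everywhere, whereas additivity over blocks
  concerns faces, which are null sets; monotonicity of both functions bridges the gap. One map c
  does not determine a simplex: it is the invariance of the set of maps under permutations of
  coordinates that separates all coordinates. Bodies inside a coordinate hyperplane have no finite
  gauge and are treated apart.\<close>

definition half_lborel :: "real measure" where
  "half_lborel = density lborel (indicator {0..})"

lemma sets_half_lborel [simp, measurable_cong]: "sets half_lborel = sets borel"
  by (simp add: half_lborel_def)

lemma space_half_lborel [simp]: "space half_lborel = UNIV"
  by (simp add: half_lborel_def)

lemma nn_integral_half_lborel:
  "f \<in> borel_measurable borel \<Longrightarrow> (\<integral>\<^sup>+x. f x \<partial>half_lborel) = (\<integral>\<^sup>+x. f x * indicator {0..} x \<partial>lborel)"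
  by (simp add: half_lborel_def nn_integral_density mult.commute)

lemma sigma_finite_half_lborel: "sigma_finite_measure half_lborel"
  unfolding half_lborel_def
  by (rule sigma_finite_measure.sigma_finite_iff_density_finite[OF sigma_finite_lborel, THEN iffD2]) (auto simp: indicator_def)

interpretation half_lborel: sigma_finite_measure half_lborel
  by (rule sigma_finite_half_lborel)

interpretation half: product_sigma_finite "\<lambda>_::'i. half_lborel"
  by standard

interpretation full: product_sigma_finite "\<lambda>_::'i. lborel :: real measure"
  by standard

lemma emeasure_half_lborel:
  assumes [measurable]: "D \<in> sets borel"
  shows "emeasure half_lborel D = emeasure lborel (D \<inter> {0..})"
proof -
  have "emeasure half_lborel D = (\<integral>\<^sup>+x. indicator {0..} x * indicator D x \<partial>lborel)"
    unfolding half_lborel_def by (rule emeasure_density) auto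
  also have "\<dots> = (\<integral>\<^sup>+x. indicator (D \<inter> {0..}) x \<partial>lborel)"
    by (intro nn_integral_cong) (auto simp: indicator_def)
  finally show ?thesis by simp
qed

lemma AE_half_lborel: "AE x in half_lborel. 0 \<le> x"
  unfolding half_lborel_def by (subst AE_density) (auto simp: indicator_def split: if_splits)

abbreviation orthant_measure :: "'i set \<Rightarrow> ('i \<Rightarrow> real) measure" where
  "orthant_measure S \<equiv> PiM S (\<lambda>_. half_lborel)"

lemma nn_integral_half_lborel_scale:
  assumes [measurable]: "f \<in> borel_measurable borel" and "0 < c"
  shows "(\<integral>\<^sup>+x. f (c * x) \<partial>half_lborel) = ennreal (1 / c) * (\<integral>\<^sup>+x. f x \<partial>half_lborel)"
proof -
  have "(\<integral>\<^sup>+x. f x \<partial>half_lborel) = (\<integral>\<^sup>+x. f x * indicator {0..} x \<partial>lborel)"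
    by (simp add: nn_integral_half_lborel)
  also have "\<dots> = ennreal c * (\<integral>\<^sup>+x. f (c * x) * indicator {0..} (c * x) \<partial>lborel)"
    using assms(2) by (subst nn_integral_real_affine[where c = c and t = 0]) auto
  also have "(\<lambda>x. f (c * x) * indicator {0..} (c * x)) = (\<lambda>x. f (c * x) * indicator {0..} x)"
    using assms(2) by (auto simp: indicator_def zero_le_mult_iff)
  also have "(\<integral>\<^sup>+x. f (c * x) * indicator {0..} x \<partial>lborel) = (\<integral>\<^sup>+x. f (c * x) \<partial>half_lborel)"
    by (simp add: nn_integral_half_lborel)
  finally have "(\<integral>\<^sup>+x. f x \<partial>half_lborel) = ennreal c * (\<integral>\<^sup>+x. f (c * x) \<partial>half_lborel)" .
  then have "ennreal (1/c) * (\<integral>\<^sup>+x. f x \<partial>half_lborel)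
      = (ennreal (1/c) * ennreal c) * (\<integral>\<^sup>+x. f (c * x) \<partial>half_lborel)"
    by (simp add: mult.assoc)
  also have "ennreal (1/c) * ennreal c = 1"
    using assms(2) by (simp flip: ennreal_mult)
  finally show ?thesis by simp
qed

text \<open>Product measures are determined by their values on boxes, and renaming coordinates maps
  boxes to boxes. It identifies a block of pairs (factor, coordinate) with a set of coordinates, and
  \<open>Basis\<close> with an index type.\<close>

lemma nn_integral_PiM_reindex:
  fixes f :: "'i \<Rightarrow> 'j"
  assumes M: "sigma_finite_measure M" and fin: "finite S" and inj: "inj_on f S"
    and g: "g \<in> borel_measurable (PiM S (\<lambda>_. M))"
  shows "(\<integral>\<^sup>+x. g (\<lambda>s\<in>S. x (f s)) \<partial>PiM (f ` S) (\<lambda>_. M)) = (\<integral>\<^sup>+x. g x \<partial>PiM S (\<lambda>_. M))"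
proof -
  interpret M: sigma_finite_measure M by fact
  interpret I: product_sigma_finite "\<lambda>_::'i. M" by standard
  interpret J: product_sigma_finite "\<lambda>_::'j. M" by standard
  have T [measurable]: "(\<lambda>x. \<lambda>s\<in>S. x (f s)) \<in> measurable (PiM (f ` S) (\<lambda>_. M)) (PiM S (\<lambda>_. M))"
    by (intro measurable_restrict measurable_component_singleton) auto
  have "distr (PiM (f ` S) (\<lambda>_. M)) (PiM S (\<lambda>_. M)) (\<lambda>x. \<lambda>s\<in>S. x (f s)) = PiM S (\<lambda>_. M)" (is "?D = _")
  proof (rule I.PiM_eqI)
    fix A :: "'i \<Rightarrow> 'a set" assume A: "\<And>i. i \<in> S \<Longrightarrow> A i \<in> sets M"
    define B where "B = (\<lambda>j. A (the_inv_into S f j))"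
    have B: "B (f i) = A i" if "i \<in> S" for i
      using that inj by (simp add: B_def the_inv_into_f_f)
    have "emeasure ?D (Pi\<^sub>E S A) = emeasure (PiM (f ` S) (\<lambda>_. M))
       ((\<lambda>x. \<lambda>s\<in>S. x (f s)) -` (Pi\<^sub>E S A) \<inter> space (PiM (f ` S) (\<lambda>_. M)))"
      by (rule emeasure_distr[OF T]) (auto intro!: sets_PiM_I_finite fin A)
    also have "(\<lambda>x. \<lambda>s\<in>S. x (f s)) -` (Pi\<^sub>E S A) \<inter> space (PiM (f ` S) (\<lambda>_. M)) = Pi\<^sub>E (f ` S) B"
      using A[THEN sets.sets_into_space] by (auto simp: space_PiM PiE_iff B Pi_iff) blast+
    also have "emeasure (PiM (f ` S) (\<lambda>_. M)) \<dots> = (\<Prod>j\<in>f ` S. emeasure M (B j))"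
      by (rule J.emeasure_PiM) (auto simp: fin B A)
    also have "\<dots> = (\<Prod>i\<in>S. emeasure M (A i))"
      using inj by (simp add: prod.reindex B)
    finally show "emeasure ?D (Pi\<^sub>E S A) = (\<Prod>i\<in>S. emeasure M (A i))" .
  qed (auto simp: fin)
  then have "(\<integral>\<^sup>+x. g x \<partial>PiM S (\<lambda>_. M)) = (\<integral>\<^sup>+x. g x \<partial>?D)" by simp
  also have "\<dots> = (\<integral>\<^sup>+x. g (\<lambda>s\<in>S. x (f s)) \<partial>PiM (f ` S) (\<lambda>_. M))"
    by (rule nn_integral_distr[OF T]) (use g in simp)
  finally show ?thesis ..
qed

text \<open>Fubini, one coordinate at a time, with \<open>c i\<close> the inverse Jacobian of
  \<open>T i\<close>. Left abstract because it is applied to dilations of the half-line and to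
  translations and reflections of the line.\<close>

lemma nn_integral_PiM_transform:
  fixes S :: "'i set"
  assumes M: "sigma_finite_measure M" and fin: "finite S"
    and g: "g \<in> borel_measurable (PiM S (\<lambda>_. M))"
    and T: "\<And>i. i \<in> S \<Longrightarrow> T i \<in> measurable M M"
    and c: "\<And>i f. i \<in> S \<Longrightarrow> f \<in> borel_measurable M \<Longrightarrow> (\<integral>\<^sup>+x. f (T i x) \<partial>M) = c i * (\<integral>\<^sup>+x. f x \<partial>M)"
  shows "(\<integral>\<^sup>+x. g (\<lambda>i\<in>S. T i (x i)) \<partial>PiM S (\<lambda>_. M)) = (\<Prod>i\<in>S. c i) * (\<integral>\<^sup>+x. g x \<partial>PiM S (\<lambda>_. M))"
  using fin g T c
proof (induction S arbitrary: g rule: finite_induct)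
  case empty
  show ?case using empty by (simp add: PiM_empty nn_integral_count_space_finite)
next
  case (insert i S)
  interpret M: sigma_finite_measure M by fact
  interpret I: product_sigma_finite "\<lambda>_::'i. M" by standard
  note g[measurable] = insert.prems(1)
  note T[measurable] = insert.prems(2)
  have meas: "(\<lambda>x. \<lambda>k\<in>insert i S. T k (x k)) \<in> measurable (PiM (insert i S) (\<lambda>_. M)) (PiM (insert i S) (\<lambda>_. M))"
    by (intro measurable_restrict) (auto intro!: measurable_compose[OF measurable_component_singleton] T)
  have meas_upd: "(\<lambda>x. g (x(i := y))) \<in> borel_measurable (PiM S (\<lambda>_. M))" if "y \<in> space M" for y
    using that by (intro measurable_compose[OF _ g]) measurable
  have pair: "(\<lambda>(x,y). g (x(i := y))) \<in> borel_measurable (PiM S (\<lambda>_. M) \<Otimes>\<^sub>M M)"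
    by measurable
  have "(\<integral>\<^sup>+x. g (\<lambda>k\<in>insert i S. T k (x k)) \<partial>PiM (insert i S) (\<lambda>_. M))
      = (\<integral>\<^sup>+y. \<integral>\<^sup>+x. g (\<lambda>k\<in>insert i S. T k ((x(i := y)) k)) \<partial>PiM S (\<lambda>_. M) \<partial>M)"
    by (rule I.product_nn_integral_insert_rev[OF insert.hyps]) (rule measurable_compose[OF meas g])
  also have "\<dots> = (\<integral>\<^sup>+y. \<integral>\<^sup>+x. g ((\<lambda>k\<in>S. T k (x k))(i := T i y)) \<partial>PiM S (\<lambda>_. M) \<partial>M)"
    using insert.hyps by (intro nn_integral_cong arg_cong[where f = g]) (auto simp: fun_eq_iff)
  also have "\<dots> = (\<integral>\<^sup>+y. (\<Prod>k\<in>S. c k) * (\<integral>\<^sup>+x. g (x(i := T i y)) \<partial>PiM S (\<lambda>_. M)) \<partial>M)"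
  proof (intro nn_integral_cong)
    fix y assume "y \<in> space M"
    then have "T i y \<in> space M"
      by (intro measurable_space[OF T]) auto
    then show "(\<integral>\<^sup>+x. g ((\<lambda>k\<in>S. T k (x k))(i := T i y)) \<partial>PiM S (\<lambda>_. M))
      = (\<Prod>k\<in>S. c k) * (\<integral>\<^sup>+x. g (x(i := T i y)) \<partial>PiM S (\<lambda>_. M))"
      by (intro insert.IH[OF meas_upd]) (simp_all add: insert.prems(2,3))
  qed
  also have "\<dots> = c i * (\<integral>\<^sup>+y. (\<Prod>k\<in>S. c k) * (\<integral>\<^sup>+x. g (x(i := y)) \<partial>PiM S (\<lambda>_. M)) \<partial>M)"
  proof -
    interpret S: finite_product_sigma_finite "\<lambda>_::'i. M" S by standard fact
    have "(\<lambda>y. \<integral>\<^sup>+x. g (x(i := y)) \<partial>PiM S (\<lambda>_. M)) \<in> borel_measurable M"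
      using pair by measurable
    then show ?thesis by (subst insert.prems(3)) auto
  qed
  also have "\<dots> = c i * ((\<Prod>k\<in>S. c k) * (\<integral>\<^sup>+y. \<integral>\<^sup>+x. g (x(i := y)) \<partial>PiM S (\<lambda>_. M) \<partial>M))"
  proof -
    interpret S: finite_product_sigma_finite "\<lambda>_::'i. M" S by standard fact
    have "(\<lambda>y. \<integral>\<^sup>+x. g (x(i := y)) \<partial>PiM S (\<lambda>_. M)) \<in> borel_measurable M"
      using pair by measurable
    then show ?thesis by (subst nn_integral_cmult) auto
  qed
  also have "(\<integral>\<^sup>+y. \<integral>\<^sup>+x. g (x(i := y)) \<partial>PiM S (\<lambda>_. M) \<partial>M) = (\<integral>\<^sup>+x. g x \<partial>PiM (insert i S) (\<lambda>_. M))"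
    by (rule I.product_nn_integral_insert_rev[OF insert.hyps, symmetric]) fact
  finally show ?case
    using insert.hyps by (simp add: mult.assoc)
qed

lemma nn_integral_PiM_half_lborel:
  assumes S: "finite S" and g [measurable]: "g \<in> borel_measurable (PiM S (\<lambda>_. lborel :: real measure))"
  shows "(\<integral>\<^sup>+x. g x \<partial>orthant_measure S) = (\<integral>\<^sup>+x. g x * (\<Prod>i\<in>S. indicator {0..} (x i)) \<partial>PiM S (\<lambda>_. lborel))"
proof -
  let ?p = "\<lambda>x. \<Prod>i\<in>S. indicator {0..} (x i) :: ennreal"
  have "density (PiM S (\<lambda>_. lborel)) ?p = orthant_measure S"
  proof (rule half.PiM_eqI[OF S])
    show "sets (density (PiM S (\<lambda>_. lborel)) ?p) = sets (orthant_measure S)"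
      by (simp, intro sets_PiM_cong) auto
    fix A :: "'a \<Rightarrow> real set" assume "\<And>i. i \<in> S \<Longrightarrow> A i \<in> sets half_lborel"
    then have A [measurable]: "\<And>i. i \<in> S \<Longrightarrow> A i \<in> sets borel" by simp
    have "emeasure (density (PiM S (\<lambda>_. lborel)) ?p) (Pi\<^sub>E S A)
       = (\<integral>\<^sup>+x. ?p x * indicator (Pi\<^sub>E S A) x \<partial>PiM S (\<lambda>_. lborel))"
      by (rule emeasure_density) (use S A in \<open>auto intro!: sets_PiM_I_finite\<close>)
    also have "\<dots> = (\<integral>\<^sup>+x. (\<Prod>i\<in>S. indicator (A i \<inter> {0..}) (x i)) \<partial>PiM S (\<lambda>_. lborel))"
    proof (rule nn_integral_cong)
      fix x :: "'a \<Rightarrow> real" assume "x \<in> space (PiM S (\<lambda>_. lborel))"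
      then have "indicator (Pi\<^sub>E S A) x = (\<Prod>i\<in>S. indicator (A i) (x i) :: ennreal)"
        using S by (auto simp: indicator_def space_PiM PiE_iff prod_zero_iff)
      then show "?p x * indicator (Pi\<^sub>E S A) x = (\<Prod>i\<in>S. indicator (A i \<inter> {0..}) (x i))"
        by (simp add: indicator_inter_arith prod.distrib mult.commute)
    qed
    also have "\<dots> = (\<Prod>i\<in>S. emeasure half_lborel (A i))"
      using S A by (subst full.product_nn_integral_prod) (auto simp: emeasure_half_lborel)
    finally show "emeasure (density (PiM S (\<lambda>_. lborel)) ?p) (Pi\<^sub>E S A) = (\<Prod>i\<in>S. emeasure half_lborel (A i))" .
  qed
  then have "(\<integral>\<^sup>+x. g x \<partial>orthant_measure S) = (\<integral>\<^sup>+x. g x \<partial>density (PiM S (\<lambda>_. lborel)) ?p)" by simp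
  also have "\<dots> = (\<integral>\<^sup>+x. g x * ?p x \<partial>PiM S (\<lambda>_. lborel))"
    by (subst nn_integral_density) (simp_all add: mult.commute)
  finally show ?thesis .
qed

text \<open>Serves twice: to factor the exponential of a sum of potentials over the fibers of a map,
  and to factor the volume of a piece over the p + 1 bodies.\<close>

lemma nn_integral_PiM_partition:
  fixes S :: "'b \<Rightarrow> 'i set"
  assumes M: "sigma_finite_measure M" and "finite B" and "\<And>b. b \<in> B \<Longrightarrow> finite (S b)"
    and "disjoint_family_on S B"
    and "\<And>b. b \<in> B \<Longrightarrow> g b \<in> borel_measurable (PiM (S b) (\<lambda>_. M))"
  shows "(\<integral>\<^sup>+x. (\<Prod>b\<in>B. g b (restrict x (S b))) \<partial>PiM (\<Union>b\<in>B. S b) (\<lambda>_. M)) = (\<Prod>b\<in>B. \<integral>\<^sup>+x. g b x \<partial>PiM (S b) (\<lambda>_. M))"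
  using assms(2-)
proof (induction B rule: finite_induct)
  case empty
  have "emeasure (PiM {} (\<lambda>_::'i. M)) {\<lambda>_. undefined} = 1"
    by (rule emeasure_PiM_empty)
  then show ?case by (simp add: space_PiM_empty)
next
  case (insert b B)
  interpret M: sigma_finite_measure M by (rule M)
  interpret I: product_sigma_finite "\<lambda>_::'i. M" by standard
  define U where "U = (\<Union>b\<in>B. S b)"
  have disj: "S b \<inter> U = {}"
  proof -
    have "S b \<inter> S b' = {}" if "b' \<in> B" for b'
      using insert.hyps(2) that by (intro disjoint_family_onD[OF insert.prems(2)]) auto
    then show ?thesis by (auto simp: U_def)
  qed
  have fin: "finite U" "finite (S b)" using insert.hyps insert.prems(1) unfolding U_def by auto
  have IH: "(\<integral>\<^sup>+x. (\<Prod>b\<in>B. g b (restrict x (S b))) \<partial>PiM U (\<lambda>_. M)) = (\<Prod>b\<in>B. \<integral>\<^sup>+x. g b x \<partial>PiM (S b) (\<lambda>_. M))"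
    unfolding U_def using insert.prems(2) by (intro insert.IH insert.prems) (auto simp: disjoint_family_on_def)
  have restr[measurable]: "(\<lambda>x. restrict x (S b')) \<in> measurable (PiM (S b \<union> U) (\<lambda>_. M)) (PiM (S b') (\<lambda>_. M))" if "b' \<in> insert b B" for b'
    using that by (intro measurable_restrict_subset) (auto simp: U_def)
  have restr'[measurable]: "(\<lambda>x. restrict x (S b')) \<in> measurable (PiM U (\<lambda>_. M)) (PiM (S b') (\<lambda>_. M))" if "b' \<in> B" for b'
    using that by (intro measurable_restrict_subset) (auto simp: U_def)
  have m1: "(\<lambda>x. g b' (restrict x (S b'))) \<in> borel_measurable (PiM (S b \<union> U) (\<lambda>_. M))" if "b' \<in> insert b B" for b'
    using restr[OF that] insert.prems(3)[OF that] by (rule measurable_compose)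
  have m2: "(\<lambda>x. g b' (restrict x (S b'))) \<in> borel_measurable (PiM U (\<lambda>_. M))" if "b' \<in> B" for b'
    by (rule measurable_compose[OF restr'[OF that] insert.prems(3)]) (use that in simp)
  have "(\<integral>\<^sup>+x. (\<Prod>b\<in>insert b B. g b (restrict x (S b))) \<partial>PiM (S b \<union> U) (\<lambda>_. M))
    = (\<integral>\<^sup>+x. \<integral>\<^sup>+y. (\<Prod>b'\<in>insert b B. g b' (restrict (merge (S b) U (x, y)) (S b'))) \<partial>PiM U (\<lambda>_. M) \<partial>PiM (S b) (\<lambda>_. M))"
    by (rule I.product_nn_integral_fold[OF disj fin(2,1)])
      (intro borel_measurable_prod_ennreal m1)
  also have "\<dots> = (\<integral>\<^sup>+x. \<integral>\<^sup>+y. g b x * (\<Prod>b'\<in>B. g b' (restrict y (S b'))) \<partial>PiM U (\<lambda>_. M) \<partial>PiM (S b) (\<lambda>_. M))"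
  proof (intro nn_integral_cong)
    fix x y assume x: "x \<in> space (PiM (S b) (\<lambda>_. M))"
    have 1: "restrict (merge (S b) U (x, y)) (S b) = x"
      using x by (auto simp: fun_eq_iff merge_def space_PiM PiE_iff extensional_def)
    have 2: "restrict (merge (S b) U (x, y)) (S b') = restrict y (S b')" if "b' \<in> B" for b'
      using that disj by (auto simp: fun_eq_iff merge_def U_def restrict_def)
    show "(\<Prod>b'\<in>insert b B. g b' (restrict (merge (S b) U (x, y)) (S b'))) = g b x * (\<Prod>b'\<in>B. g b' (restrict y (S b')))"
      using insert.hyps by (simp add: 1 2)
  qed
  also have "\<dots> = (\<integral>\<^sup>+x. g b x * (\<integral>\<^sup>+y. (\<Prod>b'\<in>B. g b' (restrict y (S b'))) \<partial>PiM U (\<lambda>_. M)) \<partial>PiM (S b) (\<lambda>_. M))"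
    by (intro nn_integral_cong nn_integral_cmult borel_measurable_prod_ennreal m2)
  also have "\<dots> = (\<integral>\<^sup>+x. g b x \<partial>PiM (S b) (\<lambda>_. M)) * (\<integral>\<^sup>+y. (\<Prod>b'\<in>B. g b' (restrict y (S b'))) \<partial>PiM U (\<lambda>_. M))"
    by (intro nn_integral_multc insert.prems) auto
  finally show ?case by (simp only: UN_insert U_def[symmetric] IH prod.insert[OF insert.hyps])
qed



section \<open>The one-dimensional Prekopa-Leindler inequality on the half-line\<close>

lemma nn_integral_layer_cake:
  assumes "sigma_finite_measure M" and [measurable]: "f \<in> borel_measurable M"
  shows "(\<integral>\<^sup>+x. ennreal (f x) \<partial>M) = (\<integral>\<^sup>+r. emeasure M {x\<in>space M. r < f x} \<partial>half_lborel)"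
proof -
  interpret M: sigma_finite_measure M by (rule assms)
  interpret P: pair_sigma_finite M half_lborel by standard
  have "(\<integral>\<^sup>+x. ennreal (f x) \<partial>M) = (\<integral>\<^sup>+x. (\<integral>\<^sup>+r. indicator {..<f x} r \<partial>half_lborel) \<partial>M)"
  proof (intro nn_integral_cong)
    fix x
    have "(\<integral>\<^sup>+r. indicator {..<f x} r \<partial>half_lborel) = (\<integral>\<^sup>+r. indicator {..<f x} r * indicator {0..} r \<partial>lborel)"
      by (rule nn_integral_half_lborel) simp
    also have "\<dots> = (\<integral>\<^sup>+r. indicator {0..<f x} r \<partial>lborel)"
      by (intro nn_integral_cong) (auto simp: indicator_def)
    also have "\<dots> = ennreal (f x)"
      by (cases "0 \<le> f x") (auto simp: ennreal_neg)
    finally show "ennreal (f x) = (\<integral>\<^sup>+r. indicator {..<f x} r \<partial>half_lborel)" ..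
  qed
  also have "\<dots> = (\<integral>\<^sup>+x. (\<integral>\<^sup>+r. indicator {p\<in>space (M \<Otimes>\<^sub>M half_lborel). snd p < f (fst p)} (x, r) \<partial>half_lborel) \<partial>M)"
    by (intro nn_integral_cong) (auto simp: indicator_def space_pair_measure)
  also have "\<dots> = (\<integral>\<^sup>+r. (\<integral>\<^sup>+x. indicator {p\<in>space (M \<Otimes>\<^sub>M half_lborel). snd p < f (fst p)} (x, r) \<partial>M) \<partial>half_lborel)"
    by (rule P.Fubini'[symmetric]) (simp add: case_prod_beta')
  also have "\<dots> = (\<integral>\<^sup>+r. (\<integral>\<^sup>+x. indicator {x\<in>space M. r < f x} x \<partial>M) \<partial>half_lborel)"
    by (intro nn_integral_cong) (auto simp: indicator_def space_pair_measure)
  also have "\<dots> = (\<integral>\<^sup>+r. emeasure M {x\<in>space M. r < f x} \<partial>half_lborel)"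
    by (intro nn_integral_cong nn_integral_indicator) measurable
  finally show ?thesis .
qed

text \<open>The set lies between 0 and its supremum. For superlevel sets of decreasing functions,
  which are intervals from 0, nothing is lost, and this bound takes the place of the one-dimensional
  Brunn-Minkowski inequality.\<close>

lemma emeasure_half_lborel_le_SUP:
  assumes [measurable]: "D \<in> sets borel"
  shows "emeasure half_lborel D \<le> (SUP x\<in>D \<inter> {0..}. ennreal x)"
proof (cases "(SUP x\<in>D \<inter> {0..}. ennreal x) = top")
  case False
  then obtain c where c: "(SUP x\<in>D \<inter> {0..}. ennreal x) = ennreal c" "0 \<le> c"
    by (cases "(SUP x\<in>D \<inter> {0..}. ennreal x)") auto
  have "D \<inter> {0..} \<subseteq> {0..c}"
  proof
    fix x assume x: "x \<in> D \<inter> {0..}"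
    then have "ennreal x \<le> ennreal c" unfolding c(1)[symmetric] by (rule SUP_upper)
    then show "x \<in> {0..c}" using x c(2) by auto
  qed
  then have "emeasure lborel (D \<inter> {0..}) \<le> emeasure lborel {0..c}"
    by (intro emeasure_mono) auto
  then show ?thesis using c by (simp add: emeasure_half_lborel)
next
  case True
  then show ?thesis by (simp only: top_greatest)
qed

lemma integral_pos_half_lborel:
assumes u: "integrable half_lborel u" "\<And>x. (0::real) < u x"
shows "0 < (LINT x|half_lborel. u x)"
proof -
  have "(LINT x|half_lborel. u x) \<noteq> 0"
  proof
    assume "(LINT x|half_lborel. u x) = 0"
    then have "AE x in half_lborel. u x = 0"
      using u by (subst (asm) integral_nonneg_eq_0_iff_AE) (auto simp: less_imp_le)
    then have "AE x in half_lborel. False"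
      by eventually_elim (use u(2) in \<open>auto simp: less_le\<close>)
    then have "emeasure half_lborel UNIV = 0"
      by (simp add: AE_iff_null null_sets_def)
    moreover have "emeasure half_lborel {0..1} \<le> emeasure half_lborel UNIV"
      by (intro emeasure_mono) auto
    moreover have "emeasure half_lborel {0..1} = 1" by (simp add: emeasure_half_lborel)
    ultimately show False by simp
  qed
  moreover have "0 \<le> (LINT x|half_lborel. u x)" using u(2) by (intro Bochner_Integration.integral_nonneg) (simp add: less_imp_le)
  ultimately show ?thesis by simp
qed

text \<open>At every height the superlevel set of \<open>h\<close> contains the combinations of
  points of those of \<open>f\<close> and \<open>g\<close>, so its length is at least the
  combination of their lengths. Integrating over the heights gives an arithmetic-mean inequality for
  the normalised functions.\<close>

lemma Prekopa_Leindler_decreasing: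
  fixes f g h :: "real \<Rightarrow> real"
  assumes f: "\<And>x y. x \<le> y \<Longrightarrow> f y \<le> f x" "\<And>x. 0 < f x" "integrable half_lborel f"
    and g: "\<And>x y. x \<le> y \<Longrightarrow> g y \<le> g x" "\<And>x. 0 < g x" "integrable half_lborel g"
    and h: "\<And>x. 0 < h x" "integrable half_lborel h"
    and t: "0 \<le> t" "t \<le> 1"
    and fgh: "\<And>x y. 0 \<le> x \<Longrightarrow> 0 \<le> y \<Longrightarrow> f x powr (1 - t) * g y powr t \<le> h ((1 - t) * x + t * y)"
  shows "(LINT x|half_lborel. f x) powr (1 - t) * (LINT x|half_lborel. g x) powr t \<le> (LINT x|half_lborel. h x)"
proof -
  \<comment> \<open>Values at 0 are the maxima on the half-line; with both scaled to 1, the two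
    superlevel sets become empty at the same height r = 1. \<open>m\<close> is the matching scale
    for \<open>h\<close>.\<close>
  define F G where "F = (\<lambda>x. f x / f 0)" and "G = (\<lambda>x. g x / g 0)"
  define m where "m = f 0 powr (1 - t) * g 0 powr t"
  define H where "H = (\<lambda>x. h x / m)"
  have m: "0 < m" using f(2)[of 0] g(2)[of 0] by (simp add: m_def)
  have anti: "antimono F" "antimono G"
    using f(1) g(1) f(2)[of 0] g(2)[of 0] by (auto simp: F_def G_def antimono_def divide_right_mono)
  have [measurable]: "f \<in> borel_measurable borel" "g \<in> borel_measurable borel" "h \<in> borel_measurable borel"
    using f(3) g(3) h(2)
    by (auto dest!: borel_measurable_integrable simp: measurable_cong_sets[OF sets_half_lborel refl])
  have [measurable]: "F \<in> borel_measurable borel" "G \<in> borel_measurable borel" "H \<in> borel_measurable borel"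
    unfolding F_def G_def H_def by measurable
  have FG1: "F x \<le> 1" "G x \<le> 1" if "0 \<le> x" for x
    using that f(1)[OF that] g(1)[OF that] f(2)[of 0] g(2)[of 0] by (auto simp: F_def G_def)
  have pos: "0 < F x" "0 < G x" "0 < H x" for x
    using f(2) g(2) h(1) m by (auto simp: F_def G_def H_def)
  have FGH: "F x powr (1 - t) * G y powr t \<le> H ((1 - t) * x + t * y)" if "0 \<le> x" "0 \<le> y" for x y
  proof -
    have "F x powr (1 - t) * G y powr t = (f x powr (1 - t) * g y powr t) / m"
      using f(2) g(2) by (simp add: F_def G_def m_def powr_divide less_imp_le)
    also have "\<dots> \<le> H ((1 - t) * x + t * y)"
      unfolding H_def using m by (intro divide_right_mono fgh that) auto
    finally show ?thesis .
  qed
  have level: "ennreal (1 - t) * emeasure half_lborel {x. r < F x} + ennreal t * emeasure half_lborel {x. r < G x}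
     \<le> emeasure half_lborel {x. r < H x}" if r: "0 \<le> r" for r
  proof (cases "r < 1")
    case False
    have "emeasure half_lborel {x. r < F x} = 0"
    proof -
      have "{x. r < F x} \<inter> {0..} = {}"
        using FG1(1) False by (fastforce simp: not_less)
      then show ?thesis by (simp add: emeasure_half_lborel)
    qed
    moreover have "emeasure half_lborel {x. r < G x} = 0"
    proof -
      have "{x. r < G x} \<inter> {0..} = {}"
        using FG1(2) False by (fastforce simp: not_less)
      then show ?thesis by (simp add: emeasure_half_lborel)
    qed
    ultimately show ?thesis by simp
  next
    case True
    define A B where "A = {x. r < F x} \<inter> {0..}" and "B = {x. r < G x} \<inter> {0..}"
    have "0 \<in> A" "0 \<in> B"
      using True f(2)[of 0] g(2)[of 0] by (auto simp: A_def B_def F_def G_def)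
    then have ne: "A \<noteq> {}" "B \<noteq> {}" by auto
    have le: "ennreal (1 - t) * ennreal x + ennreal t * ennreal y \<le> emeasure half_lborel {x. r < H x}"
      if x: "x \<in> A" and y: "y \<in> B" for x y
    proof -
      have xy: "0 \<le> x" "0 \<le> y" "r < F x" "r < G y" using x y by (auto simp: A_def B_def)
      define z where "z = (1 - t) * x + t * y"
      have z0: "0 \<le> z" using xy t by (simp add: z_def)
      \<comment> \<open>The single point z gives no interval by itself, as \<open>h\<close> may fail
        to decrease: each w below z is reached by shrinking x and y by the same factor
        \<open>s\<close>, which keeps them in their superlevel sets.\<close>
      have sub: "{0..z} \<subseteq> {x. r < H x} \<inter> {0..}"
      proof
        fix w assume w: "w \<in> {0..z}"
        define s where "s = (if z = 0 then 1 else w / z)"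
        have s: "0 \<le> s" "s \<le> 1" "w = s * z" using w by (auto simp: s_def divide_simps)
        have sxy: "s * x \<le> x" "s * y \<le> y" "0 \<le> s * x" "0 \<le> s * y"
          using s xy by (auto simp: mult_left_le_one_le)
        have "r < F (s * x)" "r < G (s * y)"
          using xy(3,4) antimonoD[OF anti(1) sxy(1)] antimonoD[OF anti(2) sxy(2)] by linarith+
        then have "r powr (1 - t) * r powr t < F (s * x) powr (1 - t) * G (s * y) powr t"
          using t r
          by (cases "t = 0"; cases "t = 1")
             (auto intro!: mult_strict_mono powr_less_mono2 simp: pos less_imp_le)
        also have "r powr (1 - t) * r powr t = r"
          using r by (simp flip: powr_add)
        also have "F (s * x) powr (1 - t) * G (s * y) powr t \<le> H ((1 - t) * (s * x) + t * (s * y))"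
          by (rule FGH) (use sxy in auto)
        also have "(1 - t) * (s * x) + t * (s * y) = w"
          by (simp add: s(3) z_def algebra_simps)
        finally show "w \<in> {x. r < H x} \<inter> {0..}" using w by auto
      qed
      have "ennreal (1 - t) * ennreal x + ennreal t * ennreal y = ennreal z"
        using t xy by (simp add: z_def ennreal_mult ennreal_plus flip: ennreal_mult ennreal_plus)
      also have "\<dots> = emeasure lborel {0..z}" using z0 by simp
      also have "\<dots> \<le> emeasure lborel ({x. r < H x} \<inter> {0..})"
        by (intro emeasure_mono sub) auto
      also have "\<dots> = emeasure half_lborel {x. r < H x}"
        by (rule emeasure_half_lborel[symmetric]) auto
      finally show ?thesis .
    qed
    have "ennreal (1 - t) * emeasure half_lborel {x. r < F x} + ennreal t * emeasure half_lborel {x. r < G x}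
      \<le> ennreal (1 - t) * (SUP x\<in>A. ennreal x) + ennreal t * (SUP y\<in>B. ennreal y)"
      unfolding A_def B_def by (intro add_mono mult_left_mono emeasure_half_lborel_le_SUP) auto
    also have "\<dots> = (SUP x\<in>A. SUP y\<in>B. ennreal (1 - t) * ennreal x + ennreal t * ennreal y)"
      using ne by (simp only: SUP_mult_left_ennreal ennreal_SUP_add_right[symmetric] ennreal_SUP_add_left[symmetric] not_False_eq_True)
    also have "\<dots> \<le> emeasure half_lborel {x. r < H x}"
      by (intro SUP_least le)
    finally show ?thesis .
  qed
  have int: "integrable half_lborel F" "integrable half_lborel G" "integrable half_lborel H"
    unfolding F_def G_def H_def using f(3) g(3) h(2) by auto
  have cake: "ennreal (LINT x|half_lborel. u x) = (\<integral>\<^sup>+r. emeasure half_lborel {x. r < u x} \<partial>half_lborel)"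
    if "integrable half_lborel u" "\<And>x. 0 < u x" for u :: "real \<Rightarrow> real"
    using that nn_integral_layer_cake[OF sigma_finite_half_lborel, of u]
    by (subst nn_integral_eq_integral[symmetric]) (auto simp: less_imp_le)
  have lm: "(\<lambda>r. emeasure half_lborel {x. r < u x}) \<in> borel_measurable borel" if [measurable]: "u \<in> borel_measurable borel" for u :: "real \<Rightarrow> real"
  proof -
    have "{p \<in> space (borel \<Otimes>\<^sub>M borel). fst p < u (snd p)} \<in> sets (borel \<Otimes>\<^sub>M borel)"
      by measurable
    moreover have "sets (borel \<Otimes>\<^sub>M borel) = sets (borel \<Otimes>\<^sub>M half_lborel)"
      by (intro sets_pair_measure_cong) auto
    ultimately have "{(r, x). r < u x} \<in> sets (borel \<Otimes>\<^sub>M half_lborel)"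
      by (simp add: space_pair_measure case_prod_beta')
    then show ?thesis
      using half_lborel.measurable_emeasure_Pair[of "{(r, x). r < u x}" borel] by (simp add: vimage_def)
  qed
  have "ennreal (1 - t) * ennreal (LINT x|half_lborel. F x) + ennreal t * ennreal (LINT x|half_lborel. G x)
     = (\<integral>\<^sup>+r. ennreal (1 - t) * emeasure half_lborel {x. r < F x} + ennreal t * emeasure half_lborel {x. r < G x} \<partial>half_lborel)"
    using int pos lm[of F] lm[of G]
    by (simp add: cake nn_integral_add nn_integral_cmult)
  also have "\<dots> \<le> (\<integral>\<^sup>+r. emeasure half_lborel {x. r < H x} \<partial>half_lborel)"
    by (rule nn_integral_mono_AE, rule eventually_mono[OF AE_half_lborel level])
  also have "\<dots> = ennreal (LINT x|half_lborel. H x)"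
    using int pos by (simp add: cake)
  finally have "ennreal ((1 - t) * (LINT x|half_lborel. F x) + t * (LINT x|half_lborel. G x)) \<le> ennreal (LINT x|half_lborel. H x)"
    using t pos by (simp add: ennreal_mult ennreal_plus Bochner_Integration.integral_nonneg less_imp_le)
  then have le: "(1 - t) * (LINT x|half_lborel. F x) + t * (LINT x|half_lborel. G x) \<le> (LINT x|half_lborel. H x)"
    using pos by (subst (asm) ennreal_le_iff) (auto simp: less_imp_le)
  \<comment> \<open>The weighted mean inequality passes to the multiplicative form, in which the
    normalisation by f(0), g(0) and \<open>m\<close> can be undone.\<close>
  have "(LINT x|half_lborel. F x) powr (1 - t) * (LINT x|half_lborel. G x) powr t \<le> (LINT x|half_lborel. H x)"
    using Youngs_inequality_0[of "1 - t" t "LINT x|half_lborel. F x" "LINT x|half_lborel. G x"] t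
      integral_pos_half_lborel[OF int(1) pos(1)] integral_pos_half_lborel[OF int(2) pos(2)] le by auto
  moreover have "(LINT x|half_lborel. F x) = (LINT x|half_lborel. f x) / f 0"
    "(LINT x|half_lborel. G x) = (LINT x|half_lborel. g x) / g 0"
    "(LINT x|half_lborel. H x) = (LINT x|half_lborel. h x) / m"
    by (simp_all add: F_def G_def H_def)
  ultimately have "((LINT x|half_lborel. f x) / f 0) powr (1 - t) * ((LINT x|half_lborel. g x) / g 0) powr t
     \<le> (LINT x|half_lborel. h x) / m" by simp
  moreover have "((LINT x|half_lborel. f x) / f 0) powr (1 - t) * ((LINT x|half_lborel. g x) / g 0) powr t
     = (LINT x|half_lborel. f x) powr (1 - t) * (LINT x|half_lborel. g x) powr t / m"
    using integral_pos_half_lborel[OF f(3) f(2)] integral_pos_half_lborel[OF g(3) g(2)] f(2)[of 0] g(2)[of 0] by (simp add: powr_divide m_def less_imp_le)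
  ultimately show ?thesis using m by (simp add: divide_le_cancel)
qed

section \<open>Marginals of log-concave functions\<close>

text \<open>Unlike \<open>merge\<close>, it keeps the values of x off the block, so functions of all
  coordinates can be evaluated on faces of the orthant.\<close>

definition override :: "'i set \<Rightarrow> ('i \<Rightarrow> 'a) \<Rightarrow> ('i \<Rightarrow> 'a) \<Rightarrow> 'i \<Rightarrow> 'a" where
  "override S y x = (\<lambda>i. if i \<in> S then y i else x i)"

abbreviation zero_ext :: "'i set \<Rightarrow> ('i \<Rightarrow> real) \<Rightarrow> 'i \<Rightarrow> real" where
  "zero_ext S x \<equiv> override S x (\<lambda>_. 0)"

lemma measurable_override [measurable (raw)]:
  assumes y: "y \<in> measurable N (PiM S (\<lambda>_. M))" and x: "x \<in> measurable N (PiM UNIV (\<lambda>_. M))"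
  shows "(\<lambda>w. override S (y w) (x w)) \<in> measurable N (PiM UNIV (\<lambda>_. M))"
proof (rule measurable_PiM_single')
  fix i
  show "(\<lambda>w. override S (y w) (x w) i) \<in> measurable N M"
    using measurable_compose[OF x measurable_component_singleton[of i]]
      measurable_compose[OF y measurable_component_singleton[of i S]]
    by (cases "i \<in> S") (auto simp: override_def)
qed (use measurable_space[OF x] measurable_space[OF y] in \<open>fastforce simp: space_PiM override_def PiE_iff\<close>)

text \<open>Decay is asked only in the coordinates of \<open>I\<close>, those not yet integrated
  out; the other properties concern all coordinates. Positivity and the exponential bound make the
  integrals positive and finite.\<close>

definition decreasing_log_concave :: "'i set \<Rightarrow> (('i \<Rightarrow> real) \<Rightarrow> real) \<Rightarrow> bool" where
  "decreasing_log_concave I f \<longleftrightarrow>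
     f \<in> borel_measurable (PiM UNIV (\<lambda>_. borel)) \<and>
     (\<forall>x. 0 < f x) \<and> (\<forall>x y. x \<le> y \<longrightarrow> f y \<le> f x) \<and>
     (\<forall>x y t. 0 \<le> t \<longrightarrow> t \<le> 1 \<longrightarrow> f x powr (1 - t) * f y powr t \<le> f (\<lambda>i. (1 - t) * x i + t * y i)) \<and>
     (\<exists>C c. 0 < c \<and> (\<forall>x. f x \<le> C * exp (- c * (\<Sum>i\<in>I. x i))))"

lemma nn_integral_half_lborel_exp:
  assumes "0 < c"
  shows "(\<integral>\<^sup>+s. ennreal (exp (- c * s)) \<partial>half_lborel) = ennreal (1 / c)"
proof -
  have "(\<integral>\<^sup>+s. ennreal (exp (- c * s)) \<partial>half_lborel) = (\<integral>\<^sup>+s. ennreal (exp (- c * s)) * indicator {0..} s \<partial>lborel)"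
    by (rule nn_integral_half_lborel) simp
  also have "\<dots> = ennreal (0 - (- exp (- c * 0) / c))"
  proof (rule nn_integral_FTC_atLeast)
    show "((\<lambda>s. - exp (- c * s) / c) \<longlongrightarrow> 0) at_top"
    proof -
      have "filterlim (\<lambda>s::real. - c * s) at_bot at_top"
        using assms by (intro filterlim_tendsto_neg_mult_at_bot[OF tendsto_const _ filterlim_ident]) auto
      then show ?thesis
        using tendsto_divide[OF tendsto_minus[OF filterlim_compose[OF exp_at_bot]] tendsto_const[of c]] assms by force
    qed
  qed (use assms in \<open>auto intro!: derivative_eq_intros\<close>)
  finally show ?thesis using assms by simp
qed

lemma integrable_half_lborel_exp_bound:
  assumes [measurable]: "f \<in> borel_measurable borel" and "0 < c" and f: "\<And>s. 0 < f s" "\<And>s. f s \<le> C * exp (- c * s)"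
  shows "integrable half_lborel f" "(LINT s|half_lborel. f s) \<le> C / c"
proof -
  have C: "0 \<le> C"
    using f(1)[of 0] f(2)[of 0] by simp
  have "(\<integral>\<^sup>+s. ennreal (f s) \<partial>half_lborel) \<le> (\<integral>\<^sup>+s. ennreal C * ennreal (exp (- c * s)) \<partial>half_lborel)"
    using f(2) C by (intro nn_integral_mono) (simp add: ennreal_leI flip: ennreal_mult)
  also have "\<dots> = ennreal C * ennreal (1 / c)"
    using assms(2) by (subst nn_integral_cmult) (simp_all only: nn_integral_half_lborel_exp, measurable)
  also have "\<dots> = ennreal (C / c)" using C assms(2) by (simp flip: ennreal_mult)
  finally have le: "(\<integral>\<^sup>+s. ennreal (f s) \<partial>half_lborel) \<le> ennreal (C / c)" .
  show int: "integrable half_lborel f"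
    using le f(1) by (intro integrableI_nonneg) (auto simp: less_imp_le intro: le_less_trans)
  have "ennreal (LINT s|half_lborel. f s) \<le> ennreal (C / c)"
    using le int f(1) by (subst nn_integral_eq_integral[symmetric]) (auto simp: less_imp_le)
  then show "(LINT s|half_lborel. f s) \<le> C / c"
    using C assms(2) by (simp add: ennreal_le_iff)
qed

text \<open>Log-concavity is Prekopa-Leindler applied to the lines in direction i, on which the
  function is decreasing. Integrating the exponential bound in coordinate i costs a factor 1 / c,
  and the decay in the remaining coordinates survives.\<close>

lemma decreasing_log_concave_marginal1:
  fixes f :: "('i::finite \<Rightarrow> real) \<Rightarrow> real"
  assumes lc: "decreasing_log_concave (insert i I) f" and i: "i \<notin> I"
  shows "decreasing_log_concave I (\<lambda>x. LINT s|half_lborel. f (x(i := s)))"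
    and "ennreal (LINT s|half_lborel. f (x(i := s))) = (\<integral>\<^sup>+s. ennreal (f (x(i := s))) \<partial>half_lborel)"
proof -
  have f [measurable]: "f \<in> borel_measurable (PiM UNIV (\<lambda>_. borel))"
    and pos: "\<And>x. 0 < f x" and dec: "\<And>x y. x \<le> y \<Longrightarrow> f y \<le> f x"
    and logc: "\<And>x y t. 0 \<le> t \<Longrightarrow> t \<le> 1 \<Longrightarrow> f x powr (1 - t) * f y powr t \<le> f (\<lambda>i. (1 - t) * x i + t * y i)"
    using lc by (auto simp: decreasing_log_concave_def)
  obtain C c where c: "0 < c" and bd: "\<And>x. f x \<le> C * exp (- c * (\<Sum>i\<in>insert i I. x i))"
    using lc by (auto simp: decreasing_log_concave_def)
  have upd: "(\<lambda>p. (fst p)(i := snd p)) \<in> measurable (PiM UNIV (\<lambda>_. borel) \<Otimes>\<^sub>M half_lborel) (PiM UNIV (\<lambda>_::'i. borel :: real measure))"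
    by (rule measurable_fun_upd[where J = UNIV]) auto
  have [measurable]: "(\<lambda>s. f (x(i := s))) \<in> borel_measurable borel" for x
    by (rule measurable_compose[OF _ f], rule measurable_fun_upd[where J = UNIV]) (auto simp: space_PiM)
  define F where "F = (\<lambda>x. LINT s|half_lborel. f (x(i := s)))"
  have bd': "f (x(i := s)) \<le> (C * exp (- c * (\<Sum>k\<in>I. x k))) * exp (- c * s)" for x s
  proof -
    have "(\<Sum>k\<in>I. (x(i := s)) k) = (\<Sum>k\<in>I. x k)" using i by (intro sum.cong) auto
    then have "f (x(i := s)) \<le> C * exp (- c * (s + (\<Sum>k\<in>I. x k)))"
      using bd[of "x(i := s)"] i by (simp add: sum.insert)
    also have "\<dots> = (C * exp (- c * (\<Sum>k\<in>I. x k))) * exp (- c * s)"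
      by (simp add: ring_distribs exp_add[symmetric])
    finally show ?thesis .
  qed
  note int = integrable_half_lborel_exp_bound[where f = "\<lambda>s. f (x(i := s))" for x, OF _ c pos bd']
  show "ennreal (LINT s|half_lborel. f (x(i := s))) = (\<integral>\<^sup>+s. ennreal (f (x(i := s))) \<partial>half_lborel)"
    using pos by (intro nn_integral_eq_integral[symmetric] int(1)) (auto simp: less_imp_le)
  show "decreasing_log_concave I F"
    unfolding decreasing_log_concave_def
  proof (intro conjI allI impI)
    have "(\<lambda>p. f ((fst p)(i := snd p))) \<in> borel_measurable (PiM UNIV (\<lambda>_. borel) \<Otimes>\<^sub>M half_lborel)"
      by (rule measurable_compose[OF upd f])
    then show "F \<in> borel_measurable (PiM UNIV (\<lambda>_. borel))"
      unfolding F_def by (intro half_lborel.borel_measurable_lebesgue_integral) (simp add: case_prod_beta')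
  next
    fix x
    show "0 < F x" unfolding F_def
    proof (rule integral_pos_half_lborel)
      show "integrable half_lborel (\<lambda>s. f (x(i := s)))" by (rule int) simp
    qed (rule pos)
  next
    fix x y :: "'i \<Rightarrow> real" assume "x \<le> y"
    then have "x(i := s) \<le> y(i := s)" for s by (auto simp: le_fun_def)
    then show "F y \<le> F x" unfolding F_def
      by (intro integral_mono int dec) auto
  next
    fix x y :: "'i \<Rightarrow> real" and t :: real assume t: "0 \<le> t" "t \<le> 1"
    define w where "w = (\<lambda>k. (1 - t) * x k + t * y k)"
    have upd_mono: "(z::'i \<Rightarrow> real)(i := s) \<le> z(i := s')" if "s \<le> s'" for s s' z
      using that by (auto simp: le_fun_def)
    show "F x powr (1 - t) * F y powr t \<le> F (\<lambda>k. (1 - t) * x k + t * y k)"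
      unfolding F_def w_def[symmetric]
    proof (rule Prekopa_Leindler_decreasing[OF _ pos _ _ pos _ pos _ t])
      fix s s' :: real
      have "w(i := (1 - t) * s + t * s') = (\<lambda>k. (1 - t) * (x(i := s)) k + t * (y(i := s')) k)"
        by (auto simp: w_def fun_eq_iff)
      then show "f (x(i := s)) powr (1 - t) * f (y(i := s')) powr t \<le> f (w(i := (1 - t) * s + t * s'))"
        using logc[OF t, of "x(i := s)" "y(i := s')"] by simp
    qed (use upd_mono in \<open>auto intro!: dec int\<close>)
  next
    have "F x \<le> (C / c) * exp (- c * (\<Sum>i\<in>I. x i))" for x
      unfolding F_def using int(2)[of x] by simp
    then show "\<exists>C c. 0 < c \<and> (\<forall>x. F x \<le> C * exp (- c * (\<Sum>i\<in>I. x i)))"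
      using c by blast
  qed
qed

text \<open>Iterates the one-coordinate case. Existence of a real-valued function is asserted
  because its \<open>ennreal\<close> image records that the integral is finite.\<close>

lemma ex_marginal:
  fixes f :: "('i::finite \<Rightarrow> real) \<Rightarrow> real"
  assumes "decreasing_log_concave (I \<union> S) f" "I \<inter> S = {}"
  shows "\<exists>G. decreasing_log_concave I G \<and> (\<forall>x. ennreal (G x) = (\<integral>\<^sup>+y. ennreal (f (override S y x)) \<partial>orthant_measure S))"
  using finite[of S] assms
proof (induction S arbitrary: f rule: finite_induct)
  case empty
  have "emeasure (PiM {} (\<lambda>_::'i. half_lborel)) {\<lambda>_. undefined} = 1"
    by (rule emeasure_PiM_empty)
  then show ?case using empty by (intro exI[of _ f]) (simp add: half.nn_integral_empty override_def space_PiM_empty)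
next
  case (insert i S)
  define f1 where "f1 = (\<lambda>x. LINT s|half_lborel. f (x(i := s)))"
  have f [measurable]: "f \<in> borel_measurable (PiM UNIV (\<lambda>_. borel))"
    using insert.prems by (simp add: decreasing_log_concave_def)
  have f1: "decreasing_log_concave (I \<union> S) f1"
    and f1': "\<And>x. ennreal (f1 x) = (\<integral>\<^sup>+s. ennreal (f (x(i := s))) \<partial>half_lborel)"
    using insert.prems insert.hyps decreasing_log_concave_marginal1[of i "I \<union> S" f]
    by (simp_all add: f1_def)
  obtain G where G: "decreasing_log_concave I G"
    "\<And>x. ennreal (G x) = (\<integral>\<^sup>+y. ennreal (f1 (override S y x)) \<partial>orthant_measure S)"
    using insert.IH[OF f1] insert.prems by auto
  show ?case
  proof (intro exI[of _ G] conjI allI G(1))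
    fix x
    have sets_eq: "sets (PiM T (\<lambda>_::'i. half_lborel)) = sets (PiM T (\<lambda>_. borel))" for T
      by (intro sets_PiM_cong) auto
    have ov: "(\<lambda>y. override (insert i S) y x) \<in> measurable (orthant_measure (insert i S)) (orthant_measure UNIV)"
      by (rule measurable_override) (auto simp: space_PiM)
    have "f \<in> borel_measurable (orthant_measure UNIV)"
      using f by (simp cong: measurable_cong_sets add: sets_eq)
    then have "(\<lambda>y. f (override (insert i S) y x)) \<in> borel_measurable (orthant_measure (insert i S))"
      by (rule measurable_compose[OF ov])
    then have "(\<integral>\<^sup>+y. ennreal (f (override (insert i S) y x)) \<partial>orthant_measure (insert i S))
      = (\<integral>\<^sup>+y. \<integral>\<^sup>+s. ennreal (f (override (insert i S) (y(i := s)) x)) \<partial>half_lborel \<partial>orthant_measure S)"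
      by (intro half.product_nn_integral_insert insert.hyps measurable_compose[OF _ measurable_ennreal])
    also have "\<dots> = (\<integral>\<^sup>+y. \<integral>\<^sup>+s. ennreal (f ((override S y x)(i := s))) \<partial>half_lborel \<partial>orthant_measure S)"
      using insert.hyps
      by (intro nn_integral_cong arg_cong[where f = "\<lambda>x. ennreal (f x)"]) (auto simp: override_def fun_eq_iff)
    also have "\<dots> = ennreal (G x)" by (simp add: G(2) f1')
    finally show "ennreal (G x) = (\<integral>\<^sup>+y. ennreal (f (override (insert i S) y x)) \<partial>orthant_measure (insert i S))" ..
  qed
qed

lemma sets_PiM_half_lborel: "sets (orthant_measure S) = sets (PiM S (\<lambda>_. borel))"
  by (intro sets_PiM_cong) auto

lemma measurable_PiM_half_lborel [simp]:
  "measurable (orthant_measure S) M = measurable (PiM S (\<lambda>_. borel)) M"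
  by (intro measurable_cong_sets sets_PiM_half_lborel refl)

section \<open>First moments by comparison with dilates\<close>

lemma nn_integral_PiM_half_lborel_scale:
  assumes [measurable]: "g \<in> borel_measurable (PiM S (\<lambda>_. borel))" and "finite S" "0 < t"
  shows "(\<integral>\<^sup>+x. g (\<lambda>i\<in>S. t * x i) \<partial>orthant_measure S) = ennreal ((1 / t) ^ card S) * (\<integral>\<^sup>+x. g x \<partial>orthant_measure S)"
proof -
  have "(\<integral>\<^sup>+x. g (\<lambda>i\<in>S. t * x i) \<partial>orthant_measure S) = (\<Prod>i\<in>S. ennreal (1 / t)) * (\<integral>\<^sup>+x. g x \<partial>orthant_measure S)"
    by (rule nn_integral_PiM_transform[OF sigma_finite_half_lborel])
      (use assms in \<open>auto simp: nn_integral_half_lborel_scale measurable_cong_sets[OF sets_half_lborel refl] measurable_cong_sets[OF sets_half_lborel sets_half_lborel]\<close>)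
  then show ?thesis using assms by (simp add: ennreal_power)
qed

text \<open>Substituting t x multiplies the integral I of exp(-\<psi>) by t^(-d), with d =
  \<open>card S\<close>, while for t < 1 the ray condition and exp(a) >= 1 + a bound the result from
  below by I + (1 - t) J, with J the left-hand side. Comparing first-order terms at t = 1 gives J <=
  d I.\<close>

lemma nn_integral_times_exp_le:
  assumes [measurable]: "\<psi> \<in> borel_measurable (PiM S (\<lambda>_. borel))" and S: "finite S"
    and pos: "\<And>x. 0 \<le> \<psi> x" and ray: "\<And>t x. 0 \<le> t \<Longrightarrow> t \<le> 1 \<Longrightarrow> \<psi> (\<lambda>i\<in>S. t * x i) \<le> t * \<psi> x"
    and fin: "(\<integral>\<^sup>+x. ennreal (exp (- \<psi> x)) \<partial>orthant_measure S) < \<infinity>"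
  shows "(\<integral>\<^sup>+x. ennreal (\<psi> x * exp (- \<psi> x)) \<partial>orthant_measure S)
     \<le> of_nat (card S) * (\<integral>\<^sup>+x. ennreal (exp (- \<psi> x)) \<partial>orthant_measure S)"
proof -
  define d where "d = card S"
  let ?M = "orthant_measure S"
  obtain I where I: "(\<integral>\<^sup>+x. ennreal (exp (- \<psi> x)) \<partial>?M) = ennreal I" "0 \<le> I"
    using fin by (cases "\<integral>\<^sup>+x. ennreal (exp (- \<psi> x)) \<partial>?M") auto
  define J where "J = (\<integral>\<^sup>+x. ennreal (\<psi> x * exp (- \<psi> x)) \<partial>?M)"
  have step: "ennreal I + ennreal (1 - t) * J \<le> ennreal ((1 / t) ^ d * I)" if t: "0 < t" "t < 1" for t
  proof -
    have "ennreal I + ennreal (1 - t) * J = (\<integral>\<^sup>+x. ennreal (exp (- \<psi> x)) + ennreal (1 - t) * ennreal (\<psi> x * exp (- \<psi> x)) \<partial>?M)"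
      unfolding I(1)[symmetric] J_def by (simp add: nn_integral_add nn_integral_cmult)
    also have "\<dots> \<le> (\<integral>\<^sup>+x. ennreal (exp (- \<psi> (\<lambda>i\<in>S. t * x i))) \<partial>?M)"
    proof (intro nn_integral_mono)
      fix x
      have "exp (- \<psi> x) + (1 - t) * (\<psi> x * exp (- \<psi> x)) = (1 + (1 - t) * \<psi> x) * exp (- \<psi> x)"
        by (simp add: algebra_simps)
      also have "\<dots> \<le> exp ((1 - t) * \<psi> x) * exp (- \<psi> x)"
        by (intro mult_right_mono exp_ge_add_one_self) auto
      also have "\<dots> = exp (- (t * \<psi> x))" by (simp add: algebra_simps flip: exp_add)
      also have "\<dots> \<le> exp (- \<psi> (\<lambda>i\<in>S. t * x i))" using ray[of t x] t by simp
      finally show "ennreal (exp (- \<psi> x)) + ennreal (1 - t) * ennreal (\<psi> x * exp (- \<psi> x)) \<le> ennreal (exp (- \<psi> (\<lambda>i\<in>S. t * x i)))"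
        using t pos[of x] by (simp add: ennreal_leI flip: ennreal_mult ennreal_plus)
    qed
    also have "\<dots> = ennreal ((1 / t) ^ d) * ennreal I"
      unfolding I(1)[symmetric] d_def using t by (intro nn_integral_PiM_half_lborel_scale S) auto
    also have "\<dots> = ennreal ((1 / t) ^ d * I)" using t I(2) by (simp add: ennreal_mult)
    finally show ?thesis .
  qed
  \<comment> \<open>Any fixed t < 1 in \<open>step\<close> forces J to be finite.\<close>
  have "J \<noteq> top"
  proof
    assume "J = top"
    then show False using step[of "1/2"] by (simp add: ennreal_mult_top top_unique)
  qed
  then obtain j where j: "J = ennreal j" "0 \<le> j" by (cases J) auto
  have le: "j * t ^ d \<le> I * real d" if t: "0 < t" "t < 1" for t
  proof -
    have "ennreal (I + (1 - t) * j) \<le> ennreal ((1 / t) ^ d * I)"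
      using step[OF t] t I(2) j by (simp add: ennreal_mult)
    then have "I + (1 - t) * j \<le> (1 / t) ^ d * I"
      using t I(2) by (subst (asm) ennreal_le_iff) auto
    then have "(I + (1 - t) * j) * t ^ d \<le> (1 / t) ^ d * I * t ^ d"
      using t by (intro mult_right_mono) auto
    also have "\<dots> = I" using t by (simp add: power_divide)
    finally have "(1 - t) * (j * t ^ d) \<le> I * (1 - t ^ d)" by (simp add: algebra_simps)
    \<comment> \<open>Bernoulli: 1 - t^d <= d (1 - t). The common factor 1 - t cancels, and t tends
      to 1.\<close>
    also have "\<dots> \<le> I * (real d * (1 - t))"
      using Bernoulli_inequality[of "t - 1" d] t I(2) by (intro mult_left_mono) (auto simp: algebra_simps)
    also have "\<dots> = (1 - t) * (I * real d)" by simp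
    finally show ?thesis using t by (simp add: mult_le_cancel_left_pos)
  qed
  have "((\<lambda>t. j * t ^ d) \<longlongrightarrow> j * 1 ^ d) (at_left 1)"
    by (intro tendsto_intros)
  moreover have "eventually (\<lambda>t. j * t ^ d \<le> I * real d) (at_left 1)"
    using eventually_at_left_real[of 0 "1::real"] le by (auto elim!: eventually_mono)
  ultimately have "j * 1 ^ d \<le> I * real d"
    by (rule tendsto_upperbound) simp
  then show ?thesis
    unfolding I(1) J_def[symmetric] j(1) d_def[symmetric] using I(2)
    by (simp add: ennreal_of_nat_eq_real_of_nat mult.commute flip: ennreal_mult)
qed

text \<open>The mirror image of \<open>nn_integral_times_exp_le\<close> with t > 1. Here J may be
  infinite, in which case there is nothing to prove.\<close>

lemma nn_integral_times_exp_ge: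
  assumes [measurable]: "\<psi> \<in> borel_measurable (PiM S (\<lambda>_. borel))" and S: "finite S"
    and pos: "\<And>x. 0 \<le> \<psi> x" and ray: "\<And>t x. 1 \<le> t \<Longrightarrow> \<psi> (\<lambda>i\<in>S. t * x i) \<le> t * \<psi> x"
    and fin: "(\<integral>\<^sup>+x. ennreal (exp (- \<psi> x)) \<partial>orthant_measure S) < \<infinity>"
  shows "of_nat (card S) * (\<integral>\<^sup>+x. ennreal (exp (- \<psi> x)) \<partial>orthant_measure S)
     \<le> (\<integral>\<^sup>+x. ennreal (\<psi> x * exp (- \<psi> x)) \<partial>orthant_measure S)"
proof -
  define d where "d = card S"
  let ?M = "orthant_measure S"
  obtain I where I: "(\<integral>\<^sup>+x. ennreal (exp (- \<psi> x)) \<partial>?M) = ennreal I" "0 \<le> I"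
    using fin by (cases "\<integral>\<^sup>+x. ennreal (exp (- \<psi> x)) \<partial>?M") auto
  define J where "J = (\<integral>\<^sup>+x. ennreal (\<psi> x * exp (- \<psi> x)) \<partial>?M)"
  have step: "ennreal I \<le> ennreal ((1 / t) ^ d * I) + ennreal (t - 1) * J" if t: "1 < t" for t
  proof -
    have [measurable]: "(\<lambda>x. \<psi> (\<lambda>i\<in>S. t * x i)) \<in> borel_measurable (PiM S (\<lambda>_. borel))"
      by measurable
    have "ennreal I \<le> (\<integral>\<^sup>+x. ennreal (exp (- \<psi> (\<lambda>i\<in>S. t * x i))) + ennreal (t - 1) * ennreal (\<psi> x * exp (- \<psi> x)) \<partial>?M)"
      unfolding I(1)[symmetric]
    proof (intro nn_integral_mono)
      fix x
      have "exp (- \<psi> x) = (1 - (t - 1) * \<psi> x) * exp (- \<psi> x) + (t - 1) * (\<psi> x * exp (- \<psi> x))"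
        by (simp add: algebra_simps)
      also have "(1 - (t - 1) * \<psi> x) * exp (- \<psi> x) \<le> exp (- ((t - 1) * \<psi> x)) * exp (- \<psi> x)"
        using exp_ge_add_one_self[of "- ((t - 1) * \<psi> x)"] by (intro mult_right_mono) auto
      also have "\<dots> = exp (- (t * \<psi> x))" by (simp add: algebra_simps flip: exp_add)
      also have "\<dots> \<le> exp (- \<psi> (\<lambda>i\<in>S. t * x i))" using ray[of t x] t by simp
      finally show "ennreal (exp (- \<psi> x)) \<le> ennreal (exp (- \<psi> (\<lambda>i\<in>S. t * x i))) + ennreal (t - 1) * ennreal (\<psi> x * exp (- \<psi> x))"
        using t pos[of x] by (simp add: ennreal_leI flip: ennreal_mult ennreal_plus)
    qed
    also have "\<dots> = (\<integral>\<^sup>+x. ennreal (exp (- \<psi> (\<lambda>i\<in>S. t * x i))) \<partial>?M) + ennreal (t - 1) * J"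
      unfolding J_def by (simp add: nn_integral_add nn_integral_cmult)
    also have "(\<integral>\<^sup>+x. ennreal (exp (- \<psi> (\<lambda>i\<in>S. t * x i))) \<partial>?M) = ennreal ((1 / t) ^ d) * ennreal I"
      unfolding I(1)[symmetric] d_def using t by (intro nn_integral_PiM_half_lborel_scale S) auto
    also have "\<dots> = ennreal ((1 / t) ^ d * I)" using t I(2) by (simp add: ennreal_mult)
    finally show ?thesis .
  qed
  show ?thesis
  proof (cases "J = top")
    case True
    then show ?thesis by (simp only: J_def[symmetric] top_greatest)
  next
    case False
    then obtain j where j: "J = ennreal j" "0 \<le> j" by (cases J) auto
    have le: "I * real d \<le> j * t ^ d" if t: "1 < t" for t
    proof -
      have "ennreal I \<le> ennreal ((1 / t) ^ d * I + (t - 1) * j)"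
        using step[OF t] t I(2) j by (simp add: ennreal_mult)
      then have "I \<le> (1 / t) ^ d * I + (t - 1) * j"
        using t I(2) j by (subst (asm) ennreal_le_iff) auto
      then have "I * t ^ d \<le> ((1 / t) ^ d * I + (t - 1) * j) * t ^ d"
        using t by (intro mult_right_mono) auto
      also have "\<dots> = I + (t - 1) * (j * t ^ d)" using t by (simp add: power_divide algebra_simps)
      finally have "I * (t ^ d - 1) \<le> (t - 1) * (j * t ^ d)" by (simp add: algebra_simps)
      moreover have "I * (real d * (t - 1)) \<le> I * (t ^ d - 1)"
        using Bernoulli_inequality[of "t - 1" d] t I(2) by (intro mult_left_mono) (auto simp: algebra_simps)
      ultimately have "(t - 1) * (I * real d) \<le> (t - 1) * (j * t ^ d)" by (simp add: algebra_simps)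
      then show ?thesis using t by (simp add: mult_le_cancel_left_pos)
    qed
    have "((\<lambda>t. j * t ^ d) \<longlongrightarrow> j * 1 ^ d) (at_right 1)"
      by (intro tendsto_intros)
    moreover have "eventually (\<lambda>t. I * real d \<le> j * t ^ d) (at_right 1)"
      using eventually_at_right_real[of "1::real" 2] le by (auto elim!: eventually_mono)
    ultimately have "I * real d \<le> j * 1 ^ d"
      by (rule tendsto_lowerbound) simp
    then show ?thesis
      unfolding I(1) J_def[symmetric] j(1) d_def[symmetric] using I(2)
      by (simp add: ennreal_of_nat_eq_real_of_nat mult.commute ennreal_leI flip: ennreal_mult)
  qed
qed

lemma nn_integral_PiM_UNIV_split:
  fixes g :: "('i::finite \<Rightarrow> real) \<Rightarrow> ennreal"
  assumes g: "g \<in> borel_measurable (PiM UNIV (\<lambda>_. borel))"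
  shows "(\<integral>\<^sup>+x. g x \<partial>orthant_measure UNIV)
     = (\<integral>\<^sup>+x. \<integral>\<^sup>+y. g (override (- S) y (zero_ext S x)) \<partial>orthant_measure (- S) \<partial>orthant_measure S)"
proof -
  have "(\<integral>\<^sup>+x. g x \<partial>orthant_measure (S \<union> - S))
     = (\<integral>\<^sup>+x. \<integral>\<^sup>+y. g (merge S (- S) (x, y)) \<partial>orthant_measure (- S) \<partial>orthant_measure S)"
    by (rule half.product_nn_integral_fold) (use g in auto)
  also have "\<dots> = (\<integral>\<^sup>+x. \<integral>\<^sup>+y. g (override (- S) y (zero_ext S x)) \<partial>orthant_measure (- S) \<partial>orthant_measure S)"
    by (intro nn_integral_cong arg_cong[where f = g]) (auto simp: merge_def override_def fun_eq_iff)
  finally show ?thesis by simp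
qed

section \<open>The dual Loomis-Whitney inequality\<close>

text \<open>A gauge on the orthant, extended to all vectors through their positive parts; this avoids sign
  conditions in what follows.\<close>

locale orthant_gauge =
  fixes N :: "('i::finite \<Rightarrow> real) \<Rightarrow> real"
  assumes mono: "x \<le> y \<Longrightarrow> N x \<le> N y"
    and subadd: "N (\<lambda>i. x i + y i) \<le> N x + N y"
    and homog: "0 \<le> c \<Longrightarrow> N (\<lambda>i. c * x i) = c * N x"
    and pos_part: "N (\<lambda>i. max 0 (x i)) = N x"
    and coercive: "\<exists>c>0. \<forall>x. c * (\<Sum>i\<in>UNIV. x i) \<le> N x"
begin

lemma zero: "N (\<lambda>_. 0) = 0"
  using homog[of 0 "\<lambda>_. 0"] by simp

lemma nonneg: "0 \<le> N x"
  using mono[of "\<lambda>_. 0" "\<lambda>i. max 0 (x i)"] by (simp add: zero pos_part le_fun_def)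

text \<open>The form in which continuity of a gauge enters: raising all coordinates by e costs at
  most e times N(1, ..., 1). It yields measurability and, later, the passage from almost all points
  to all points.\<close>

lemma le_add_const:
  assumes "0 \<le> e" "\<And>i. y i \<le> x i + e"
  shows "N y \<le> N x + e * N (\<lambda>_. 1)"
proof -
  have "N y \<le> N (\<lambda>i. x i + e * 1)" using assms(2) by (intro mono) (simp add: le_fun_def)
  also have "\<dots> \<le> N x + N (\<lambda>i. e * 1)" by (rule subadd)
  also have "N (\<lambda>i. e * 1) = e * N (\<lambda>_. 1)" by (rule homog) fact
  finally show ?thesis .
qed

lemma measurable [measurable]: "N \<in> borel_measurable (PiM UNIV (\<lambda>_. borel))"
proof (subst borel_measurable_iff_less, intro allI)
  fix a
  have "open {x. N x < a}"
  proof (subst open_subopen, intro ballI)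
    fix x assume x: "x \<in> {x. N x < a}"
    \<comment> \<open>Spends half of the slack a - N x; the \<open>+ 1\<close> keeps the denominator
      positive.\<close>
    define e where "e = (a - N x) / (2 * (N (\<lambda>_. 1) + 1))"
    have e: "0 < e" using x nonneg[of "\<lambda>_. 1"] by (auto simp: e_def)
    have "e * N (\<lambda>_. 1) \<le> e * (N (\<lambda>_. 1) + 1)" using e by simp
    also have "\<dots> < a - N x" using x nonneg[of "\<lambda>_. 1"] by (simp add: e_def divide_simps)
    finally have lt: "N x + e * N (\<lambda>_. 1) < a" by simp
    define T where "T = {y::'i \<Rightarrow> real. \<forall>i. y i < x i + e}"
    have "T = (\<Inter>i\<in>UNIV. {y. y i < x i + e})" by (auto simp: T_def)
    then have "open T"
      by (simp only:) (intro open_INT finite ballI open_Collect_less continuous_on_product_coordinates continuous_on_const)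
    moreover have "x \<in> T" using e by (simp add: T_def)
    moreover have "T \<subseteq> {x. N x < a}"
    proof
      fix y assume "y \<in> T"
      then have "N y \<le> N x + e * N (\<lambda>_. 1)"
        using e by (intro le_add_const) (auto simp: T_def less_imp_le)
      then show "y \<in> {x. N x < a}" using lt by simp
    qed
    ultimately show "\<exists>T. open T \<and> x \<in> T \<and> T \<subseteq> {x. N x < a}" by blast
  qed
  then have "{x. N x < a} \<in> sets (borel :: ('i \<Rightarrow> real) measure)" by simp
  then show "{x \<in> space (PiM UNIV (\<lambda>_. borel)). N x < a} \<in> sets (PiM UNIV (\<lambda>_. borel))"
    by (simp add: space_PiM sets_PiM_equal_borel)
qed

lemma decreasing_log_concave_exp: "decreasing_log_concave UNIV (\<lambda>x. exp (- N x))"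
  unfolding decreasing_log_concave_def
proof (intro conjI allI impI)
  fix x y :: "'i \<Rightarrow> real" and t :: real assume t: "0 \<le> t" "t \<le> 1"
  have "N (\<lambda>i. (1 - t) * x i + t * y i) \<le> N (\<lambda>i. (1 - t) * x i) + N (\<lambda>i. t * y i)" by (rule subadd)
  also have "\<dots> = (1 - t) * N x + t * N y" using t by (simp add: homog)
  finally have "exp (- ((1 - t) * N x + t * N y)) \<le> exp (- N (\<lambda>i. (1 - t) * x i + t * y i))" by simp
  moreover have "exp (- N x) powr (1 - t) * exp (- N y) powr t = exp (- ((1 - t) * N x + t * N y))"
    by (simp add: powr_def algebra_simps flip: exp_add)
  ultimately show "exp (- N x) powr (1 - t) * exp (- N y) powr t \<le> exp (- N (\<lambda>i. (1 - t) * x i + t * y i))"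
    by simp
next
  obtain c where "0 < c" "\<And>x. c * (\<Sum>i\<in>UNIV. x i) \<le> N x" using coercive by auto
  then show "\<exists>C c. 0 < c \<and> (\<forall>x. exp (- N x) \<le> C * exp (- c * (\<Sum>i\<in>UNIV. x i)))"
    by (intro exI[of _ 1] exI[of _ c]) auto
qed (auto simp: mono)

text \<open>\<open>S\<close> is the set of coordinates that are integrated out; the marginal on a
  block is therefore \<open>marginal\<close> of its complement. \<open>enn2real\<close> loses
  nothing, as \<open>ennreal_marginal\<close> shows.\<close>

definition marginal :: "'i set \<Rightarrow> ('i \<Rightarrow> real) \<Rightarrow> real" where
  "marginal S x = enn2real (\<integral>\<^sup>+y. ennreal (exp (- N (override S y x))) \<partial>orthant_measure S)"

text \<open>The v(S) of the overview; for the gauge of a body it is |S|! times a section volume by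
  \<open>total_eq_section_volume\<close>.\<close>

definition total :: "'i set \<Rightarrow> real" where
  "total S = marginal S (\<lambda>_. 0)"

lemma decreasing_log_concave_marginal: "decreasing_log_concave (- S) (marginal S)"
  and ennreal_marginal: "ennreal (marginal S x) = (\<integral>\<^sup>+y. ennreal (exp (- N (override S y x))) \<partial>orthant_measure S)"
proof -
  obtain G where G: "decreasing_log_concave (- S) G"
    "\<And>x. ennreal (G x) = (\<integral>\<^sup>+y. ennreal (exp (- N (override S y x))) \<partial>orthant_measure S)"
    using ex_marginal[of "- S" S "\<lambda>x. exp (- N x)"] decreasing_log_concave_exp by auto
  have "0 < G x" for x using G(1) by (simp add: decreasing_log_concave_def)
  then have "G = marginal S" by (simp add: fun_eq_iff marginal_def G(2)[symmetric] less_imp_le)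
  then show "decreasing_log_concave (- S) (marginal S)"
    "ennreal (marginal S x) = (\<integral>\<^sup>+y. ennreal (exp (- N (override S y x))) \<partial>orthant_measure S)"
    using G by auto
qed

lemma marginal_measurable [measurable]: "marginal S \<in> borel_measurable (PiM UNIV (\<lambda>_. borel))"
  and marginal_pos: "0 < marginal S x"
  and marginal_log_concave: "0 \<le> t \<Longrightarrow> t \<le> 1 \<Longrightarrow>
     marginal S x powr (1 - t) * marginal S y powr t \<le> marginal S (\<lambda>i. (1 - t) * x i + t * y i)"
  using decreasing_log_concave_marginal[of S] by (auto simp: decreasing_log_concave_def)

lemma marginal_antimono: "x \<le> y \<Longrightarrow> marginal S y \<le> marginal S x"
  using decreasing_log_concave_marginal[of S] by (auto simp: decreasing_log_concave_def)

lemma total_pos: "0 < total S" by (simp add: total_def marginal_pos)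

lemma total_eq: "ennreal (total S) = (\<integral>\<^sup>+y. ennreal (exp (- N (override S y (\<lambda>_. 0)))) \<partial>orthant_measure S)"
  by (simp add: total_def ennreal_marginal)

lemma total_UNIV: "ennreal (total UNIV) = (\<integral>\<^sup>+y. ennreal (exp (- N y)) \<partial>orthant_measure UNIV)"
  by (simp add: total_eq override_def)

lemma marginal_le_total: "marginal S x \<le> total S"
proof -
  have "ennreal (marginal S x) \<le> ennreal (total S)"
    unfolding ennreal_marginal total_eq
  proof (intro nn_integral_mono ennreal_leI)
    fix y
    \<comment> \<open>Coordinates of x may be negative, so the comparison with 0 passes through
      positive parts.\<close>
    have "N (override S y (\<lambda>_. 0)) = N (\<lambda>i. max 0 (override S y (\<lambda>_. 0) i))" by (rule pos_part[symmetric])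
    also have "\<dots> \<le> N (\<lambda>i. max 0 (override S y x i))"
      by (rule mono) (auto simp: le_fun_def override_def)
    also have "\<dots> = N (override S y x)" by (rule pos_part)
    finally show "exp (- N (override S y x)) \<le> exp (- N (override S y (\<lambda>_. 0)))" by simp
  qed
  then show ?thesis using total_pos[of S] by (simp add: ennreal_le_iff)
qed

lemma marginal_cong: "(\<And>i. i \<notin> S \<Longrightarrow> x i = y i) \<Longrightarrow> marginal S x = marginal S y"
  unfolding marginal_def
  by (intro arg_cong[where f = enn2real] nn_integral_cong arg_cong[where f = "\<lambda>x. ennreal (exp (- N x))"])
     (auto simp: override_def)

definition potential :: "'i set \<Rightarrow> ('i \<Rightarrow> real) \<Rightarrow> real" where
  "potential S x = ln (total (- S)) - ln (marginal (- S) x)"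

lemma potential_measurable [measurable]: "potential S \<in> borel_measurable (PiM UNIV (\<lambda>_. borel))"
  unfolding potential_def by measurable

lemma potential_nonneg: "0 \<le> potential S x"
  using marginal_le_total[of "- S" x] marginal_pos[of "- S" x] by (simp add: potential_def)

lemma potential_mono: "x \<le> y \<Longrightarrow> potential S x \<le> potential S y"
  using marginal_antimono[of x y "- S"] marginal_pos[of "- S"] by (simp add: potential_def)

lemma potential_cong: "(\<And>i. i \<in> S \<Longrightarrow> x i = y i) \<Longrightarrow> potential S x = potential S y"
  using marginal_cong[of "- S" x y] by (simp add: potential_def)

lemma exp_potential: "exp (- potential S x) = marginal (- S) x / total (- S)"
  using marginal_pos[of "- S" x] total_pos[of "- S"] by (simp add: potential_def exp_diff exp_minus)

text \<open>Log-concavity of the marginal between 0 and x, as the potential vanishes at 0.\<close>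

lemma potential_ray:
  assumes "0 \<le> t" "t \<le> 1"
  shows "potential S (\<lambda>i. t * x i) \<le> t * potential S x"
proof -
  have "total (- S) powr (1 - t) * marginal (- S) x powr t \<le> marginal (- S) (\<lambda>i. t * x i)"
    using marginal_log_concave[OF assms, of "- S" "\<lambda>_. 0" x] by (simp add: total_def)
  then have "ln (total (- S) powr (1 - t) * marginal (- S) x powr t) \<le> ln (marginal (- S) (\<lambda>i. t * x i))"
    using marginal_pos[of "- S" x] total_pos[of "- S"] by (intro ln_mono mult_pos_pos) auto
  moreover have "ln (total (- S) powr (1 - t) * marginal (- S) x powr t) = (1 - t) * ln (total (- S)) + t * ln (marginal (- S) x)"
    using marginal_pos[of "- S" x] total_pos[of "- S"] by (simp add: ln_mult ln_powr)
  ultimately show ?thesis by (simp add: potential_def algebra_simps)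
qed

text \<open>Fubini with the complement of \<open>S\<close> innermost. As \<open>g\<close> depends
  only on \<open>S\<close>, the inner integral is the marginal, which is \<open>total (- S)\<close>
  times the exponential of minus the potential. Used with g = 1 and with the potential
  itself.\<close>

lemma block_integral:
  assumes [measurable]: "g \<in> borel_measurable (PiM UNIV (\<lambda>_. borel))"
    and cong: "\<And>x y. (\<And>i. i \<in> S \<Longrightarrow> x i = y i) \<Longrightarrow> g x = g y"
  shows "(\<integral>\<^sup>+x. g x * ennreal (exp (- N x)) \<partial>orthant_measure UNIV)
     = ennreal (total (- S)) * (\<integral>\<^sup>+x. g (zero_ext S x) * ennreal (exp (- potential S (zero_ext S x))) \<partial>orthant_measure S)"
proof -
  have [measurable]: "(\<lambda>x. override S x (\<lambda>_. 0::real)) \<in> measurable (PiM S (\<lambda>_. borel)) (PiM UNIV (\<lambda>_. borel))"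
    by (rule measurable_override) (auto simp: space_PiM)
  have ov[measurable]: "(\<lambda>y. override (- S) y z) \<in> measurable (PiM (- S) (\<lambda>_. borel)) (PiM UNIV (\<lambda>_. borel))" for z :: "'i \<Rightarrow> real"
    by (rule measurable_override) (auto simp: space_PiM)
  have "(\<integral>\<^sup>+x. g x * ennreal (exp (- N x)) \<partial>orthant_measure UNIV)
    = (\<integral>\<^sup>+x. \<integral>\<^sup>+y. g (override (- S) y (zero_ext S x)) * ennreal (exp (- N (override (- S) y (zero_ext S x))))
         \<partial>orthant_measure (- S) \<partial>orthant_measure S)"
    by (rule nn_integral_PiM_UNIV_split) measurable
  also have "\<dots> = (\<integral>\<^sup>+x. \<integral>\<^sup>+y. g (zero_ext S x) * ennreal (exp (- N (override (- S) y (zero_ext S x))))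
         \<partial>orthant_measure (- S) \<partial>orthant_measure S)"
    by (intro nn_integral_cong arg_cong2[where f = "(*)"] cong refl) (simp add: override_def)
  also have "\<dots> = (\<integral>\<^sup>+x. g (zero_ext S x) * ennreal (marginal (- S) (zero_ext S x)) \<partial>orthant_measure S)"
    unfolding ennreal_marginal by (intro nn_integral_cong nn_integral_cmult) measurable
  also have "\<dots> = (\<integral>\<^sup>+x. ennreal (total (- S)) * (g (zero_ext S x) * ennreal (exp (- potential S (zero_ext S x)))) \<partial>orthant_measure S)"
  proof (intro nn_integral_cong)
    fix x
    have "ennreal (marginal (- S) (zero_ext S x)) = ennreal (total (- S)) * ennreal (exp (- potential S (zero_ext S x)))"
      using total_pos[of "- S"] by (simp add: exp_potential flip: ennreal_mult')
    then show "g (zero_ext S x) * ennreal (marginal (- S) (zero_ext S x))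
       = ennreal (total (- S)) * (g (zero_ext S x) * ennreal (exp (- potential S (zero_ext S x))))"
      by (simp only: mult_ac)
  qed
  also have "\<dots> = ennreal (total (- S)) * (\<integral>\<^sup>+x. g (zero_ext S x) * ennreal (exp (- potential S (zero_ext S x))) \<partial>orthant_measure S)"
    by (rule nn_integral_cmult) measurable
  finally show ?thesis .
qed

lemma block_partition_function:
  "(\<integral>\<^sup>+x. ennreal (exp (- potential S (zero_ext S x))) \<partial>orthant_measure S) = ennreal (total UNIV / total (- S))"
proof -
  let ?I = "(\<integral>\<^sup>+x. ennreal (exp (- potential S (zero_ext S x))) \<partial>orthant_measure S)"
  have "ennreal (total UNIV) = ennreal (total (- S)) * ?I"
    using block_integral[of "\<lambda>_. 1" S] by (simp add: total_UNIV)
  then have "ennreal (1 / total (- S)) * ennreal (total UNIV) = (ennreal (1 / total (- S)) * ennreal (total (- S))) * ?I"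
    by (simp add: mult.assoc)
  also have "ennreal (1 / total (- S)) * ennreal (total (- S)) = 1"
    using total_pos[of "- S"] by (simp flip: ennreal_mult')
  finally show ?thesis using total_pos[of "- S"] total_pos[of UNIV] by (simp flip: ennreal_mult')
qed

text \<open>The potential lives on an orthant of dimension \<open>card S\<close>, so the first
  moment bound contributes \<open>card S\<close>; the factor \<open>total (- S)\<close> cancels
  against the partition function.\<close>

lemma block_potential_le:
  "(\<integral>\<^sup>+x. ennreal (potential S x * exp (- N x)) \<partial>orthant_measure UNIV) \<le> ennreal (real (card S) * total UNIV)"
proof -
  have [measurable]: "(\<lambda>x. override S x (\<lambda>_. 0::real)) \<in> measurable (PiM S (\<lambda>_. borel)) (PiM UNIV (\<lambda>_. borel))"
    by (rule measurable_override) (auto simp: space_PiM)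
  define \<psi> where "\<psi> = (\<lambda>x. potential S (zero_ext S x))"
  have "(\<integral>\<^sup>+x. ennreal (potential S x * exp (- N x)) \<partial>orthant_measure UNIV)
     = (\<integral>\<^sup>+x. ennreal (potential S x) * ennreal (exp (- N x)) \<partial>orthant_measure UNIV)"
    by (simp add: ennreal_mult' potential_nonneg)
  also have "\<dots> = ennreal (total (- S)) * (\<integral>\<^sup>+x. ennreal (\<psi> x) * ennreal (exp (- \<psi> x)) \<partial>orthant_measure S)"
    unfolding \<psi>_def by (rule block_integral) (measurable, metis potential_cong)
  also have "(\<integral>\<^sup>+x. ennreal (\<psi> x) * ennreal (exp (- \<psi> x)) \<partial>orthant_measure S)
     = (\<integral>\<^sup>+x. ennreal (\<psi> x * exp (- \<psi> x)) \<partial>orthant_measure S)"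
    by (simp add: ennreal_mult' \<psi>_def potential_nonneg)
  also have "ennreal (total (- S)) * \<dots> \<le> ennreal (total (- S)) * (of_nat (card S) * (\<integral>\<^sup>+x. ennreal (exp (- \<psi> x)) \<partial>orthant_measure S))"
  proof (intro mult_left_mono nn_integral_times_exp_le)
    show "\<psi> \<in> borel_measurable (PiM S (\<lambda>_. borel))" unfolding \<psi>_def by measurable
    show "\<psi> (\<lambda>i\<in>S. t * x i) \<le> t * \<psi> x" if "0 \<le> t" "t \<le> 1" for t x
    proof -
      have "\<psi> (\<lambda>i\<in>S. t * x i) = potential S (\<lambda>i. t * zero_ext S x i)"
        unfolding \<psi>_def by (rule potential_cong) (auto simp: override_def)
      then show ?thesis using potential_ray[OF that] by (simp add: \<psi>_def)
    qed
  qed (auto simp: \<psi>_def potential_nonneg block_partition_function)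
  also have "\<dots> = ennreal (real (card S) * total UNIV)"
    unfolding \<psi>_def block_partition_function using total_pos[of "- S"] total_pos[of UNIV]
    by (simp add: ennreal_of_nat_eq_real_of_nat flip: ennreal_mult')
  finally show ?thesis .
qed

text \<open>Euler's relation in integrated form: a homogeneous function satisfies both ray
  conditions, so the bounds from t < 1 and from t > 1 meet.\<close>

lemma first_moment: "(\<integral>\<^sup>+x. ennreal (N x * exp (- N x)) \<partial>orthant_measure UNIV) = ennreal (real CARD('i) * total UNIV)"
proof (rule antisym)
  have eq: "of_nat CARD('i) * (\<integral>\<^sup>+x. ennreal (exp (- N x)) \<partial>orthant_measure UNIV) = ennreal (real CARD('i) * total UNIV)"
    by (simp add: total_UNIV[symmetric] ennreal_of_nat_eq_real_of_nat flip: ennreal_mult')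
  show "(\<integral>\<^sup>+x. ennreal (N x * exp (- N x)) \<partial>orthant_measure UNIV) \<le> ennreal (real CARD('i) * total UNIV)"
    unfolding eq[symmetric]
    by (rule nn_integral_times_exp_le) (auto simp: nonneg homog total_UNIV[symmetric] restrict_UNIV)
  show "ennreal (real CARD('i) * total UNIV) \<le> (\<integral>\<^sup>+x. ennreal (N x * exp (- N x)) \<partial>orthant_measure UNIV)"
    unfolding eq[symmetric]
    by (rule nn_integral_times_exp_ge) (auto simp: nonneg homog total_UNIV[symmetric] restrict_UNIV)
qed

end

text \<open>The inequality exp(b) >= 1 + b at b = a / 2, squared, gives exp(a) >= 1 + a + a^2 / 4
  whenever 1 + a / 2 >= 0; for smaller a the number 1 + a is negative.\<close>

lemma exp_eq_one_plus_imp_zero: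
  assumes "exp (a::real) = 1 + a"
  shows "a = 0"
proof (rule ccontr)
  assume a: "a \<noteq> 0"
  show False
  proof (cases "0 \<le> 1 + a / 2")
    case True
    have "(1 + a / 2)\<^sup>2 \<le> (exp (a / 2))\<^sup>2"
      by (rule power_mono[OF _ True]) (rule exp_ge_add_one_self)
    also have "\<dots> = exp a" by (simp add: power2_eq_square flip: exp_add)
    finally have "a\<^sup>2 \<le> 0" using assms by (simp add: power2_eq_square algebra_simps)
    then show False using a by simp
  next
    case False
    then have "1 + a < 0" by simp
    then show False using assms exp_gt_zero[of a] by simp
  qed
qed

lemma le_if_le_add_eps:
  fixes A B C :: real
  assumes "0 \<le> C" and le: "\<And>e. 0 < e \<Longrightarrow> A \<le> B + C * e"
  shows "A \<le> B"
proof (rule field_le_epsilon)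
  fix e :: real assume e: "0 < e"
  have "A \<le> B + C * (e / (C + 1))" using e assms(1) by (intro le) simp
  also have "\<dots> \<le> B + e" using e assms(1) by (simp add: divide_simps) (simp add: algebra_simps)
  finally show "A \<le> B + e" .
qed

context orthant_gauge
begin

definition potential_sum :: "('i \<Rightarrow> 'b::finite) \<Rightarrow> ('i \<Rightarrow> real) \<Rightarrow> real" where
  "potential_sum c x = (\<Sum>b\<in>UNIV. potential (c -` {b}) x)"

lemma potential_sum_measurable [measurable]: "potential_sum c \<in> borel_measurable (PiM UNIV (\<lambda>_. borel))"
  unfolding potential_sum_def by measurable

lemma nn_integral_exp_potential_sum:
  fixes c :: "'i \<Rightarrow> 'b::finite"
  shows "(\<integral>\<^sup>+x. ennreal (exp (- potential_sum c x)) \<partial>orthant_measure UNIV) = ennreal (\<Prod>b\<in>UNIV. total UNIV / total (- (c -` {b})))"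
proof -
  have [measurable]: "(\<lambda>x. override S x (\<lambda>_. 0::real)) \<in> measurable (PiM S (\<lambda>_. borel)) (PiM UNIV (\<lambda>_. borel))" for S :: "'i set"
    by (rule measurable_override) (auto simp: space_PiM)
  define g where "g = (\<lambda>b x. ennreal (exp (- potential (c -` {b}) (zero_ext (c -` {b}) x))))"
  have U: "(\<Union>b\<in>UNIV. c -` {b}) = UNIV" by auto
  have "(\<integral>\<^sup>+x. ennreal (exp (- potential_sum c x)) \<partial>orthant_measure UNIV)
     = (\<integral>\<^sup>+x. (\<Prod>b\<in>UNIV. g b (restrict x (c -` {b}))) \<partial>orthant_measure (\<Union>b\<in>UNIV. c -` {b}))"
    unfolding U
  proof (intro nn_integral_cong)
    fix x :: "'i \<Rightarrow> real"
    have "g b (restrict x (c -` {b})) = ennreal (exp (- potential (c -` {b}) x))" for b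
      unfolding g_def by (intro arg_cong[where f = "\<lambda>z. ennreal (exp (- z))"] potential_cong) (auto simp: override_def)
    then show "ennreal (exp (- potential_sum c x)) = (\<Prod>b\<in>UNIV. g b (restrict x (c -` {b})))"
      by (simp add: potential_sum_def prod_ennreal exp_sum sum_negf[symmetric] del: sum_negf)
  qed
  also have "\<dots> = (\<Prod>b\<in>UNIV. \<integral>\<^sup>+x. g b x \<partial>orthant_measure (c -` {b}))"
    by (rule nn_integral_PiM_partition[OF sigma_finite_half_lborel]) (auto simp: disjoint_family_on_def g_def)
  also have "\<dots> = (\<Prod>b\<in>UNIV. ennreal (total UNIV / total (- (c -` {b}))))"
    by (simp add: g_def block_partition_function)
  also have "\<dots> = ennreal (\<Prod>b\<in>UNIV. total UNIV / total (- (c -` {b})))"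
    by (rule prod_ennreal) (simp add: total_pos less_imp_le)
  finally show ?thesis .
qed

text \<open>\<open>D\<close> is the gap in the pointwise inequality, namely exp(-N) (exp(d) - 1 - d)
  with d = N - \<Psi>. Its integral is kept in the conclusion because its vanishing is the equality
  case.\<close>

lemma gibbs:
  fixes c :: "'i \<Rightarrow> 'b::finite"
  defines "P \<equiv> \<Prod>b\<in>UNIV. total UNIV / total (- (c -` {b}))"
    and "D \<equiv> \<lambda>x. exp (- potential_sum c x) + potential_sum c x * exp (- N x) - (exp (- N x) + N x * exp (- N x))"
  shows "0 \<le> D x" and "D x = 0 \<Longrightarrow> N x = potential_sum c x"
    and "ennreal (total UNIV) + (\<integral>\<^sup>+x. ennreal (D x) \<partial>orthant_measure UNIV) \<le> ennreal P"
proof -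
  have D: "D x = exp (- N x) * (exp (N x - potential_sum c x) - (1 + (N x - potential_sum c x)))" for x
    by (simp add: D_def algebra_simps flip: exp_add)
  show nn: "0 \<le> D x" for x
    using exp_ge_add_one_self[of "N x - potential_sum c x"] by (simp add: D)
  show "D x = 0 \<Longrightarrow> N x = potential_sum c x"
    using exp_eq_one_plus_imp_zero[of "N x - potential_sum c x"] by (simp add: D)
  let ?M = "PiM UNIV (\<lambda>_::'i. half_lborel)"
  define n v where "n = real CARD('i)" and "v = total UNIV"
  have v: "0 < v" by (simp add: v_def total_pos)
  have Psi: "0 \<le> potential_sum c x" for x
    unfolding potential_sum_def by (intro sum_nonneg potential_nonneg)
  have [measurable]: "D \<in> borel_measurable (PiM UNIV (\<lambda>_. borel))" unfolding D_def by measurable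
  \<comment> \<open>The definition of \<open>D\<close> is rearranged so that both sides are sums of
    nonnegative terms, since differences cannot be split under \<open>nn_integral\<close>.\<close>
  have "(ennreal v + ennreal (n * v)) + (\<integral>\<^sup>+x. ennreal (D x) \<partial>?M)
     = (\<integral>\<^sup>+x. ennreal (exp (- N x)) + ennreal (N x * exp (- N x)) + ennreal (D x) \<partial>?M)"
    by (simp add: nn_integral_add v_def n_def first_moment total_UNIV)
  also have "\<dots> = (\<integral>\<^sup>+x. ennreal (exp (- potential_sum c x)) + (\<Sum>b\<in>UNIV. ennreal (potential (c -` {b}) x * exp (- N x))) \<partial>?M)"
  proof (intro nn_integral_cong)
    fix x
    have "ennreal (exp (- N x)) + ennreal (N x * exp (- N x)) + ennreal (D x) = ennreal (exp (- N x) + N x * exp (- N x) + D x)"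
      using nonneg[of x] nn[of x] by (simp add: ennreal_plus)
    also have "exp (- N x) + N x * exp (- N x) + D x = exp (- potential_sum c x) + (\<Sum>b\<in>UNIV. potential (c -` {b}) x * exp (- N x))"
      by (simp add: D_def potential_sum_def sum_distrib_right)
    also have "ennreal \<dots> = ennreal (exp (- potential_sum c x)) + (\<Sum>b\<in>UNIV. ennreal (potential (c -` {b}) x * exp (- N x)))"
      by (subst ennreal_plus) (auto simp: sum_ennreal potential_nonneg intro!: sum_nonneg mult_nonneg_nonneg)
    finally show "ennreal (exp (- N x)) + ennreal (N x * exp (- N x)) + ennreal (D x) =
        ennreal (exp (- potential_sum c x)) + (\<Sum>b\<in>UNIV. ennreal (potential (c -` {b}) x * exp (- N x)))" .
  qed
  also have "\<dots> = ennreal P + (\<Sum>b\<in>UNIV. \<integral>\<^sup>+x. ennreal (potential (c -` {b}) x * exp (- N x)) \<partial>?M)"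
    by (simp add: nn_integral_add nn_integral_sum nn_integral_exp_potential_sum P_def)
  also have "\<dots> \<le> ennreal P + (\<Sum>b\<in>UNIV. ennreal (real (card (c -` {b})) * v))"
    unfolding v_def by (intro add_left_mono sum_mono block_potential_le)
  \<comment> \<open>The blocks partition the coordinates, so the block moments add up to the same n
    v as the moment of N; this finite term then cancels.\<close>
  also have "(\<Sum>b\<in>UNIV. ennreal (real (card (c -` {b})) * v)) = ennreal (n * v)"
  proof -
    have "(\<Sum>b\<in>UNIV. card (c -` {b})) = card (\<Union>b\<in>UNIV. c -` {b})"
      by (rule card_UN_disjoint[symmetric]) auto
    also have "(\<Union>b\<in>UNIV. c -` {b}) = UNIV" by auto
    finally have "n = (\<Sum>b\<in>UNIV. real (card (c -` {b})))" by (simp add: n_def flip: of_nat_sum)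
    then show ?thesis using v by (simp add: sum_ennreal sum_distrib_right)
  qed
  finally have "ennreal (n * v) + (ennreal v + (\<integral>\<^sup>+x. ennreal (D x) \<partial>?M)) \<le> ennreal (n * v) + ennreal P"
    by (simp add: add_ac)
  then show "ennreal (total UNIV) + (\<integral>\<^sup>+x. ennreal (D x) \<partial>?M) \<le> ennreal P"
    by (simp add: v_def ennreal_add_left_cancel_le)
qed

lemma prod_ratio: "(\<Prod>b\<in>(UNIV::'b::finite set). total UNIV / total (- (c -` {b}))) * (\<Prod>b\<in>UNIV. total (- (c -` {b}))) = total UNIV ^ CARD('b)"
  using total_pos by (simp add: prod_dividef less_imp_neq[symmetric] prod_zero_iff)

text \<open>Drops the gap in \<open>gibbs\<close> and clears denominators. The extra factor
  \<open>total UNIV\<close> avoids the exponent \<open>CARD('b) - 1\<close>.\<close>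

theorem dual_Loomis_Whitney:
  fixes c :: "'i \<Rightarrow> 'b::finite"
  shows "total UNIV * (\<Prod>b\<in>UNIV. total (- (c -` {b}))) \<le> total UNIV ^ CARD('b)"
proof -
  have "ennreal (total UNIV) \<le> ennreal (\<Prod>b\<in>UNIV. total UNIV / total (- (c -` {b})))"
    using gibbs(3)[of c] by (rule order_trans[rotated]) simp
  then have "total UNIV \<le> (\<Prod>b\<in>UNIV. total UNIV / total (- (c -` {b})))"
    by (subst (asm) ennreal_le_iff) (auto intro!: prod_nonneg simp: total_pos less_imp_le)
  then show ?thesis
    unfolding prod_ratio[of c, symmetric] by (intro mult_right_mono prod_nonneg) (auto simp: total_pos less_imp_le)
qed

text \<open>Equality makes the gap integral vanish, so N = \<Psi> almost everywhere. Each summand of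
  \<Psi> sees only its block, and N of a block component is compared with that summand by moving
  slightly into the interior.\<close>

theorem dual_Loomis_Whitney_eq:
  fixes c :: "'i \<Rightarrow> 'b::finite"
  assumes eq: "total UNIV * (\<Prod>b\<in>UNIV. total (- (c -` {b}))) = total UNIV ^ CARD('b)"
    and x: "\<And>i. 0 \<le> x i"
  shows "N x = (\<Sum>b\<in>UNIV. N (zero_ext (c -` {b}) x))"
proof -
  define P where "P = (\<Prod>b\<in>UNIV. total UNIV / total (- (c -` {b})))"
  define D where "D = (\<lambda>x. exp (- potential_sum c x) + potential_sum c x * exp (- N x) - (exp (- N x) + N x * exp (- N x)))"
  let ?M = "PiM UNIV (\<lambda>_::'i. half_lborel)"
  have "total UNIV = P"
    using eq total_pos unfolding prod_ratio[of c, symmetric] P_def[symmetric]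
    by (simp add: less_imp_neq[symmetric] prod_zero_iff)
  then have "ennreal P + (\<integral>\<^sup>+x. ennreal (D x) \<partial>?M) \<le> ennreal P + 0"
    using gibbs(3)[of c] by (simp add: P_def D_def)
  then have int0: "(\<integral>\<^sup>+x. ennreal (D x) \<partial>?M) = 0"
    by (subst (asm) ennreal_add_left_cancel_le) simp
  have [measurable]: "D \<in> borel_measurable (PiM UNIV (\<lambda>_. borel))" unfolding D_def by measurable
  have "AE x in ?M. ennreal (D x) = 0"
    using int0 by (subst (asm) nn_integral_0_iff_AE) auto
  then have AE: "AE x in ?M. N x = potential_sum c x"
  proof (rule AE_mp, intro AE_I2 impI)
    fix x assume "ennreal (D x) = 0"
    then have "D x = 0" using gibbs(1)[of c x] by (simp add: D_def)
    then show "N x = potential_sum c x" unfolding D_def by (rule gibbs(2))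
  qed
  \<comment> \<open>A box of positive measure inside the orthant cannot lie in the exceptional null
    set.\<close>
  have dense: "\<exists>y. N y = potential_sum c y \<and> (\<forall>i. l i < y i \<and> y i < u i)" if lu: "\<And>i. 0 \<le> l i" "\<And>i. l i < u i" for l u :: "'i \<Rightarrow> real"
  proof (rule ccontr)
    assume no: "\<not> ?thesis"
    let ?B = "Pi\<^sub>E UNIV (\<lambda>i. {l i<..<u i})"
    obtain Z where Z: "{x \<in> space ?M. \<not> (N x = potential_sum c x)} \<subseteq> Z" "emeasure ?M Z = 0" "Z \<in> sets ?M"
      using AE by (rule AE_E)
    have "?B \<subseteq> Z" using no Z(1) by (fastforce simp: space_PiM)
    then have "emeasure ?M ?B \<le> 0" using Z(2,3) by (metis emeasure_mono)
    moreover have "emeasure ?M ?B = (\<Prod>i\<in>UNIV. emeasure half_lborel {l i<..<u i})"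
      by (rule half.emeasure_PiM) auto
    moreover have "emeasure half_lborel {l i<..<u i} = ennreal (u i - l i)" for i
    proof -
      have "{l i<..<u i} \<inter> {0..} = {l i<..<u i}" using lu(1)[of i] by auto
      then show ?thesis using lu(2)[of i] by (simp add: emeasure_half_lborel)
    qed
    ultimately obtain i where "ennreal (u i - l i) = 0" by auto
    then show False using lu(2)[of i] by (simp add: ennreal_eq_0_iff)
  qed
  have N1: "0 \<le> N (\<lambda>_. 1)" by (rule nonneg)
  \<comment> \<open>Both sides are monotone, so points of equality slightly below and slightly above
    z enclose them; \<open>le_add_const\<close> controls the change of N between these
    points.\<close>
  have interior: "N z = potential_sum c z" if z: "\<And>i. 0 < z i" for z
  proof (rule antisym)
    have mono_sum: "potential_sum c y \<le> potential_sum c y'" if "y \<le> y'" for y y'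
      unfolding potential_sum_def using that by (intro sum_mono potential_mono)
    show "N z \<le> potential_sum c z"
    proof (rule le_if_le_add_eps[OF N1])
      fix e :: real assume e: "0 < e"
      obtain y where y: "N y = potential_sum c y" "\<And>i. max 0 (z i - e) < y i \<and> y i < z i"
        using dense[of "\<lambda>i. max 0 (z i - e)" z] z e by auto
      have "N z \<le> N y + e * N (\<lambda>_. 1)" using e y(2) by (intro le_add_const) (auto simp: less_imp_le algebra_simps)
      also have "N y \<le> potential_sum c z" unfolding y(1) using y(2) by (intro mono_sum) (auto simp: le_fun_def less_imp_le)
      finally show "N z \<le> potential_sum c z + N (\<lambda>_. 1) * e" by (simp add: mult.commute)
    qed
    show "potential_sum c z \<le> N z"
    proof (rule le_if_le_add_eps[OF N1])
      fix e :: real assume e: "0 < e"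
      obtain y where y: "N y = potential_sum c y" "\<And>i. z i < y i \<and> y i < z i + e"
        using dense[of z "\<lambda>i. z i + e"] z e by (auto simp: less_imp_le)
      have "potential_sum c z \<le> N y" unfolding y(1) using y(2) by (intro mono_sum) (auto simp: le_fun_def less_imp_le)
      also have "N y \<le> N z + e * N (\<lambda>_. 1)" using e y(2) by (intro le_add_const) (auto simp: less_imp_le)
      finally show "potential_sum c z \<le> N z + N (\<lambda>_. 1) * e" by (simp add: mult.commute)
    qed
  qed
  define m where "m = real CARD('b)"
  define xb where "xb = (\<lambda>b. zero_ext (c -` {b}) x)"
  have xb0: "0 \<le> xb b i" for b i using x by (auto simp: xb_def override_def)
  \<comment> \<open>Block components may lie on the boundary of the orthant, which
    \<open>interior\<close> does not reach; adding e to every coordinate moves them inside, and e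
    tends to 0.\<close>
  have int_xb: "N (\<lambda>i. xb b i + e) = (\<Sum>b'\<in>UNIV. potential (c -` {b'}) (\<lambda>i. xb b i + e))" if "0 < e" for b e
    using that xb0 by (subst interior) (auto simp: potential_sum_def add_nonneg_pos)
  have same: "potential (c -` {b}) (\<lambda>i. xb b i + e) = potential (c -` {b}) (\<lambda>i. x i + e)" for b e
    by (rule potential_cong) (auto simp: xb_def override_def)
  have int_x: "N (\<lambda>i. x i + e) = (\<Sum>b\<in>UNIV. potential (c -` {b}) (\<lambda>i. x i + e))" if "0 < e" for e
    using that x by (subst interior) (auto simp: potential_sum_def add_nonneg_pos)
  show ?thesis
  proof (rule antisym)
    show "N x \<le> (\<Sum>b\<in>UNIV. N (zero_ext (c -` {b}) x))"
    proof (rule le_if_le_add_eps[where C = "m * N (\<lambda>_. 1)"])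
      fix e :: real assume e: "0 < e"
      have "N x \<le> N (\<lambda>i. x i + e)" using e by (intro mono) (simp add: le_fun_def)
      also have "\<dots> = (\<Sum>b\<in>UNIV. potential (c -` {b}) (\<lambda>i. xb b i + e))"
        using e by (simp add: int_x same)
      also have "\<dots> \<le> (\<Sum>b\<in>UNIV. N (xb b) + e * N (\<lambda>_. 1))"
      proof (rule sum_mono)
        fix b
        have "potential (c -` {b}) (\<lambda>i. xb b i + e) \<le> N (\<lambda>i. xb b i + e)"
          unfolding int_xb[OF e] by (rule member_le_sum) (auto simp: potential_nonneg)
        also have "\<dots> \<le> N (xb b) + e * N (\<lambda>_. 1)" using e by (intro le_add_const) auto
        finally show "potential (c -` {b}) (\<lambda>i. xb b i + e) \<le> N (xb b) + e * N (\<lambda>_. 1)" .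
      qed
      finally show "N x \<le> (\<Sum>b\<in>UNIV. N (zero_ext (c -` {b}) x)) + m * N (\<lambda>_. 1) * e"
        by (simp add: sum.distrib m_def xb_def mult_ac)
    qed (simp add: m_def N1)
    show "(\<Sum>b\<in>UNIV. N (zero_ext (c -` {b}) x)) \<le> N x"
    \<comment> \<open>The constant collects an error e N(1, ..., 1) for each pair of blocks, from
      the potentials of the other blocks at (e, ..., e), and one more from N(x + e).\<close>
    proof (rule le_if_le_add_eps[where C = "(1 + m * m) * N (\<lambda>_. 1)"])
      fix e :: real assume e: "0 < e"
      have small: "potential (c -` {b}) (\<lambda>i. e) \<le> e * N (\<lambda>_. 1)" for b
      proof -
        have "potential (c -` {b}) (\<lambda>i. e) \<le> potential_sum c (\<lambda>i. e)"
          unfolding potential_sum_def by (rule member_le_sum) (auto simp: potential_nonneg)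
        also have "\<dots> = N (\<lambda>i. e * 1)" using e by (subst interior) auto
        also have "\<dots> = e * N (\<lambda>_. 1)" using e by (subst homog) auto
        finally show ?thesis .
      qed
      have "(\<Sum>b\<in>UNIV. N (xb b)) \<le> (\<Sum>b\<in>UNIV. N (\<lambda>i. xb b i + e))"
        using e by (intro sum_mono mono) (simp add: le_fun_def)
      also have "\<dots> \<le> (\<Sum>b\<in>UNIV. potential (c -` {b}) (\<lambda>i. x i + e) + m * (e * N (\<lambda>_. 1)))"
      proof (rule sum_mono)
        fix b
        have "N (\<lambda>i. xb b i + e) = potential (c -` {b}) (\<lambda>i. x i + e) + (\<Sum>b'\<in>UNIV - {b}. potential (c -` {b'}) (\<lambda>i. xb b i + e))"
          unfolding int_xb[OF e] by (subst sum.remove[of _ b]) (auto simp: same)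
        also have "(\<Sum>b'\<in>UNIV - {b}. potential (c -` {b'}) (\<lambda>i. xb b i + e)) = (\<Sum>b'\<in>UNIV - {b}. potential (c -` {b'}) (\<lambda>i. e))"
          by (intro sum.cong refl potential_cong) (auto simp: xb_def override_def)
        also have "\<dots> \<le> (\<Sum>b'\<in>(UNIV :: 'b set). e * N (\<lambda>_. 1))"
          using e N1 by (intro order_trans[OF sum_mono[OF small] sum_mono2]) auto
        finally show "N (\<lambda>i. xb b i + e) \<le> potential (c -` {b}) (\<lambda>i. x i + e) + m * (e * N (\<lambda>_. 1))"
          by (simp add: m_def)
      qed
      also have "\<dots> = N (\<lambda>i. x i + e) + m * (m * (e * N (\<lambda>_. 1)))"
        using e by (simp add: int_x sum.distrib m_def)
      also have "N (\<lambda>i. x i + e) \<le> N x + e * N (\<lambda>_. 1)" using e by (intro le_add_const) auto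
      finally show "(\<Sum>b\<in>UNIV. N (zero_ext (c -` {b}) x)) \<le> N x + (1 + m * m) * N (\<lambda>_. 1) * e"
        by (simp add: xb_def algebra_simps)
    qed (simp add: m_def N1)
  qed
qed

end

section \<open>Anti-blocking bodies and their gauges\<close>

text \<open>The |S|-dimensional volume of a coordinate section. For empty S the measure is a unit
  point mass, so the value is 1 if the origin belongs to L.\<close>

definition section_volume :: "('i \<Rightarrow> real) set \<Rightarrow> 'i set \<Rightarrow> ennreal" where
  "section_volume L S = (\<integral>\<^sup>+x. indicator L (zero_ext S x) \<partial>orthant_measure S)"

definition scale_set :: "real \<Rightarrow> ('i \<Rightarrow> real) set \<Rightarrow> ('i \<Rightarrow> real) set" where
  "scale_set r L = (\<lambda>x i. r * x i) ` L"

lemma measurable_override_zero [measurable]: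
  "(\<lambda>x. override S x (\<lambda>_. 0::real)) \<in> measurable (PiM S (\<lambda>_. borel)) (PiM UNIV (\<lambda>_. borel))"
  by (rule measurable_override) (auto simp: space_PiM)

lemma AE_PiM_coordinate:
  fixes S :: "'i set"
  assumes M: "sigma_finite_measure M" and S: "finite S" "i \<in> S"
    and P: "AE x in M. P x" and [measurable]: "Measurable.pred M P"
  shows "AE x in PiM S (\<lambda>_. M). P (x i)"
proof -
  interpret M: sigma_finite_measure M by (rule M)
  interpret I: product_sigma_finite "\<lambda>_::'i. M" by standard
  define A where "A = (\<lambda>j. if j = i then {x \<in> space M. \<not> P x} else space M)"
  have "emeasure M (A i) = 0"
    using P by (subst (asm) AE_iff_measurable[OF _ refl]) (auto simp: A_def)
  then have "(\<Prod>j\<in>S. emeasure M (A j)) = 0" using S by (auto simp: prod_zero_iff)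
  moreover have "emeasure (PiM S (\<lambda>_. M)) (Pi\<^sub>E S A) = (\<Prod>j\<in>S. emeasure M (A j))"
    by (rule I.emeasure_PiM[OF S(1)]) (auto simp: A_def)
  moreover have "{x \<in> space (PiM S (\<lambda>_. M)). \<not> P (x i)} = Pi\<^sub>E S A"
    using S(2) by (auto simp: space_PiM A_def PiE_iff extensional_def split: if_splits)
  moreover have "Pi\<^sub>E S A \<in> sets (PiM S (\<lambda>_. M))"
    using S(1) by (intro sets_PiM_I_finite) (auto simp: A_def)
  ultimately show ?thesis by (intro AE_I[of _ _ "Pi\<^sub>E S A"]) auto
qed

lemma AE_half_lborel_neq_0: "AE x in half_lborel. x \<noteq> 0"
proof -
  have "AE x in lborel. x \<noteq> (0::real)" by (rule AE_lborel_singleton)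
  then show ?thesis unfolding half_lborel_def by (subst AE_density) (auto elim!: eventually_mono)
qed

locale down_closed =
  fixes L :: "('i::finite \<Rightarrow> real) set"
  assumes orthant: "x \<in> L \<Longrightarrow> 0 \<le> x i"
    and down: "y \<in> L \<Longrightarrow> (\<And>i. 0 \<le> x i) \<Longrightarrow> (\<And>i. x i \<le> y i) \<Longrightarrow> x \<in> L"
    and sets_L [measurable]: "L \<in> sets (PiM UNIV (\<lambda>_. borel))"

text \<open>Closedness appears in its radial form, which is what makes the infimum in the gauge
  attained; \<open>bounded_above\<close> gives coercivity of the gauge and finite section
  volumes.\<close>

locale antiblocking_body = down_closed +
  assumes zero_mem: "(\<lambda>_. 0) \<in> L"
    and convex_comb: "x \<in> L \<Longrightarrow> y \<in> L \<Longrightarrow> 0 \<le> t \<Longrightarrow> t \<le> 1 \<Longrightarrow> (\<lambda>i. (1 - t) * x i + t * y i) \<in> L"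
    and radially_closed: "(\<And>t. 0 \<le> t \<Longrightarrow> t < 1 \<Longrightarrow> (\<lambda>i. t * x i) \<in> L) \<Longrightarrow> x \<in> L"
    and bounded_above: "\<exists>R>0. \<forall>x\<in>L. \<forall>i. x i \<le> R"
begin

lemma mem_scale_set_iff: "0 < r \<Longrightarrow> x \<in> scale_set r L \<longleftrightarrow> (\<lambda>i. x i / r) \<in> L"
  unfolding scale_set_def by (force simp: fun_eq_iff)

lemma scale_set_0: "scale_set 0 L = {\<lambda>_. 0}"
  using zero_mem by (auto simp: scale_set_def)

lemma down_closed_scale_set:
  assumes "0 \<le> r"
  shows "down_closed (scale_set r L)"
proof (cases "r = 0")
  case True
  have "{\<lambda>_::'a. 0::real} = Pi\<^sub>E UNIV (\<lambda>_. {0})" by (auto simp: fun_eq_iff)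
  also have "\<dots> \<in> sets (PiM UNIV (\<lambda>_. borel))" by (intro sets_PiM_I_finite) auto
  finally show ?thesis unfolding True scale_set_0
    by unfold_locales (auto simp: fun_eq_iff intro: order_antisym)
next
  case False
  then have r: "0 < r" using assms by simp
  have "scale_set r L = (\<lambda>x. \<lambda>i\<in>UNIV. x i / r) -` L \<inter> space (PiM UNIV (\<lambda>_. borel))"
    using r by (auto simp: mem_scale_set_iff space_PiM restrict_UNIV)
  also have "\<dots> \<in> sets (PiM UNIV (\<lambda>_. borel))"
    by (rule measurable_sets[OF _ sets_L]) measurable
  finally have [measurable]: "scale_set r L \<in> sets (PiM UNIV (\<lambda>_. borel))" .
  show ?thesis
  proof
    fix x i assume "x \<in> scale_set r L"
    then show "0 \<le> x i" using r orthant by (auto simp: scale_set_def)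
  next
    fix x y assume "y \<in> scale_set r L" "\<And>i. 0 \<le> x i" "\<And>i. x i \<le> y i"
    then show "x \<in> scale_set r L"
      using r by (auto simp: mem_scale_set_iff divide_right_mono intro: down[of "\<lambda>i. y i / r"])
  qed measurable
qed

lemma section_volume_scale:
  assumes "0 \<le> r"
  shows "section_volume (scale_set r L) S = ennreal (r ^ card S) * section_volume L S"
proof (cases "r = 0")
  \<comment> \<open>At r = 0 the convention 0^0 = 1 fits: the section over the empty set is a point,
    and every other section of the origin is null.\<close>
  case True
  show ?thesis
  proof (cases "S = {}")
    case True
    then show ?thesis using \<open>r = 0\<close> zero_mem
      by (simp add: section_volume_def scale_set_0 override_def)
  next
    case False
    then obtain i where i: "i \<in> S" by auto
    have "AE x in orthant_measure S. x i \<noteq> 0"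
      by (rule AE_PiM_coordinate[OF sigma_finite_half_lborel finite i AE_half_lborel_neq_0]) measurable
    then have "section_volume (scale_set r L) S = (\<integral>\<^sup>+x. 0 \<partial>PiM S (\<lambda>_::'a. half_lborel))"
      unfolding section_volume_def using i
      by (intro nn_integral_cong_AE) (auto simp: indicator_def True scale_set_0 override_def fun_eq_iff elim!: eventually_mono)
    then show ?thesis using False True by (simp add: card_gt_0_iff)
  qed
next
  case False
  then have r: "0 < r" using assms by simp
  have "section_volume (scale_set r L) S = (\<integral>\<^sup>+x. indicator L (override S (\<lambda>i\<in>S. (1 / r) * x i) (\<lambda>_. 0)) \<partial>orthant_measure S)"
    unfolding section_volume_def
  proof (intro nn_integral_cong)
    fix x :: "'a \<Rightarrow> real"
    have "(\<lambda>i. zero_ext S x i / r) = override S (\<lambda>i\<in>S. (1 / r) * x i) (\<lambda>_. 0)"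
      by (auto simp: override_def fun_eq_iff)
    then show "indicator (scale_set r L) (zero_ext S x) = (indicator L (override S (\<lambda>i\<in>S. (1 / r) * x i) (\<lambda>_. 0)) :: ennreal)"
      using r by (simp add: indicator_def mem_scale_set_iff)
  qed
  also have "\<dots> = ennreal ((1 / (1 / r)) ^ card S) * (\<integral>\<^sup>+x. indicator L (zero_ext S x) \<partial>orthant_measure S)"
    using r by (intro nn_integral_PiM_half_lborel_scale) auto
  finally show ?thesis by (simp add: section_volume_def)
qed

lemma section_volume_finite: "section_volume L S < \<infinity>"
proof -
  obtain R where R: "0 < R" "\<And>x i. x \<in> L \<Longrightarrow> x i \<le> R" using bounded_above by auto
  have "section_volume L S \<le> (\<integral>\<^sup>+x. (\<Prod>i\<in>S. indicator {0..R} (x i)) \<partial>orthant_measure S)"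
    unfolding section_volume_def
  proof (intro nn_integral_mono)
    fix x :: "'a \<Rightarrow> real"
    show "indicator L (zero_ext S x) \<le> (\<Prod>i\<in>S. indicator {0..R} (x i) :: ennreal)"
    proof (cases "zero_ext S x \<in> L")
      case True
      have "indicator {0..R} (x i) = (1 :: ennreal)" if "i \<in> S" for i
        using that R(2)[OF True, of i] orthant[OF True, of i] by (simp add: override_def)
      then show ?thesis using True by simp
    qed simp
  qed
  also have "\<dots> = (\<Prod>i\<in>S. emeasure half_lborel {0..R})"
    by (subst half.product_nn_integral_prod) auto
  also have "\<dots> < \<infinity>"
    using R(1) by (simp add: emeasure_half_lborel ennreal_power power_less_top_ennreal)
  finally show ?thesis .
qed

end

lemma nn_integral_half_lborel_power_exp:
  "(\<integral>\<^sup>+r. ennreal (r ^ d * exp (- r)) \<partial>half_lborel) = ennreal (fact d)"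
proof -
  have "(\<integral>\<^sup>+r. ennreal (r ^ d * exp (- r)) \<partial>half_lborel) = (\<integral>\<^sup>+r. ennreal (r ^ d * exp (- r)) * indicator {0..} r \<partial>lborel)"
    by (rule nn_integral_half_lborel) simp
  also have "\<dots> = (\<integral>\<^sup>+r. ennreal (indicator {0..} r * r powr (real (Suc d) - 1) / exp r) \<partial>lborel)"
    by (rule nn_integral_cong_AE, rule eventually_mono[OF AE_lborel_singleton[of 0]])
       (auto simp: indicator_def powr_realpow exp_minus divide_inverse)
  also have "\<dots> = ennreal (Gamma (real (Suc d)))"
    by (rule Gamma_conv_nn_integral_real[symmetric]) simp
  also have "Gamma (real (Suc d)) = fact d" by (simp add: Gamma_fact)
  finally show ?thesis .
qed

text \<open>By \<open>down\<close>, L then contains a cube with a vertex at the origin, which makes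
  the gauge finite.\<close>

locale full_antiblocking_body = antiblocking_body +
  assumes full: "\<exists>a>0. (\<lambda>_. a) \<in> L"
begin

definition gauge :: "('a \<Rightarrow> real) \<Rightarrow> real" where
  "gauge x = Inf {r. 0 < r \<and> (\<lambda>i. max 0 (x i) / r) \<in> L}"

lemma gauge_bdd: "bdd_below {r. 0 < r \<and> (\<lambda>i. max 0 (x i) / r) \<in> L}"
  by (rule bdd_belowI[of _ 0]) auto

lemma gauge_set_nonempty: "{r. 0 < r \<and> (\<lambda>i. max 0 (x i) / r) \<in> L} \<noteq> {}"
proof -
  obtain a where a: "0 < a" "(\<lambda>_. a) \<in> L" using full by auto
  \<comment> \<open>Makes every coordinate of the positive part of x at most a r; the summand 1
    keeps \<open>r\<close> positive when x = 0.\<close>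
  define r where "r = (1 + (\<Sum>i\<in>UNIV. \<bar>x i\<bar>)) / a"
  have s: "0 \<le> (\<Sum>i\<in>UNIV. \<bar>x i\<bar>)" by (simp add: sum_nonneg)
  have r: "0 < r" using a s unfolding r_def by (intro divide_pos_pos add_pos_nonneg) auto
  have "(\<lambda>i. max 0 (x i) / r) \<in> L"
  proof (rule down[OF a(2)])
    fix i
    show "0 \<le> max 0 (x i) / r" using r by simp
    have "\<bar>x i\<bar> \<le> (\<Sum>i\<in>UNIV. \<bar>x i\<bar>)" by (rule member_le_sum) auto
    then have "max 0 (x i) \<le> a * r" using a by (simp add: r_def)
    then show "max 0 (x i) / r \<le> a" using r by (simp add: divide_simps)
  qed
  then show ?thesis using r by auto
qed

lemma gauge_nonneg: "0 \<le> gauge x"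
  unfolding gauge_def by (rule cInf_greatest[OF gauge_set_nonempty]) auto

text \<open>For x in the orthant with gauge at most r and t < 1, some admissible s is smaller than r
  / t, and t x / r lies below x / s. So all proper multiples of x / r belong to L, and
  \<open>radially_closed\<close> gives x / r itself.\<close>

lemma gauge_le_iff:
  assumes r: "0 < r"
  shows "gauge x \<le> r \<longleftrightarrow> (\<lambda>i. max 0 (x i) / r) \<in> L"
proof
  assume "(\<lambda>i. max 0 (x i) / r) \<in> L"
  then show "gauge x \<le> r" unfolding gauge_def using r by (intro cInf_lower gauge_bdd) auto
next
  assume le: "gauge x \<le> r"
  show "(\<lambda>i. max 0 (x i) / r) \<in> L"
  proof (rule radially_closed)
    fix t :: real assume t: "0 \<le> t" "t < 1"
    show "(\<lambda>i. t * (max 0 (x i) / r)) \<in> L"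
    proof (cases "t = 0")
      case True then show ?thesis using zero_mem by simp
    next
      case False
      then have t0: "0 < t" using t by simp
      then have "gauge x < r / t" using le r t by (simp add: pos_less_divide_eq) (smt (verit) mult_less_cancel_left2 gauge_nonneg mult_left_le)
      then obtain s where s: "0 < s" "(\<lambda>i. max 0 (x i) / s) \<in> L" "s < r / t"
        unfolding gauge_def using cInf_less_iff[OF gauge_set_nonempty gauge_bdd] by auto
      show ?thesis
      proof (rule down[OF s(2)])
        fix i
        show "0 \<le> t * (max 0 (x i) / r)" using t r by simp
        have "t / r \<le> 1 / s" using s t0 r by (simp add: field_simps)
        then have "max 0 (x i) * (t / r) \<le> max 0 (x i) * (1 / s)" by (intro mult_left_mono) auto
        then show "t * (max 0 (x i) / r) \<le> max 0 (x i) / s" by (simp add: mult.commute)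
      qed
    qed
  qed
qed

lemma gauge_leI:
  assumes "0 \<le> B" "\<And>r. B \<le> r \<Longrightarrow> 0 < r \<Longrightarrow> gauge x \<le> r"
  shows "gauge x \<le> B"
proof (rule field_le_epsilon)
  fix e :: real assume "0 < e"
  then show "gauge x \<le> B + e" using assms by (intro assms(2)) auto
qed

sublocale orthant_gauge gauge
proof
  fix x y :: "'a \<Rightarrow> real" assume xy: "x \<le> y"
  show "gauge x \<le> gauge y"
  proof (rule gauge_leI[OF gauge_nonneg])
    fix r assume r: "gauge y \<le> r" "0 < r"
    then have mem: "(\<lambda>i. max 0 (y i) / r) \<in> L" by (simp add: gauge_le_iff)
    have "(\<lambda>i. max 0 (x i) / r) \<in> L"
      using xy r by (intro down[OF mem]) (auto simp: le_fun_def intro!: divide_right_mono max.mono)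
    then show "gauge x \<le> r" using r by (simp add: gauge_le_iff)
  qed
next
  fix x y :: "'a \<Rightarrow> real"
  have aux: "gauge (\<lambda>i. x i + y i) \<le> r + s" if r: "gauge x \<le> r" "0 < r" and s: "gauge y \<le> s" "0 < s" for r s
  proof -
    have "(\<lambda>i. max 0 (x i) / r) \<in> L" "(\<lambda>i. max 0 (y i) / s) \<in> L" using r s by (simp_all add: gauge_le_iff)
    \<comment> \<open>The convex combination with weights r / (r + s) and s / (r + s), as for every
      gauge of a convex set.\<close>
    then have mem: "(\<lambda>i. (1 - s / (r + s)) * (max 0 (x i) / r) + s / (r + s) * (max 0 (y i) / s)) \<in> L"
      using r s by (intro convex_comb) auto
    have "(1 - s / (r + s)) = r / (r + s)" using r s by (simp add: field_simps)
    then have eq: "(1 - s / (r + s)) * (max 0 (x i) / r) + s / (r + s) * (max 0 (y i) / s) = (max 0 (x i) + max 0 (y i)) / (r + s)" for i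
      using r s by (simp add: add_divide_distrib)
    have "(\<lambda>i. max 0 (x i + y i) / (r + s)) \<in> L"
      using r s by (intro down[OF mem[unfolded eq]]) (auto intro!: divide_right_mono)
    then show ?thesis using r s by (simp add: gauge_le_iff)
  qed
  show "gauge (\<lambda>i. x i + y i) \<le> gauge x + gauge y"
  proof (rule field_le_epsilon)
    fix e :: real assume "0 < e"
    then have "gauge (\<lambda>i. x i + y i) \<le> (gauge x + e / 2) + (gauge y + e / 2)"
      using gauge_nonneg[of x] gauge_nonneg[of y] by (intro aux) auto
    then show "gauge (\<lambda>i. x i + y i) \<le> gauge x + gauge y + e" by simp
  qed
next
  fix c :: real and x :: "'a \<Rightarrow> real" assume c: "0 \<le> c"
  show "gauge (\<lambda>i. c * x i) = c * gauge x"
  proof (cases "c = 0")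
    case True
    have "gauge (\<lambda>_. 0) \<le> 0" by (rule gauge_leI) (auto simp: gauge_le_iff zero_mem)
    then show ?thesis using True gauge_nonneg[of "\<lambda>_. 0"] by simp
  next
    case False
    then have c0: "0 < c" using c by simp
    have iff: "gauge (\<lambda>i. c * x i) \<le> r \<longleftrightarrow> gauge x \<le> r / c" if r: "0 < r" for r
    proof -
      have "max 0 (c * x i) / r = max 0 (x i) / (r / c)" for i
        using c0 r by (auto simp: max_def zero_le_mult_iff mult_le_0_iff)
      then show ?thesis using c0 r by (simp add: gauge_le_iff)
    qed
    show ?thesis
    proof (rule antisym)
      show "gauge (\<lambda>i. c * x i) \<le> c * gauge x"
      proof (rule gauge_leI)
        fix r assume "c * gauge x \<le> r" "0 < r"
        then show "gauge (\<lambda>i. c * x i) \<le> r" using c0 by (simp add: iff pos_le_divide_eq mult.commute)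
      qed (simp add: c gauge_nonneg)
      have "gauge x \<le> gauge (\<lambda>i. c * x i) / c"
      proof (rule gauge_leI)
        fix r assume "gauge (\<lambda>i. c * x i) / c \<le> r" "0 < r"
        then show "gauge x \<le> r" using c0 iff[of "r * c"] by (simp add: pos_divide_le_eq)
      qed (simp add: c gauge_nonneg)
      then show "c * gauge x \<le> gauge (\<lambda>i. c * x i)" using c0 by (simp add: pos_le_divide_eq mult.commute)
    qed
  qed
next
  fix x :: "'a \<Rightarrow> real"
  show "gauge (\<lambda>i. max 0 (x i)) = gauge x" by (simp add: gauge_def)
next
  obtain R where R: "0 < R" "\<And>x i. x \<in> L \<Longrightarrow> x i \<le> R" using bounded_above by auto
  define n where "n = real CARD('a)"
  have n: "0 < n" by (simp add: n_def)
  \<comment> \<open>Every coordinate of x is at most R times the gauge; summing n of them gives the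
    constant.\<close>
  have "(1 / (n * R)) * (\<Sum>i\<in>UNIV. x i) \<le> gauge x" for x
  proof (rule field_le_epsilon)
    fix e :: real assume "0 < e"
    define r where "r = gauge x + e"
    have r: "0 < r" "gauge x \<le> r" using \<open>0 < e\<close> gauge_nonneg[of x] by (auto simp: r_def)
    then have mem: "(\<lambda>i. max 0 (x i) / r) \<in> L" by (simp add: gauge_le_iff)
    have "x i \<le> R * r" for i
      using R(2)[OF mem, of i] r by (simp add: pos_divide_le_eq)
    then have "(\<Sum>i\<in>UNIV. x i) \<le> (\<Sum>i\<in>(UNIV::'a set). R * r)" by (intro sum_mono)
    also have "\<dots> = n * R * r" by (simp add: n_def)
    finally show "(1 / (n * R)) * (\<Sum>i\<in>UNIV. x i) \<le> gauge x + e"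
      using n R(1) by (simp add: r_def pos_divide_le_eq mult_ac)
  qed
  then show "\<exists>c>0. \<forall>x. c * (\<Sum>i\<in>UNIV. x i) \<le> gauge x"
    using n R(1) by (intro exI[of _ "1 / (n * R)"]) auto
qed

text \<open>The number exp(-N) is the integral of exp(-r) over r >= N, and the sublevel set of the
  gauge at r is the dilate of L by r. After Fubini the section volume is multiplied by the integral
  of r^|S| exp(-r), which is |S|!.\<close>

lemma total_eq_section_volume: "ennreal (total S) = ennreal (fact (card S)) * section_volume L S"
proof -
  have [measurable]: "(\<lambda>x. gauge (zero_ext S x)) \<in> borel_measurable (PiM S (\<lambda>_. borel))"
    by measurable
  interpret S: finite_product_sigma_finite "\<lambda>_::'a. half_lborel" S by standard auto
  interpret P: pair_sigma_finite "PiM S (\<lambda>_::'a. half_lborel)" half_lborel by standard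
  have exp_eq: "ennreal (exp (- z)) = (\<integral>\<^sup>+r. ennreal (exp (- r)) * indicator {z..} r \<partial>half_lborel)" if z: "0 \<le> z" for z
  proof -
    have "(\<integral>\<^sup>+r. ennreal (exp (- r)) * indicator {z..} r \<partial>half_lborel) = (\<integral>\<^sup>+r. ennreal (exp (- r)) * indicator {z..} r * indicator {0..} r \<partial>lborel)"
      by (rule nn_integral_half_lborel) measurable
    also have "\<dots> = (\<integral>\<^sup>+r. ennreal (exp (- r)) * indicator {z..} r \<partial>lborel)"
      using z by (intro nn_integral_cong) (auto simp: indicator_def)
    also have "\<dots> = ennreal (0 - (- exp (- z)))"
    proof (rule nn_integral_FTC_atLeast)
      have "((\<lambda>x::real. exp (- x)) \<longlongrightarrow> 0) at_top"
        by (rule filterlim_compose[OF exp_at_bot filterlim_uminus_at_bot_at_top])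
      then show "((\<lambda>x::real. - exp (- x)) \<longlongrightarrow> 0) at_top"
        using tendsto_minus by fastforce
    qed (auto intro!: derivative_eq_intros)
    finally show ?thesis by simp
  qed
  have "ennreal (total S) = (\<integral>\<^sup>+x. (\<integral>\<^sup>+r. ennreal (exp (- r)) * indicator {gauge (zero_ext S x)..} r \<partial>half_lborel) \<partial>orthant_measure S)"
    by (simp add: total_eq exp_eq gauge_nonneg)
  also have "\<dots> = (\<integral>\<^sup>+x. (\<integral>\<^sup>+r. ennreal (exp (- r)) * indicator {p. gauge (override S (fst p) (\<lambda>_. 0)) \<le> snd p} (x, r) \<partial>half_lborel) \<partial>orthant_measure S)"
    by (intro nn_integral_cong) (auto simp: indicator_def)
  also have "\<dots> = (\<integral>\<^sup>+r. (\<integral>\<^sup>+x. ennreal (exp (- r)) * indicator {p. gauge (override S (fst p) (\<lambda>_. 0)) \<le> snd p} (x, r) \<partial>orthant_measure S) \<partial>half_lborel)"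
    by (rule P.Fubini'[symmetric]) (simp add: case_prod_beta' indicator_def, measurable)
  also have "\<dots> = (\<integral>\<^sup>+r. ennreal (r ^ card S * exp (- r)) * section_volume L S \<partial>half_lborel)"
  proof (rule nn_integral_cong_AE)
    have "AE r in half_lborel. 0 < r"
      using AE_half_lborel AE_half_lborel_neq_0 by eventually_elim auto
    then show "AE r in half_lborel. (\<integral>\<^sup>+x. ennreal (exp (- r)) * indicator {p. gauge (override S (fst p) (\<lambda>_. 0)) \<le> snd p} (x, r) \<partial>orthant_measure S)
       = ennreal (r ^ card S * exp (- r)) * section_volume L S"
    proof eventually_elim
      case (elim r)
      interpret r: down_closed "scale_set r L" by (rule down_closed_scale_set) (use elim in simp)
      have "AE x in PiM S (\<lambda>_::'a. half_lborel). \<forall>i\<in>S. 0 \<le> x i"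
        by (rule AE_finite_allI) (auto intro: AE_PiM_coordinate[OF sigma_finite_half_lborel finite _ AE_half_lborel])
      then have "(\<integral>\<^sup>+x. ennreal (exp (- r)) * indicator {p. gauge (override S (fst p) (\<lambda>_. 0)) \<le> snd p} (x, r) \<partial>orthant_measure S)
        = (\<integral>\<^sup>+x. ennreal (exp (- r)) * indicator (scale_set r L) (zero_ext S x) \<partial>orthant_measure S)"
      proof (intro nn_integral_cong_AE, eventually_elim)
        fix x :: "'a \<Rightarrow> real" assume x: "\<forall>i\<in>S. 0 \<le> x i"
        have "(\<lambda>i. max 0 (zero_ext S x i) / r) = (\<lambda>i. zero_ext S x i / r)"
          using x by (auto simp: override_def fun_eq_iff)
        then have "gauge (zero_ext S x) \<le> r \<longleftrightarrow> zero_ext S x \<in> scale_set r L"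
          using elim by (simp add: gauge_le_iff mem_scale_set_iff)
        then show "ennreal (exp (- r)) * indicator {p. gauge (override S (fst p) (\<lambda>_. 0)) \<le> snd p} (x, r)
          = ennreal (exp (- r)) * indicator (scale_set r L) (zero_ext S x)"
          by (simp add: indicator_def)
      qed
      also have "\<dots> = ennreal (exp (- r)) * section_volume (scale_set r L) S"
        unfolding section_volume_def by (rule nn_integral_cmult) measurable
      also have "\<dots> = ennreal (r ^ card S * exp (- r)) * section_volume L S"
        using elim by (simp add: section_volume_scale ennreal_mult mult_ac)
      finally show ?case .
    qed
  qed
  also have "\<dots> = ennreal (fact (card S)) * section_volume L S"
    by (subst nn_integral_multc) (auto simp: nn_integral_half_lborel_power_exp)
  finally show ?thesis .
qed

end

section \<open>Volume of a sum with a negative diagonal\<close>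

lemma nn_integral_lborel_shift_reflect:
  fixes f :: "real \<Rightarrow> ennreal"
  assumes "f \<in> borel_measurable borel"
  shows "(\<integral>\<^sup>+x. f (x + a) \<partial>lborel) = 1 * (\<integral>\<^sup>+x. f x \<partial>lborel)" "(\<integral>\<^sup>+x. f (- x) \<partial>lborel) = 1 * (\<integral>\<^sup>+x. f x \<partial>lborel)"
  using nn_integral_real_affine[OF assms, of 1 a] nn_integral_real_affine[OF assms, of "-1" 0]
  by (simp_all add: add.commute)

text \<open>Parametrises the piece of c by the orthant. In a column j with c j = Some k, the
  variable at (k, j) is the depth of the most negative entry, and the others are excesses over that
  entry; in the remaining columns the variables are the entries themselves.\<close>

definition piece_map :: "('n \<Rightarrow> 'p option) \<Rightarrow> ('p \<times> 'n \<Rightarrow> real) \<Rightarrow> 'p \<times> 'n \<Rightarrow> real" where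
  "piece_map c u = (\<lambda>(i, j). case c j of None \<Rightarrow> u (i, j) | Some k \<Rightarrow> if i = k then - u (k, j) else u (i, j) - u (k, j))"

lemma measurable_piece_map [measurable]:
  "piece_map c \<in> measurable (PiM UNIV (\<lambda>_. borel)) (PiM UNIV (\<lambda>_. borel))"
proof (rule measurable_PiM_single')
  fix p :: "'a \<times> 'b"
  show "(\<lambda>u. piece_map c u p) \<in> borel_measurable (PiM UNIV (\<lambda>_. borel))"
    by (cases p; cases "c (snd p)") (auto simp: piece_map_def)
qed (auto simp: space_PiM)

text \<open>The coordinates in \<open>B\<close> are reflected, and all others are translated by
  amounts that depend on \<open>B\<close> only. With the integral over the complement of
  \<open>B\<close> innermost, invariance under translations and then under reflections
  applies.\<close>

lemma nn_integral_piece_map: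
  fixes c :: "'n::finite \<Rightarrow> 'p::finite option"
  assumes g [measurable]: "g \<in> borel_measurable (PiM UNIV (\<lambda>_. borel))"
  shows "(\<integral>\<^sup>+u. g (piece_map c u) \<partial>PiM UNIV (\<lambda>_. lborel)) = (\<integral>\<^sup>+u. g u \<partial>PiM UNIV (\<lambda>_. lborel))"
proof -
  have sets_eq: "sets (PiM T (\<lambda>_. lborel)) = sets (PiM T (\<lambda>_. borel :: real measure))" for T :: "('p \<times> 'n) set"
    by (intro sets_PiM_cong) auto
  have meas_eq [simp]: "measurable (PiM T (\<lambda>_. lborel)) N = measurable (PiM T (\<lambda>_. borel :: real measure)) N" for T :: "('p \<times> 'n) set" and N :: "'c measure"
    by (intro measurable_cong_sets sets_eq refl)
  define B where "B = {(k, j). c j = Some k}"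
  define s where "s = (\<lambda>(x :: 'p \<times> 'n \<Rightarrow> real) (i :: 'p, j). case c j of None \<Rightarrow> 0 | Some k \<Rightarrow> - x (k, j))"
  let ?MB = "PiM B (\<lambda>_. lborel :: real measure)" and ?MA = "PiM (- B) (\<lambda>_. lborel :: real measure)"
  have merge_meas: "(\<lambda>y. merge B (- B) (x, y)) \<in> measurable ?MA (PiM UNIV (\<lambda>_. borel))" if "x \<in> space ?MB" for x
  proof -
    have "(\<lambda>y. merge B (- B) (x, y)) \<in> measurable ?MA (PiM (B \<union> - B) (\<lambda>_. lborel))"
      using that by (intro measurable_compose[OF _ measurable_merge] measurable_Pair measurable_const) auto
    also have "measurable ?MA (PiM (B \<union> - B) (\<lambda>_. lborel :: real measure)) = measurable ?MA (PiM UNIV (\<lambda>_. borel))"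
      by (intro measurable_cong_sets) (simp_all add: sets_eq)
    finally show ?thesis .
  qed
  have fold: "(\<integral>\<^sup>+u. h u \<partial>PiM UNIV (\<lambda>_. lborel)) = (\<integral>\<^sup>+x. \<integral>\<^sup>+y. h (merge B (- B) (x, y)) \<partial>?MA \<partial>?MB)"
    if h: "h \<in> borel_measurable (PiM UNIV (\<lambda>_. borel))" for h :: "('p \<times> 'n \<Rightarrow> real) \<Rightarrow> ennreal"
  proof -
    have "(\<integral>\<^sup>+u. h u \<partial>PiM (B \<union> - B) (\<lambda>_. lborel)) = (\<integral>\<^sup>+x. \<integral>\<^sup>+y. h (merge B (- B) (x, y)) \<partial>?MA \<partial>?MB)"
      by (rule full.product_nn_integral_fold) (use h in auto)
    then show ?thesis by simp
  qed
  have inner: "(\<lambda>x. \<integral>\<^sup>+y. g (merge B (- B) (x, y)) \<partial>?MA) \<in> borel_measurable ?MB"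
  proof -
    interpret A: finite_product_sigma_finite "\<lambda>_::'p \<times> 'n. lborel :: real measure" "- B" by standard auto
    have "merge B (- B) \<in> measurable (?MB \<Otimes>\<^sub>M ?MA) (PiM (B \<union> - B) (\<lambda>_. lborel))" by (rule measurable_merge)
    also have "measurable (?MB \<Otimes>\<^sub>M ?MA) (PiM (B \<union> - B) (\<lambda>_. lborel :: real measure)) = measurable (?MB \<Otimes>\<^sub>M ?MA) (PiM UNIV (\<lambda>_. borel))"
      by (intro measurable_cong_sets) (simp_all add: sets_eq)
    finally have "(\<lambda>p. g (merge B (- B) p)) \<in> borel_measurable (?MB \<Otimes>\<^sub>M ?MA)"
      by (rule measurable_compose[OF _ g])
    then show ?thesis
      by (intro A.borel_measurable_nn_integral) (simp add: case_prod_eta del: meas_eq)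
  qed
  have "(\<integral>\<^sup>+u. g (piece_map c u) \<partial>PiM UNIV (\<lambda>_. lborel)) = (\<integral>\<^sup>+x. \<integral>\<^sup>+y. g (piece_map c (merge B (- B) (x, y))) \<partial>?MA \<partial>?MB)"
    by (rule fold) measurable
  also have "\<dots> = (\<integral>\<^sup>+x. \<integral>\<^sup>+y. g (merge B (- B) (\<lambda>p\<in>B. - x p, y)) \<partial>?MA \<partial>?MB)"
  proof (rule nn_integral_cong)
    fix x assume x: "x \<in> space ?MB"
    have x': "(\<lambda>p\<in>B. - x p) \<in> space ?MB" by (auto simp: space_PiM)
    have merge_g: "(\<lambda>y. g (merge B (- B) (\<lambda>p\<in>B. - x p, y))) \<in> borel_measurable ?MA"
      by (rule measurable_compose[OF merge_meas[OF x'] g])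
    have "piece_map c (merge B (- B) (x, y)) = merge B (- B) (\<lambda>p\<in>B. - x p, \<lambda>p\<in>- B. y p + s x p)" for y
      by (auto simp: fun_eq_iff piece_map_def merge_def B_def s_def split: option.splits)
    then have "(\<integral>\<^sup>+y. g (piece_map c (merge B (- B) (x, y))) \<partial>?MA)
      = (\<integral>\<^sup>+y. g (merge B (- B) (\<lambda>p\<in>B. - x p, \<lambda>p\<in>- B. y p + s x p)) \<partial>?MA)" by simp
    also have "\<dots> = (\<Prod>p\<in>- B. 1) * (\<integral>\<^sup>+y. g (merge B (- B) (\<lambda>p\<in>B. - x p, y)) \<partial>?MA)"
      by (rule nn_integral_PiM_transform[OF sigma_finite_lborel])
         (use merge_g in \<open>auto intro!: nn_integral_lborel_shift_reflect(1)[unfolded mult_1] simp del: merge_restrict\<close>)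
    finally show "(\<integral>\<^sup>+y. g (piece_map c (merge B (- B) (x, y))) \<partial>?MA) = (\<integral>\<^sup>+y. g (merge B (- B) (\<lambda>p\<in>B. - x p, y)) \<partial>?MA)"
      by simp
  qed
  also have "\<dots> = (\<Prod>p\<in>B. 1) * (\<integral>\<^sup>+x. \<integral>\<^sup>+y. g (merge B (- B) (x, y)) \<partial>?MA \<partial>?MB)"
    by (rule nn_integral_PiM_transform[OF sigma_finite_lborel, where g = "\<lambda>x. \<integral>\<^sup>+y. g (merge B (- B) (x, y)) \<partial>?MA" and T = "\<lambda>_ x. - x"])
       (use inner in \<open>auto intro!: nn_integral_lborel_shift_reflect(2)[unfolded mult_1] simp del: merge_restrict\<close>)
  also have "\<dots> = (\<integral>\<^sup>+u. g u \<partial>PiM UNIV (\<lambda>_. lborel))"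
    by (simp add: fold[OF g])
  finally show ?thesis .
qed

text \<open>Ties are broken towards the smallest index, so that the pieces are disjoint.\<close>

definition argmin_neg :: "('p::{finite,linorder} \<Rightarrow> real) \<Rightarrow> 'p option \<Rightarrow> bool" where
  "argmin_neg w b = (case b of None \<Rightarrow> \<forall>i. 0 \<le> w i
     | Some k \<Rightarrow> w k < 0 \<and> (\<forall>i. w k \<le> w i) \<and> (\<forall>i<k. w k < w i))"

lemma argmin_neg_ex1: "\<exists>!b. argmin_neg w b"
proof (cases "\<forall>i. 0 \<le> w i")
  case True
  then show ?thesis
    by (intro ex1I[of _ None]) (auto simp: argmin_neg_def not_less[symmetric] split: option.splits)
next
  case False
  define A where "A = {i. \<forall>i'. w i \<le> w i'}"
  have ne: "A \<noteq> {}"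
  proof -
    have "Min (range w) \<in> range w" by (rule Min_in) auto
    then obtain i where "w i = Min (range w)" by (metis imageE)
    then have "i \<in> A" by (simp add: A_def)
    then show ?thesis by auto
  qed
  define k where "k = Min A"
  have k: "k \<in> A" "\<And>i. i \<in> A \<Longrightarrow> k \<le> i" using ne by (auto simp: k_def)
  have neg: "w k < 0" using False k(1) by (auto simp: A_def not_le intro: le_less_trans)
  have lt: "w k < w i" if "i < k" for i
  proof (rule ccontr)
    assume "\<not> w k < w i"
    then have "i \<in> A" using k(1) by (auto simp: A_def not_less intro: order_trans)
    then show False using k(2)[of i] that by simp
  qed
  show ?thesis
  proof (rule ex1I[of _ "Some k"])
    show "argmin_neg w (Some k)" using neg lt k(1) by (simp add: argmin_neg_def A_def)
    fix b assume b: "argmin_neg w b"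
    show "b = Some k"
    proof (cases b)
      case None
      then show ?thesis using b False by (simp add: argmin_neg_def)
    next
      case (Some i)
      then have "\<forall>i'. w i \<le> w i'" "\<forall>i'<i. w i < w i'" using b by (auto simp: argmin_neg_def)
      moreover have "\<forall>i'. w k \<le> w i'" using k(1) by (simp add: A_def)
      ultimately have "\<not> k < i" "\<not> i < k" using lt by (metis leD)+
      then show ?thesis using Some by auto
    qed
  qed
qed

definition in_piece :: "('n \<Rightarrow> 'p::{finite,linorder} option) \<Rightarrow> ('p \<times> 'n \<Rightarrow> real) \<Rightarrow> bool" where
  "in_piece c z \<longleftrightarrow> (\<forall>j. argmin_neg (\<lambda>i. z (i, j)) (c j))"

lemma sum_in_piece:
  fixes z :: "'p::{finite,linorder} \<times> 'n::finite \<Rightarrow> real"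
  shows "(\<Sum>c\<in>UNIV. of_bool (in_piece c z)) = (1 :: ennreal)"
proof -
  define c where "c = (\<lambda>j. THE b. argmin_neg (\<lambda>i. z (i, j)) b)"
  have c: "argmin_neg (\<lambda>i. z (i, j)) b \<longleftrightarrow> b = c j" for j b
    using theI'[OF argmin_neg_ex1, of "\<lambda>i. z (i, j)"] argmin_neg_ex1[of "\<lambda>i. z (i, j)"] by (auto simp: c_def)
  have "in_piece c' z \<longleftrightarrow> c' = c" for c' by (auto simp: in_piece_def c fun_eq_iff)
  then show ?thesis by (simp add: of_bool_def sum.delta)
qed

lemma in_piece_measurable [measurable]:
  "Measurable.pred (PiM UNIV (\<lambda>_. borel)) (in_piece (c :: 'n::finite \<Rightarrow> 'p::{finite,linorder} option))"
proof -
  have "Measurable.pred (PiM UNIV (\<lambda>_. borel)) (\<lambda>z. argmin_neg (\<lambda>i. z (i, j)) (c j))" for j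
  proof (cases "c j")
    case None
    then show ?thesis by (simp add: argmin_neg_def)
  next
    case (Some a)
    have le: "Measurable.pred (PiM UNIV (\<lambda>_. borel)) (\<lambda>z :: 'p \<times> 'n \<Rightarrow> real. z p \<le> z q)"
      and lt: "Measurable.pred (PiM UNIV (\<lambda>_. borel)) (\<lambda>z :: 'p \<times> 'n \<Rightarrow> real. z p < z q)" for p q
      unfolding pred_def by (rule borel_measurable_le borel_measurable_less, (rule measurable_component_singleton, simp)+)+
    have "(\<lambda>z. argmin_neg (\<lambda>i. z (i, j)) (c j)) =
      (\<lambda>z :: 'p \<times> 'n \<Rightarrow> real. z (a, j) < 0 \<and> (\<forall>i\<in>UNIV. z (a, j) \<le> z (i, j)) \<and> (\<forall>i\<in>{..<a}. z (a, j) < z (i, j)))"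
      using Some by (auto simp: argmin_neg_def fun_eq_iff)
    then show ?thesis
      by (simp only:) (intro pred_intros_logic pred_intros_finite finite le lt, simp)
  qed
  then have "Measurable.pred (PiM UNIV (\<lambda>_. borel)) (\<lambda>z. \<forall>j\<in>UNIV. argmin_neg (\<lambda>i. z (i, j)) (c j))"
    by (intro pred_intros_finite finite)
  then show ?thesis by (simp add: in_piece_def[abs_def])
qed

text \<open>When no coordinate of u is zero, the strict and the weak inequalities in
  \<open>argmin_neg\<close> coincide, so the tie-breaking disappears. The excluded points form a
  null set.\<close>

lemma in_piece_piece_map:
  fixes c :: "'n \<Rightarrow> 'p::{finite,linorder} option"
  assumes u: "\<And>p. u p \<noteq> 0"
  shows "in_piece c (piece_map c u) \<longleftrightarrow> (\<forall>p. 0 \<le> u p)"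
proof -
  have "argmin_neg (\<lambda>i. piece_map c u (i, j)) (c j) \<longleftrightarrow> (\<forall>i. 0 \<le> u (i, j))" for j
  proof (cases "c j")
    case None
    then show ?thesis by (simp add: argmin_neg_def piece_map_def)
  next
    case (Some k)
    have "0 < u (i, j) \<longleftrightarrow> 0 \<le> u (i, j)" for i using u[of "(i, j)"] by (simp add: less_le)
    then show ?thesis using Some by (auto simp: argmin_neg_def piece_map_def) metis
  qed
  then show ?thesis by (auto simp: in_piece_def)
qed

text \<open>The sum of \<open>L\<close>, embedded by minus the diagonal, and of the product of the \<open>M i\<close>.\<close>

definition diagonal_sum :: "('n \<Rightarrow> real) set \<Rightarrow> ('p \<Rightarrow> ('n \<Rightarrow> real) set) \<Rightarrow> ('p \<times> 'n \<Rightarrow> real) set" where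
  "diagonal_sum L M = {z. \<exists>x\<in>L. \<forall>i. (\<lambda>j. z (i, j) + x j) \<in> M i}"

definition neg_part :: "('p::finite \<times> 'n \<Rightarrow> real) \<Rightarrow> 'n \<Rightarrow> real" where
  "neg_part z j = Max (insert 0 (range (\<lambda>i. - z (i, j))))"

lemma neg_part_ge: "0 \<le> neg_part z j" "- z (i, j) \<le> neg_part z j"
  unfolding neg_part_def by (rule Max_ge; auto)+

lemma neg_part_le: "0 \<le> a \<Longrightarrow> (\<And>i. - z (i, j) \<le> a) \<Longrightarrow> neg_part z j \<le> a"
  unfolding neg_part_def by (subst Max_le_iff) auto

lemma neg_part_measurable [measurable]: "(\<lambda>z. neg_part z j) \<in> borel_measurable (PiM UNIV (\<lambda>_ :: 'p::finite \<times> 'n. borel))"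
proof -
  have eq: "neg_part z j = max 0 (Max ((\<lambda>i. - z (i, j)) ` UNIV))" for z :: "'p \<times> 'n \<Rightarrow> real"
    unfolding neg_part_def by (subst Max_insert) auto
  show ?thesis unfolding eq by measurable
qed

context
  fixes L :: "('n::finite \<Rightarrow> real) set" and M :: "'p::{finite,linorder} \<Rightarrow> ('n \<Rightarrow> real) set"
  assumes L: "down_closed L" and M: "\<And>i. down_closed (M i)"
begin

interpretation L: down_closed L by (rule L)
interpretation M: down_closed "M i" for i by (rule M)

text \<open>The existential in \<open>diagonal_sum\<close> has a best witness: every admissible x
  dominates \<open>neg_part z\<close>, the least nonnegative vector that makes all rows of z
  nonnegative, and down-closedness lets x shrink to it.\<close>

lemma diagonal_sum_iff:
  "z \<in> diagonal_sum L M \<longleftrightarrow> neg_part z \<in> L \<and> (\<forall>i. (\<lambda>j. z (i, j) + neg_part z j) \<in> M i)"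
proof
  assume "z \<in> diagonal_sum L M"
  then obtain x where x: "x \<in> L" and zx: "\<And>i. (\<lambda>j. z (i, j) + x j) \<in> M i"
    by (auto simp: diagonal_sum_def)
  have le: "neg_part z j \<le> x j" for j
    by (rule neg_part_le) (use L.orthant[OF x] M.orthant[OF zx] in \<open>auto simp: minus_le_iff algebra_simps\<close>, smt (verit) M.orthant zx)
  show "neg_part z \<in> L \<and> (\<forall>i. (\<lambda>j. z (i, j) + neg_part z j) \<in> M i)"
  proof (intro conjI allI)
    show "neg_part z \<in> L" by (rule L.down[OF x neg_part_ge(1) le])
    show "(\<lambda>j. z (i, j) + neg_part z j) \<in> M i" for i
    proof (rule M.down[OF zx])
      fix j
      show "0 \<le> z (i, j) + neg_part z j" using neg_part_ge(2)[of z i j] by simp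
      show "z (i, j) + neg_part z j \<le> z (i, j) + x j" using le[of j] by simp
    qed
  qed
qed (auto simp: diagonal_sum_def)

lemma diagonal_sum_measurable [measurable]: "diagonal_sum L M \<in> sets (PiM UNIV (\<lambda>_. borel))"
proof -
  have np [measurable]: "neg_part \<in> measurable (PiM UNIV (\<lambda>_ :: 'p \<times> 'n. borel)) (PiM UNIV (\<lambda>_. borel))"
    by (rule measurable_PiM_single') (auto simp: space_PiM)
  have np2 [measurable]: "(\<lambda>z j. z (i, j) + neg_part z j) \<in> measurable (PiM UNIV (\<lambda>_ :: 'p \<times> 'n. borel)) (PiM UNIV (\<lambda>_. borel))" for i
    by (rule measurable_PiM_single') (auto simp: space_PiM)
  have "Measurable.pred (PiM UNIV (\<lambda>_ :: 'p \<times> 'n. borel)) (\<lambda>z. neg_part z \<in> L \<and> (\<forall>i. (\<lambda>j. z (i, j) + neg_part z j) \<in> M i))"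
    by measurable
  moreover have "diagonal_sum L M = {z \<in> space (PiM UNIV (\<lambda>_. borel)). neg_part z \<in> L \<and> (\<forall>i. (\<lambda>j. z (i, j) + neg_part z j) \<in> M i)}"
    by (auto simp: diagonal_sum_iff space_PiM)
  ultimately show ?thesis by (simp add: pred_def)
qed

abbreviation body :: "'p option \<Rightarrow> ('n \<Rightarrow> real) set" where
  "body b \<equiv> case b of None \<Rightarrow> L | Some i \<Rightarrow> M i"

text \<open>On this piece \<open>neg_part\<close> consists of the variables at (k, j) with c j =
  Some k, and row i plus \<open>neg_part\<close> consists of the variables at (i, j) with c j
  different from Some i, with zeros elsewhere. These positions partition all pn of them, so the p +
  1 membership conditions concern separate variables.\<close>

lemma volume_piece:
  fixes c :: "'n \<Rightarrow> 'p option"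
  shows "(\<integral>\<^sup>+u. indicator (diagonal_sum L M) (piece_map c u) \<partial>orthant_measure UNIV)
    = (\<Prod>b\<in>UNIV. section_volume (body b) (- (c -` {b})))"
proof -
  define f where "f = (\<lambda>b j. (case b of None \<Rightarrow> the (c j) | Some i \<Rightarrow> i, j))"
  define S where "S = (\<lambda>b. - (c -` {b}))"
  define R where "R = (\<lambda>b. f b ` S b)"
  define g where "g = (\<lambda>b w. indicator (body b) (override (S b) w (\<lambda>_. 0)) :: ennreal)"
  have inj: "inj_on (f b) (S b)" for b by (auto simp: inj_on_def f_def)
  have U: "(\<Union>b\<in>UNIV. R b) = UNIV"
  proof -
    have "(i, j) \<in> (\<Union>b\<in>UNIV. R b)" for i j
    proof (cases "c j = Some i")
      case True
      then have "j \<in> S None" "(i, j) = f None j" by (auto simp: S_def f_def)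
      then show ?thesis unfolding R_def by blast
    next
      case False
      then have "j \<in> S (Some i)" "(i, j) = f (Some i) j" by (auto simp: S_def f_def)
      then show ?thesis unfolding R_def by blast
    qed
    then show ?thesis by auto
  qed
  have disj: "disjoint_family_on R UNIV"
    by (auto simp: disjoint_family_on_def R_def S_def f_def split: option.splits)
  have body_meas [measurable]: "body b \<in> sets (PiM UNIV (\<lambda>_. borel))" for b
    by (cases b) auto
  have g_meas [measurable]: "g b \<in> borel_measurable (PiM (S b) (\<lambda>_. borel))" for b
    unfolding g_def by measurable
  have g_restr [measurable]: "(\<lambda>x. g b (\<lambda>s\<in>S b. x (f b s))) \<in> borel_measurable (PiM (R b) (\<lambda>_. borel))" for b
  proof (rule measurable_compose[OF _ g_meas])
    show "(\<lambda>x. \<lambda>s\<in>S b. x (f b s)) \<in> measurable (PiM (R b) (\<lambda>_. borel)) (PiM (S b) (\<lambda>_. borel))"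
      by (intro measurable_restrict measurable_component_singleton) (auto simp: R_def)
  qed
  have "AE u in PiM UNIV (\<lambda>_ :: 'p \<times> 'n. half_lborel). \<forall>p\<in>UNIV. 0 \<le> u p"
    by (rule AE_finite_allI) (auto intro: AE_PiM_coordinate[OF sigma_finite_half_lborel finite _ AE_half_lborel])
  then have "(\<integral>\<^sup>+u. indicator (diagonal_sum L M) (piece_map c u) \<partial>orthant_measure UNIV)
    = (\<integral>\<^sup>+u. (\<Prod>b\<in>UNIV. g b (\<lambda>s\<in>S b. restrict u (R b) (f b s))) \<partial>orthant_measure (\<Union>b\<in>UNIV. R b))"
    unfolding U
  proof (intro nn_integral_cong_AE, eventually_elim)
    fix u :: "'p \<times> 'n \<Rightarrow> real" assume u: "\<forall>p\<in>UNIV. 0 \<le> u p"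
    have np: "neg_part (piece_map c u) = override (S None) (\<lambda>s. u (f None s)) (\<lambda>_. 0)"
    proof
      fix j
      show "neg_part (piece_map c u) j = override (S None) (\<lambda>s. u (f None s)) (\<lambda>_. 0) j"
      proof (cases "c j")
        case None
        show ?thesis
          by (rule antisym[OF neg_part_le]) (use None u in \<open>auto simp: override_def S_def piece_map_def neg_part_ge(1)\<close>)
      next
        case (Some k)
        have "u (k, j) \<le> neg_part (piece_map c u) j"
          using neg_part_ge(2)[of "piece_map c u" k j] Some by (simp add: piece_map_def)
        moreover have "neg_part (piece_map c u) j \<le> u (k, j)"
          by (rule neg_part_le) (use Some u in \<open>auto simp: piece_map_def\<close>)
        ultimately show ?thesis using Some by (simp add: override_def S_def f_def)
      qed
    qed
    have y: "(\<lambda>j. piece_map c u (i, j) + neg_part (piece_map c u) j) = override (S (Some i)) (\<lambda>s. u (f (Some i) s)) (\<lambda>_. 0)" for i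
      unfolding np by (auto simp: fun_eq_iff override_def S_def f_def piece_map_def split: option.splits)
    have gb: "g b (\<lambda>s\<in>S b. restrict u (R b) (f b s)) = indicator (body b) (override (S b) (\<lambda>s. u (f b s)) (\<lambda>_. 0))" for b
      unfolding g_def by (intro arg_cong[where f = "indicator (body b)"]) (auto simp: override_def fun_eq_iff R_def)
    have "piece_map c u \<in> diagonal_sum L M \<longleftrightarrow> (\<forall>b. override (S b) (\<lambda>s. u (f b s)) (\<lambda>_. 0) \<in> body b)"
      unfolding diagonal_sum_iff y by (auto simp: split_option_all np)
    then show "indicator (diagonal_sum L M) (piece_map c u) = (\<Prod>b\<in>UNIV. g b (\<lambda>s\<in>S b. restrict u (R b) (f b s)))"
      unfolding gb by (auto simp: indicator_def prod_zero_iff)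
  qed
  also have "\<dots> = (\<Prod>b\<in>UNIV. \<integral>\<^sup>+x. g b (\<lambda>s\<in>S b. x (f b s)) \<partial>orthant_measure (R b))"
    by (rule nn_integral_PiM_partition[OF sigma_finite_half_lborel, where g = "\<lambda>b x. g b (\<lambda>s\<in>S b. x (f b s))"])
       (use disj in auto)
  also have "\<dots> = (\<Prod>b\<in>UNIV. section_volume (body b) (S b))"
    unfolding R_def section_volume_def g_def
    by (intro prod.cong refl nn_integral_PiM_reindex[OF sigma_finite_half_lborel] finite inj) auto
  finally show ?thesis by (simp add: S_def)
qed

text \<open>The indicators of the pieces sum to 1, and the measure-preserving
  \<open>piece_map c\<close> pulls its piece back to the orthant, up to a null set.\<close>

lemma volume_diagonal_sum:
  "(\<integral>\<^sup>+z. indicator (diagonal_sum L M) z \<partial>PiM UNIV (\<lambda>_. lborel))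
    = (\<Sum>c\<in>UNIV. \<Prod>b\<in>UNIV. section_volume (body b) (- (c -` {b})))"
proof -
  have meas_eq [simp]: "measurable (PiM T (\<lambda>_. lborel)) N = measurable (PiM T (\<lambda>_. borel :: real measure)) N" for T :: "('p \<times> 'n) set" and N :: "'c measure"
    by (intro measurable_cong_sets sets_PiM_cong refl) auto
  let ?W = "indicator (diagonal_sum L M) :: _ \<Rightarrow> ennreal"
  have [measurable]: "(\<lambda>u. ?W (piece_map c u)) \<in> borel_measurable (PiM UNIV (\<lambda>_. borel))" for c :: "'n \<Rightarrow> 'p option"
    by (rule measurable_compose[OF measurable_piece_map]) measurable
  have "(\<integral>\<^sup>+z. ?W z \<partial>PiM UNIV (\<lambda>_. lborel)) = (\<integral>\<^sup>+z. (\<Sum>c\<in>UNIV. of_bool (in_piece c z) * ?W z) \<partial>PiM UNIV (\<lambda>_. lborel))"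
    by (simp add: sum_distrib_right[symmetric] sum_in_piece)
  also have "\<dots> = (\<Sum>c\<in>UNIV. \<integral>\<^sup>+z. of_bool (in_piece c z) * ?W z \<partial>PiM UNIV (\<lambda>_. lborel))"
    by (rule nn_integral_sum) simp
  also have "\<dots> = (\<Sum>c\<in>UNIV. \<Prod>b\<in>UNIV. section_volume (body b) (- (c -` {b})))"
  proof (rule sum.cong[OF refl])
    fix c :: "'n \<Rightarrow> 'p option"
    have "(\<integral>\<^sup>+z. of_bool (in_piece c z) * ?W z \<partial>PiM UNIV (\<lambda>_. lborel))
      = (\<integral>\<^sup>+u. of_bool (in_piece c (piece_map c u)) * ?W (piece_map c u) \<partial>PiM UNIV (\<lambda>_. lborel))"
      by (rule nn_integral_piece_map[symmetric]) measurable
    also have "\<dots> = (\<integral>\<^sup>+u. ?W (piece_map c u) * (\<Prod>p\<in>UNIV. indicator {0..} (u p)) \<partial>PiM UNIV (\<lambda>_. lborel))"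
    proof -
      have "AE u in PiM UNIV (\<lambda>_ :: 'p \<times> 'n. lborel). \<forall>p\<in>UNIV. u p \<noteq> (0::real)"
        by (rule AE_finite_allI) (auto intro: AE_PiM_coordinate[OF sigma_finite_lborel finite _ AE_lborel_singleton])
      then show ?thesis
      proof (intro nn_integral_cong_AE, eventually_elim)
        fix u :: "'p \<times> 'n \<Rightarrow> real" assume "\<forall>p\<in>UNIV. u p \<noteq> 0"
        then have "in_piece c (piece_map c u) \<longleftrightarrow> (\<forall>p. 0 \<le> u p)" by (intro in_piece_piece_map) auto
        moreover have "(\<Prod>p\<in>UNIV. indicator {0..} (u p)) = (of_bool (\<forall>p. 0 \<le> u p) :: ennreal)"
          by (auto simp: indicator_def of_bool_def prod_zero_iff simp del: split_paired_All split_paired_Ex)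
        ultimately show "of_bool (in_piece c (piece_map c u)) * ?W (piece_map c u) = ?W (piece_map c u) * (\<Prod>p\<in>UNIV. indicator {0..} (u p))"
          by (simp add: mult.commute)
      qed
    qed
    also have "\<dots> = (\<integral>\<^sup>+u. ?W (piece_map c u) \<partial>orthant_measure UNIV)"
      by (rule nn_integral_PiM_half_lborel[symmetric]) auto
    also have "\<dots> = (\<Prod>b\<in>UNIV. section_volume (body b) (- (c -` {b})))"
      by (rule volume_piece)
    finally show "(\<integral>\<^sup>+z. of_bool (in_piece c z) * ?W z \<partial>PiM UNIV (\<lambda>_. lborel)) = (\<Prod>b\<in>UNIV. section_volume (body b) (- (c -` {b})))" .
  qed
  finally show ?thesis .
qed

end

section \<open>Euclidean spaces and anti-blocking bodies in coordinates\<close>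

lemma nn_integral_lborel_reindex:
  fixes e :: "'i::finite \<Rightarrow> 'a::euclidean_space" and g :: "'a \<Rightarrow> ennreal"
  assumes e: "bij_betw e UNIV Basis" and g [measurable]: "g \<in> borel_measurable borel"
  shows "(\<integral>\<^sup>+v. g v \<partial>lborel) = (\<integral>\<^sup>+x. g (\<Sum>i\<in>UNIV. x i *\<^sub>R e i) \<partial>PiM UNIV (\<lambda>_. lborel))"
proof -
  have inj: "inj e" and img: "e ` UNIV = Basis" using e by (auto simp: bij_betw_def)
  have [measurable]: "(\<lambda>x. g (\<Sum>i\<in>UNIV. x i *\<^sub>R e i)) \<in> borel_measurable (PiM UNIV (\<lambda>_. lborel))"
    by measurable
  have "(\<integral>\<^sup>+v. g v \<partial>lborel) = (\<integral>\<^sup>+f. g (\<Sum>b\<in>Basis. f b *\<^sub>R b) \<partial>PiM Basis (\<lambda>_. lborel))"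
    by (subst lborel_eq) (rule nn_integral_distr; measurable)
  also have "\<dots> = (\<integral>\<^sup>+f. g (\<Sum>i\<in>UNIV. (\<lambda>i\<in>UNIV. f (e i)) i *\<^sub>R e i) \<partial>PiM (e ` UNIV) (\<lambda>_. lborel))"
    unfolding img[symmetric] sum.reindex[OF inj] by simp
  also have "\<dots> = (\<integral>\<^sup>+x. g (\<Sum>i\<in>UNIV. x i *\<^sub>R e i) \<partial>PiM UNIV (\<lambda>_. lborel))"
    by (rule nn_integral_PiM_reindex[OF sigma_finite_lborel finite inj]) measurable
  finally show ?thesis .
qed

lemma nn_integral_lborel_vec:
  fixes g :: "real ^ 'n::finite \<Rightarrow> ennreal"
  assumes "g \<in> borel_measurable borel"
  shows "(\<integral>\<^sup>+v. g v \<partial>lborel) = (\<integral>\<^sup>+x. g (\<chi> j. x j) \<partial>PiM UNIV (\<lambda>_. lborel))"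
proof -
  have "bij_betw (\<lambda>j::'n. axis j (1::real)) UNIV Basis"
    by (auto simp: bij_betw_def inj_on_def Basis_vec_def axis_eq_axis)
  moreover have "(\<Sum>j\<in>UNIV. x j *\<^sub>R axis j (1::real)) = (\<chi> j. x j)" for x :: "'n \<Rightarrow> real"
    by (simp add: vec_eq_iff axis_def if_distrib[of "(*) _"] cong: if_cong)
  ultimately show ?thesis using nn_integral_lborel_reindex[OF _ assms, of "\<lambda>j. axis j 1"] by simp
qed

lemma nn_integral_lborel_matrix:
  fixes g :: "real ^ 'n::finite ^ 'p::finite \<Rightarrow> ennreal"
  assumes "g \<in> borel_measurable borel"
  shows "(\<integral>\<^sup>+v. g v \<partial>lborel) = (\<integral>\<^sup>+x. g (\<chi> i j. x (i, j)) \<partial>PiM UNIV (\<lambda>_. lborel))"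
proof -
  define e where "e = (\<lambda>(i::'p, j::'n). axis i (axis j (1::real)))"
  have "bij_betw e UNIV Basis"
  proof -
    have "inj e" by (auto simp: e_def inj_on_def axis_eq_axis)
    moreover have "range e = Basis" by (auto simp: e_def Basis_vec_def image_iff)
    ultimately show ?thesis by (simp add: bij_betw_def)
  qed
  moreover have "(\<Sum>p\<in>UNIV. x p *\<^sub>R e p) = (\<chi> i j. x (i, j))" for x :: "'p \<times> 'n \<Rightarrow> real"
  proof -
    have "(\<Sum>p\<in>UNIV. x p *\<^sub>R e p) $ i $ j = x (i, j)" for i j
    proof -
      have "(\<Sum>p\<in>UNIV. x p *\<^sub>R e p) $ i $ j = (\<Sum>p\<in>UNIV. if p = (i, j) then x p else 0)"
        unfolding sum_component by (intro sum.cong refl) (auto simp: axis_def e_def split: if_splits)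
      then show ?thesis by simp
    qed
    then show ?thesis by (simp add: vec_eq_iff)
  qed
  ultimately show ?thesis using nn_integral_lborel_reindex[OF _ assms, of e] by simp
qed

definition coord_set :: "(real ^ 'n) set \<Rightarrow> ('n \<Rightarrow> real) set" where
  "coord_set K = {x. (\<chi> j. x j) \<in> K}"

lemma orth_proj_coord_subspace:
  fixes x :: "real ^ 'n::finite"
  shows "orth_proj (coord_subspace \<sigma>) x = (\<chi> i. if i \<in> \<sigma> then x $ i else 0)"
proof -
  have in_sub: "y \<in> coord_subspace \<sigma> \<longleftrightarrow> (\<forall>i. i \<notin> \<sigma> \<longrightarrow> y $ i = 0)" for y :: "real ^ 'n"
  proof
    assume "y \<in> coord_subspace \<sigma>"
    then show "\<forall>i. i \<notin> \<sigma> \<longrightarrow> y $ i = 0"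
      unfolding coord_subspace_def
      by (induction rule: span_induct_alt) (auto simp: axis_def split: if_splits)
  next
    assume y: "\<forall>i. i \<notin> \<sigma> \<longrightarrow> y $ i = 0"
    have "y = (\<Sum>i\<in>UNIV. y $ i *\<^sub>R axis i 1)"
      by (simp add: vec_eq_iff axis_def if_distrib[of "(*) _"] cong: if_cong)
    also have "\<dots> \<in> coord_subspace \<sigma>"
      unfolding coord_subspace_def
    proof (rule span_sum)
      fix i
      show "y $ i *\<^sub>R axis i 1 \<in> span ((\<lambda>i. axis i 1) ` \<sigma>)"
      proof (cases "i \<in> \<sigma>")
        case True
        then show ?thesis by (intro span_scale span_base imageI)
      qed (simp add: y span_zero)
    qed
    finally show "y \<in> coord_subspace \<sigma>" .
  qed
  define z where "z = (\<chi> i. if i \<in> \<sigma> then x $ i else 0)"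
  show ?thesis unfolding orth_proj_def z_def[symmetric]
  proof (rule the_equality)
    show "z \<in> coord_subspace \<sigma> \<and> (\<forall>w\<in>coord_subspace \<sigma>. orthogonal (x - z) w)"
      by (auto simp: in_sub z_def orthogonal_def inner_vec_def intro!: sum.neutral)
    fix y assume y: "y \<in> coord_subspace \<sigma> \<and> (\<forall>w\<in>coord_subspace \<sigma>. orthogonal (x - y) w)"
    have "y $ i = z $ i" for i
    proof (cases "i \<in> \<sigma>")
      case True
      then have "axis i 1 \<in> coord_subspace \<sigma>" by (auto simp: in_sub axis_def)
      then have "orthogonal (x - y) (axis i 1)" using y by blast
      then show ?thesis using True by (simp add: orthogonal_def inner_axis z_def)
    next
      case False
      then show ?thesis using y by (simp add: in_sub z_def)
    qed
    then show "y = z" by (simp add: vec_eq_iff)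
  qed
qed

text \<open>Projections only delete coordinates; convexity then allows lowering one: the result lies
  on the segment from a point to its projection. Coordinates are lowered one after another.
  Compactness supplies radial closedness and bounds.\<close>

lemma anti_blocking_coord_set:
  fixes K :: "(real ^ 'n::finite) set"
  assumes K: "convex_body K" and ab: "anti_blocking K"
  shows "antiblocking_body (coord_set K)"
proof -
  let ?L = "coord_set K"
  have K': "K \<noteq> {}" "compact K" "convex K" using K by (auto simp: convex_body_def)
  have orth: "0 \<le> x i" if "x \<in> ?L" for x i
    using ab that by (auto simp: anti_blocking_def coord_set_def subset_iff)
  have proj: "(\<lambda>i. if i \<in> \<sigma> then x i else 0) \<in> ?L" if "x \<in> ?L" for x \<sigma>
  proof -
    have "orth_proj (coord_subspace \<sigma>) (\<chi> j. x j) \<in> K"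
      using ab that unfolding anti_blocking_def coord_set_def by blast
    then show ?thesis by (simp add: orth_proj_coord_subspace coord_set_def cong: if_cong)
  qed
  have conv: "(\<lambda>i. (1 - t) * x i + t * y i) \<in> ?L" if "x \<in> ?L" "y \<in> ?L" "0 \<le> t" "t \<le> 1" for x y t
  proof -
    have "(1 - t) *\<^sub>R (\<chi> j. x j) + t *\<^sub>R (\<chi> j. y j) \<in> K"
      using that by (intro convexD[OF K'(3)]) (auto simp: coord_set_def)
    also have "(1 - t) *\<^sub>R (\<chi> j. x j) + t *\<^sub>R (\<chi> j. y j) = (\<chi> i. (1 - t) * x i + t * y i)"
      by (simp add: vec_eq_iff)
    finally show ?thesis by (simp add: coord_set_def)
  qed
  have down1: "z(i := a) \<in> ?L" if z: "z \<in> ?L" and a: "0 \<le> a" "a \<le> z i" for z i a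
  proof (cases "z i = 0")
    case True
    then have "z(i := a) = z" using a by (auto simp: fun_eq_iff)
    then show ?thesis using z by simp
  next
    case False
    then have zi: "0 < z i" using a by simp
    \<comment> \<open>The weight a / z i leaves the other coordinates unchanged and turns coordinate
      i into a.\<close>
    have "(\<lambda>k. (1 - a / z i) * (if k \<in> - {i} then z k else 0) + a / z i * z k) \<in> ?L"
      using zi a by (intro conv proj z) auto
    also have "(\<lambda>k. (1 - a / z i) * (if k \<in> - {i} then z k else 0) + a / z i * z k) = z(i := a)"
      using zi by (auto simp: fun_eq_iff algebra_simps)
    finally show ?thesis .
  qed
  have down: "x \<in> ?L" if y: "y \<in> ?L" and xy: "\<And>i. 0 \<le> x i" "\<And>i. x i \<le> y i" for x y
  proof -
    have "override S x y \<in> ?L" for S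
      using finite[of S]
    proof (induction S rule: finite_induct)
      case (insert i S)
      have upd: "override (insert i S) x y = (override S x y)(i := x i)"
        by (auto simp: override_def fun_eq_iff)
      show ?case unfolding upd using insert.hyps xy by (intro down1 insert.IH) (auto simp: override_def)
    qed (simp add: override_def y)
    from this[of UNIV] show ?thesis by (simp add: override_def)
  qed
  have closed: "x \<in> ?L" if x: "\<And>t. 0 \<le> t \<Longrightarrow> t < 1 \<Longrightarrow> (\<lambda>i. t * x i) \<in> ?L" for x
  proof -
    have lim: "(\<lambda>n. (1 - 1 / real (Suc n)) *\<^sub>R (\<chi> j. x j)) \<longlonglongrightarrow> (1 - 0) *\<^sub>R (\<chi> j. x j)"
      using LIMSEQ_inverse_real_of_nat by (intro tendsto_intros) (simp add: inverse_eq_divide)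
    have mem: "(1 - 1 / real (Suc n)) *\<^sub>R (\<chi> j. x j) \<in> K" for n
    proof -
      have "(\<chi> i. (1 - 1 / real (Suc n)) * x i) \<in> K"
        using x[of "1 - 1 / real (Suc n)"] by (simp add: coord_set_def)
      also have "(\<chi> i. (1 - 1 / real (Suc n)) * x i) = (1 - 1 / real (Suc n)) *\<^sub>R (\<chi> j. x j)"
        by (simp add: vec_eq_iff)
      finally show ?thesis .
    qed
    have "(1 - 0) *\<^sub>R (\<chi> j. x j) \<in> K"
      by (rule closed_sequentially[OF compact_imp_closed[OF K'(2)] mem lim])
    then show ?thesis by (simp add: coord_set_def)
  qed
  have bdd: "\<exists>R>0. \<forall>x\<in>?L. \<forall>i. x i \<le> R"
  proof -
    obtain R where R: "0 < R" "\<And>v. v \<in> K \<Longrightarrow> norm v \<le> R"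
      using compact_imp_bounded[OF K'(2)] unfolding bounded_pos by blast
    have "x i \<le> R" if "x \<in> ?L" for x i
    proof -
      have "x i \<le> norm (\<chi> j. x j)" using component_le_norm_cart[of "\<chi> j. x j" i] by simp
      also have "\<dots> \<le> R" using that by (intro R) (simp add: coord_set_def)
      finally show ?thesis .
    qed
    then show ?thesis using R(1) by blast
  qed
  have zero: "(\<lambda>_. 0) \<in> ?L"
  proof -
    obtain v where "v \<in> K" using K'(1) by auto
    then have "(\<lambda>i. v $ i) \<in> ?L" by (simp add: coord_set_def)
    from proj[OF this, of "{}"] show ?thesis by simp
  qed
  have sets: "?L \<in> sets (PiM UNIV (\<lambda>_. borel))"
  proof -
    have "(\<lambda>x. \<Sum>j\<in>UNIV. x j *\<^sub>R axis j (1::real)) \<in> borel_measurable (PiM UNIV (\<lambda>_::'n. borel))"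
      by measurable
    moreover have "(\<lambda>x. \<Sum>j\<in>UNIV. x j *\<^sub>R axis j (1::real)) = (\<lambda>x. \<chi> j::'n. x j)"
      by (simp add: fun_eq_iff vec_eq_iff axis_def if_distrib[of "(*) _"] cong: if_cong)
    ultimately have "(\<lambda>x. \<chi> j. x j) -` K \<inter> space (PiM UNIV (\<lambda>_::'n. borel)) \<in> sets (PiM UNIV (\<lambda>_. borel))"
      using borel_compact[OF K'(2)] by (auto intro: measurable_sets)
    then show ?thesis by (simp add: coord_set_def space_PiM vimage_def)
  qed
  show ?thesis
    by unfold_locales (fact orth down sets zero conv closed bdd)+
qed

section \<open>Mixed volumes of block polynomials\<close>

text \<open>The volume is known to be polynomial only at positive arguments. Agreement there
  suffices, because positivity is an open condition and a derivative is local.\<close>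

lemma partial_deriv_cong:
  assumes "i < m" and "\<And>j. j < m \<Longrightarrow> 0 < l j"
    and "\<And>l'. (\<And>j. j < m \<Longrightarrow> 0 < l' j) \<Longrightarrow> f l' = g l'"
  shows "partial_deriv i f l = partial_deriv i g l"
  unfolding partial_deriv_def
proof (rule deriv_cong_ev[OF _ refl])
  have "eventually (\<lambda>t. t \<in> {0<..}) (nhds (l i))"
    using assms(1,2) by (intro eventually_nhds_in_open) auto
  then show "eventually (\<lambda>t. f (l(i := t)) = g (l(i := t))) (nhds (l i))"
    by eventually_elim (use assms in auto)
qed

lemma foldr_partial_deriv_cong:
  assumes "set is \<subseteq> {..<m}" and "\<And>l. (\<And>j. j < m \<Longrightarrow> 0 < l j) \<Longrightarrow> f l = g l" and "\<And>j. j < m \<Longrightarrow> 0 < l j"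
  shows "foldr partial_deriv is f l = foldr partial_deriv is g l"
  using assms(1,3)
proof (induction "is" arbitrary: l)
  case (Cons i "is")
  then show ?case by (auto intro!: partial_deriv_cong[of i m])
qed (simp add: assms(2))

text \<open>Equal bodies of the list share a block, and their multipliers enter the volume only
  through this sum.\<close>

definition block_sum :: "(nat \<Rightarrow> 'b) \<Rightarrow> nat \<Rightarrow> 'b \<Rightarrow> (nat \<Rightarrow> real) \<Rightarrow> real" where
  "block_sum \<beta> m b l = (\<Sum>i | i < m \<and> \<beta> i = b. l i)"

text \<open>The falling factorial, coefficient in the k-th derivative of x^n; for k > n one factor
  is zero, which kills monomials of too small degree.\<close>

definition falling :: "nat \<Rightarrow> nat \<Rightarrow> real" where
  "falling n k = (\<Prod>r<k. real n - real r)"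

lemma falling_Suc: "falling n (Suc k) = falling n k * (real n - real k)"
  by (simp add: falling_def)

lemma falling_eq_0: "n < k \<Longrightarrow> falling n k = 0"
  unfolding falling_def by (rule prod_zero) auto

lemma falling_eq: "k \<le> n \<Longrightarrow> falling n k = fact n / fact (n - k)"
proof (induction k)
  case (Suc k)
  then have "fact (n - k) = real (n - k) * fact (n - Suc k)"
    by (metis Suc_diff_le Suc_le_lessD diff_Suc_Suc fact_Suc of_nat_fact of_nat_mult)
  then show ?case using Suc by (simp add: falling_Suc of_nat_diff divide_simps)
qed (simp add: falling_def)

lemma block_sum_upd:
  assumes "i < m"
  shows "block_sum \<beta> m b (l(i := t)) = (if \<beta> i = b then t + (\<Sum>j | j < m \<and> \<beta> j = b \<and> j \<noteq> i. l j) else block_sum \<beta> m b l)"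
proof (cases "\<beta> i = b")
  case True
  have "{j. j < m \<and> \<beta> j = b} = insert i {j. j < m \<and> \<beta> j = b \<and> j \<noteq> i}" using assms True by auto
  then show ?thesis using True by (simp add: block_sum_def)
qed (auto simp: block_sum_def intro!: sum.cong)

text \<open>Only the block containing i depends on \<open>l i\<close>, with slope 1. If the exponent
  is 0, its truncated predecessor is harmless because the coefficient is 0 as well.\<close>

lemma partial_deriv_block_prod:
  fixes \<beta> :: "nat \<Rightarrow> 'b::finite"
  assumes i: "i < m"
  shows "partial_deriv i (\<lambda>l. \<Sum>c\<in>C. w c * (\<Prod>b\<in>UNIV. block_sum \<beta> m b l ^ e c b)) l
     = (\<Sum>c\<in>C. w c * real (e c (\<beta> i)) * (\<Prod>b\<in>UNIV. block_sum \<beta> m b l ^ ((e c)(\<beta> i := e c (\<beta> i) - 1)) b))"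
proof -
  define a where "a = (\<Sum>j | j < m \<and> \<beta> j = \<beta> i \<and> j \<noteq> i. l j)"
  have split: "(\<Prod>b\<in>UNIV. h b) = h (\<beta> i) * (\<Prod>b\<in>UNIV - {\<beta> i}. h b)" for h :: "'b \<Rightarrow> real"
    by (rule prod.remove) auto
  have li: "l(i := l i) = l" by simp
  have here: "block_sum \<beta> m (\<beta> i) l = l i + a"
    using block_sum_upd[OF i, of \<beta> "\<beta> i" l "l i"] by (simp add: a_def)
  have upd: "(\<Prod>b\<in>UNIV. block_sum \<beta> m b (l(i := t)) ^ e c b)
     = (t + a) ^ e c (\<beta> i) * (\<Prod>b\<in>UNIV - {\<beta> i}. block_sum \<beta> m b l ^ e c b)" for t c
    unfolding split[of "\<lambda>b. block_sum \<beta> m b (l(i := t)) ^ e c b"]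
    by (intro arg_cong2[where f = "(*)"] prod.cong) (auto simp: block_sum_upd[OF i] a_def)
  have "((\<lambda>t. \<Sum>c\<in>C. w c * ((t + a) ^ e c (\<beta> i) * (\<Prod>b\<in>UNIV - {\<beta> i}. block_sum \<beta> m b l ^ e c b)))
    has_field_derivative (\<Sum>c\<in>C. w c * real (e c (\<beta> i)) * ((l i + a) ^ (e c (\<beta> i) - 1) * (\<Prod>b\<in>UNIV - {\<beta> i}. block_sum \<beta> m b l ^ e c b)))) (at (l i))"
    by (intro DERIV_sum) (auto intro!: derivative_eq_intros)
  then have "partial_deriv i (\<lambda>l. \<Sum>c\<in>C. w c * (\<Prod>b\<in>UNIV. block_sum \<beta> m b l ^ e c b)) l
    = (\<Sum>c\<in>C. w c * real (e c (\<beta> i)) * ((l i + a) ^ (e c (\<beta> i) - 1) * (\<Prod>b\<in>UNIV - {\<beta> i}. block_sum \<beta> m b l ^ e c b)))"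
    unfolding partial_deriv_def upd by (rule DERIV_imp_deriv)
  also have "\<dots> = (\<Sum>c\<in>C. w c * real (e c (\<beta> i)) * (\<Prod>b\<in>UNIV. block_sum \<beta> m b l ^ ((e c)(\<beta> i := e c (\<beta> i) - 1)) b))"
  proof (intro sum.cong refl arg_cong2[where f = "(*)"])
    fix c
    show "(l i + a) ^ (e c (\<beta> i) - 1) * (\<Prod>b\<in>UNIV - {\<beta> i}. block_sum \<beta> m b l ^ e c b)
      = (\<Prod>b\<in>UNIV. block_sum \<beta> m b l ^ ((e c)(\<beta> i := e c (\<beta> i) - 1)) b)"
      unfolding split[of "\<lambda>b. block_sum \<beta> m b l ^ ((e c)(\<beta> i := e c (\<beta> i) - 1)) b"]
      by (intro arg_cong2[where f = "(*)"] prod.cong) (auto simp: here)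
  qed
  finally show ?thesis .
qed

lemma foldr_partial_deriv_block_prod:
  fixes \<beta> :: "nat \<Rightarrow> 'b::finite"
  assumes "set is \<subseteq> {..<m}"
  shows "foldr partial_deriv is (\<lambda>l. \<Sum>c\<in>C. w c * (\<Prod>b\<in>UNIV. block_sum \<beta> m b l ^ e c b))
     = (\<lambda>l. \<Sum>c\<in>C. w c * (\<Prod>b\<in>UNIV. falling (e c b) (count_list (map \<beta> is) b)) * (\<Prod>b\<in>UNIV. block_sum \<beta> m b l ^ (e c b - count_list (map \<beta> is) b)))"
  using assms
proof (induction "is")
  case Nil
  then show ?case by (simp add: falling_def)
next
  case (Cons i "is")
  define k where "k = count_list (map \<beta> is)"
  have i: "i < m" using Cons.prems by simp
  have IH: "foldr partial_deriv is (\<lambda>l. \<Sum>c\<in>C. w c * (\<Prod>b\<in>UNIV. block_sum \<beta> m b l ^ e c b))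
     = (\<lambda>l. \<Sum>c\<in>C. w c * (\<Prod>b\<in>UNIV. falling (e c b) (k b)) * (\<Prod>b\<in>UNIV. block_sum \<beta> m b l ^ (e c b - k b)))"
    using Cons unfolding k_def by simp
  \<comment> \<open>Subtraction of naturals agrees with real subtraction while k <= e; beyond that
    both sides contain a vanishing \<open>falling\<close>.\<close>
  have fall: "(\<Prod>b\<in>UNIV. falling (e c b) (count_list (map \<beta> (i # is)) b)) = (\<Prod>b\<in>UNIV. falling (e c b) (k b)) * real (e c (\<beta> i) - k (\<beta> i))" for c
  proof -
    have "falling (e c b) (count_list (map \<beta> (i # is)) b) = falling (e c b) (k b) * (if b = \<beta> i then real (e c (\<beta> i) - k (\<beta> i)) else 1)" for b
    proof (cases "k b \<le> e c b")
      case True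
      then show ?thesis by (auto simp: k_def falling_Suc of_nat_diff)
    next
      case False
      then show ?thesis by (auto simp: k_def falling_eq_0)
    qed
    then show ?thesis by (simp add: prod.distrib prod.delta')
  qed
  show ?case
  proof
    fix l
    have "foldr partial_deriv (i # is) (\<lambda>l. \<Sum>c\<in>C. w c * (\<Prod>b\<in>UNIV. block_sum \<beta> m b l ^ e c b)) l
      = partial_deriv i (\<lambda>l. \<Sum>c\<in>C. (w c * (\<Prod>b\<in>UNIV. falling (e c b) (k b))) * (\<Prod>b\<in>UNIV. block_sum \<beta> m b l ^ (\<lambda>b. e c b - k b) b)) l"
      by (simp add: IH)
    also have "\<dots> = (\<Sum>c\<in>C. w c * (\<Prod>b\<in>UNIV. falling (e c b) (k b)) * real (e c (\<beta> i) - k (\<beta> i))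
        * (\<Prod>b\<in>UNIV. block_sum \<beta> m b l ^ ((\<lambda>b. e c b - k b)(\<beta> i := e c (\<beta> i) - k (\<beta> i) - 1)) b))"
      by (rule partial_deriv_block_prod[OF i])
    also have "\<dots> = (\<Sum>c\<in>C. w c * (\<Prod>b\<in>UNIV. falling (e c b) (count_list (map \<beta> (i # is)) b))
        * (\<Prod>b\<in>UNIV. block_sum \<beta> m b l ^ (e c b - count_list (map \<beta> (i # is)) b)))"
      unfolding fall mult.assoc
      by (intro sum.cong refl arg_cong2[where f = "(*)"] prod.cong) (auto simp: k_def)
    finally show "foldr partial_deriv (i # is) (\<lambda>l. \<Sum>c\<in>C. w c * (\<Prod>b\<in>UNIV. block_sum \<beta> m b l ^ e c b)) l
      = (\<Sum>c\<in>C. w c * (\<Prod>b\<in>UNIV. falling (e c b) (count_list (map \<beta> (i # is)) b))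
        * (\<Prod>b\<in>UNIV. block_sum \<beta> m b l ^ (e c b - count_list (map \<beta> (i # is)) b)))" .
  qed
qed

lemma count_list_upt: "count_list (map \<beta> [0..<m]) b = card {i. i < m \<and> \<beta> i = b}"
proof (induction m)
  case (Suc m)
  have "{i. i < Suc m \<and> \<beta> i = b} = (if \<beta> m = b then insert m {i. i < m \<and> \<beta> i = b} else {i. i < m \<and> \<beta> i = b})"
    by (auto simp: less_Suc_eq)
  then show ?case using Suc by (simp add: count_list_append)
qed simp

text \<open>The degrees \<open>e c\<close> and the block sizes have the same sum, so a degree that differs from the
  block sizes is too small in some block and its monomial is killed by the derivative.\<close>

lemma mixed_volume_block_polynomial:
  fixes Ks :: "'a::euclidean_space set list" and \<beta> :: "nat \<Rightarrow> 'b::finite"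
  defines "k \<equiv> \<lambda>b. card {i. i < length Ks \<and> \<beta> i = b}"
  assumes vol: "\<And>l. (\<And>i. i < length Ks \<Longrightarrow> 0 < l i) \<Longrightarrow>
      measure lebesgue (minkowski_comb Ks l) = (\<Sum>c\<in>C. w c * (\<Prod>b\<in>UNIV. block_sum \<beta> (length Ks) b l ^ e c b))"
    and deg: "\<And>c. c \<in> C \<Longrightarrow> (\<Sum>b\<in>UNIV. e c b) = length Ks" and fin: "finite C"
  shows "mixed_volume Ks = (\<Prod>b\<in>UNIV. fact (k b)) * (\<Sum>c | c \<in> C \<and> e c = k. w c) / fact (length Ks)"
proof -
  define m where "m = length Ks"
  have sum_k: "(\<Sum>b\<in>UNIV. k b) = m"
  proof -
    have "(\<Sum>b\<in>UNIV. k b) = card (\<Union>b\<in>UNIV. {i. i < m \<and> \<beta> i = b})"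
      unfolding k_def m_def by (rule card_UN_disjoint[symmetric]) auto
    also have "(\<Union>b\<in>UNIV. {i. i < m \<and> \<beta> i = b}) = {..<m}" by auto
    finally show ?thesis by simp
  qed
  have "foldr partial_deriv [0..<m] (\<lambda>l. measure lebesgue (minkowski_comb Ks l)) (\<lambda>_. 1)
      = foldr partial_deriv [0..<m] (\<lambda>l. \<Sum>c\<in>C. w c * (\<Prod>b\<in>UNIV. block_sum \<beta> m b l ^ e c b)) (\<lambda>_. 1)"
    by (rule foldr_partial_deriv_cong[where m = m]) (auto simp: m_def vol)
  also have "\<dots> = (\<Sum>c\<in>C. w c * (\<Prod>b\<in>UNIV. falling (e c b) (k b)) * (\<Prod>b\<in>UNIV. block_sum \<beta> m b (\<lambda>_. 1) ^ (e c b - k b)))"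
    by (subst foldr_partial_deriv_block_prod) (auto simp: count_list_upt k_def m_def)
  also have "\<dots> = (\<Sum>c\<in>C. if e c = k then w c * (\<Prod>b\<in>UNIV. fact (k b)) else 0)"
  proof (rule sum.cong[OF refl])
    fix c assume c: "c \<in> C"
    show "w c * (\<Prod>b\<in>UNIV. falling (e c b) (k b)) * (\<Prod>b\<in>UNIV. block_sum \<beta> m b (\<lambda>_. 1) ^ (e c b - k b))
      = (if e c = k then w c * (\<Prod>b\<in>UNIV. fact (k b)) else 0)"
    proof (cases "e c = k")
      case True
      then show ?thesis by (simp add: falling_eq)
    next
      case False
      have "\<exists>b. e c b < k b"
      proof (rule ccontr)
        assume "\<nexists>b. e c b < k b"
        then have le: "k b \<le> e c b" for b by (simp add: not_less)
        obtain b where "k b \<noteq> e c b" using False by (metis ext)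
        then have "(\<Sum>b\<in>UNIV. k b) < (\<Sum>b\<in>UNIV. e c b)"
          using le by (intro sum_strict_mono_ex1) (auto simp: le_less)
        then show False using deg[OF c] sum_k by (simp add: m_def)
      qed
      then obtain b where "falling (e c b) (k b) = 0" using falling_eq_0 by blast
      then have "(\<Prod>b\<in>UNIV. falling (e c b) (k b)) = 0" by (intro prod_zero) auto
      then show ?thesis using False by simp
    qed
  qed
  also have "\<dots> = (\<Prod>b\<in>UNIV. fact (k b)) * (\<Sum>c | c \<in> C \<and> e c = k. w c)"
    using fin by (simp add: sum.If_cases sum_distrib_left mult.commute Collect_conj_eq)
  finally show ?thesis by (simp add: mixed_volume_def m_def)
qed

section \<open>Minkowski combinations of the bodies in the list\<close>

text \<open>The product of the dilates of K by \<open>r (Some i)\<close>, minus the diagonal copy of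
  K dilated by \<open>r None\<close>. With nonnegative coefficients and convex K, this family
  contains all bodies of both lists and is closed under sums and dilations, so a Minkowski
  combination is described by p + 1 coefficients.\<close>

definition block_body :: "(real ^ 'n) set \<Rightarrow> ('p option \<Rightarrow> real) \<Rightarrow> (real ^ 'n ^ 'p) set" where
  "block_body K r = {\<chi> i. r (Some i) *\<^sub>R y (Some i) - r None *\<^sub>R y None | y. \<forall>b. y b \<in> K}"

lemma block_body_plus:
  fixes K :: "(real ^ 'n) set" and r s :: "'p::finite option \<Rightarrow> real"
  assumes K: "convex K" and nn: "\<And>b. 0 \<le> r b" "\<And>b. 0 \<le> s b"
  shows "block_body K r + block_body K s = (block_body K (\<lambda>b. r b + s b) :: (real ^ 'n ^ 'p) set)"
proof (rule set_eqI, rule iffI)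
  fix v :: "real ^ 'n ^ 'p"
  assume "v \<in> block_body K r + block_body K s"
  then obtain y z where y: "\<And>b. y b \<in> K" and z: "\<And>b. z b \<in> K"
    and v: "v = (\<chi> i. r (Some i) *\<^sub>R y (Some i) - r None *\<^sub>R y None) + (\<chi> i. s (Some i) *\<^sub>R z (Some i) - s None *\<^sub>R z None)"
    by (auto simp: block_body_def elim!: set_plus_elim)
  have "\<exists>w. w \<in> K \<and> (r b + s b) *\<^sub>R w = r b *\<^sub>R y b + s b *\<^sub>R z b" for b
  proof (cases "r b + s b = 0")
    case True
    then have "r b = 0" "s b = 0" using nn[of b] by auto
    then show ?thesis using y[of b] by auto
  next
    case False
    have "(r b / (r b + s b)) *\<^sub>R y b + (s b / (r b + s b)) *\<^sub>R z b \<in> K"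
      using False nn[of b] y z by (intro convexD[OF K]) (auto simp: add_divide_distrib[symmetric])
    then show ?thesis using False by (intro exI conjI) (auto simp: scaleR_add_right)
  qed
  then obtain w where w: "\<And>b. w b \<in> K" "\<And>b. (r b + s b) *\<^sub>R w b = r b *\<^sub>R y b + s b *\<^sub>R z b" by metis
  have "v = (\<chi> i. (r (Some i) + s (Some i)) *\<^sub>R w (Some i) - (r None + s None) *\<^sub>R w None)"
    unfolding v w(2) by (simp add: vec_eq_iff algebra_simps)
  then show "v \<in> block_body K (\<lambda>b. r b + s b)" using w(1) by (auto simp: block_body_def)
next
  fix v :: "real ^ 'n ^ 'p"
  assume "v \<in> block_body K (\<lambda>b. r b + s b)"
  then obtain y where y: "\<And>b. y b \<in> K" and v: "v = (\<chi> i. (r (Some i) + s (Some i)) *\<^sub>R y (Some i) - (r None + s None) *\<^sub>R y None)"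
    by (auto simp: block_body_def)
  have "v = (\<chi> i. r (Some i) *\<^sub>R y (Some i) - r None *\<^sub>R y None) + (\<chi> i. s (Some i) *\<^sub>R y (Some i) - s None *\<^sub>R y None)"
    unfolding v by (simp add: vec_eq_iff algebra_simps)
  then show "v \<in> block_body K r + block_body K s"
    using y by (auto simp: block_body_def intro!: set_plus_intro)
qed

lemma block_body_scale: "(\<lambda>x. c *\<^sub>R x) ` block_body K r = block_body K (\<lambda>b. c * r b)"
proof -
  have "(\<chi> i. (c * r (Some i)) *\<^sub>R y (Some i) - (c * r None) *\<^sub>R y None) = c *\<^sub>R (\<chi> i. r (Some i) *\<^sub>R y (Some i) - r None *\<^sub>R y None)" for y :: "'b option \<Rightarrow> real ^ 'a"
    by (simp add: vec_eq_iff algebra_simps)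
  then show ?thesis unfolding block_body_def by (auto simp: image_iff)
qed

lemma block_body_zero: "K \<noteq> {} \<Longrightarrow> block_body K (\<lambda>_. 0) = {0}"
  by (auto simp: block_body_def vec_eq_iff)

lemma minkowski_comb_block_body:
  fixes K :: "(real ^ 'n) set" and s :: "nat \<Rightarrow> 'p::finite option \<Rightarrow> real"
  assumes K: "convex K" "K \<noteq> {}" and Ks: "\<And>i. i < length Ks \<Longrightarrow> Ks ! i = block_body K (s i)"
    and s: "\<And>i b. 0 \<le> s i b" and l: "\<And>i. i < length Ks \<Longrightarrow> 0 \<le> l i"
  shows "minkowski_comb Ks l = (block_body K (\<lambda>b. \<Sum>i<length Ks. l i * s i b) :: (real ^ 'n ^ 'p) set)"
proof -
  have "(\<Sum>i<m. (\<lambda>x. l i *\<^sub>R x) ` (Ks ! i)) = (block_body K (\<lambda>b. \<Sum>i<m. l i * s i b) :: (real ^ 'n ^ 'p) set)" if "m \<le> length Ks" for m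
    using that
  proof (induction m)
    case 0
    then show ?case using K(2) by (simp add: block_body_zero set_zero)
  next
    case (Suc m)
    then have IH: "(\<Sum>i<m. (\<lambda>x. l i *\<^sub>R x) ` (Ks ! i)) = (block_body K (\<lambda>b. \<Sum>i<m. l i * s i b) :: (real ^ 'n ^ 'p) set)"
      and m: "m < length Ks" by auto
    show ?case
      using m s l unfolding sum.lessThan_Suc IH Ks[OF m] block_body_scale
      by (intro block_body_plus K) (auto intro!: sum_nonneg mult_nonneg_nonneg)
  qed
  then show ?thesis by (simp add: minkowski_comb_def)
qed

lemma uminus_diag_image:
  fixes K :: "(real ^ 'n) set"
  assumes "K \<noteq> {}"
  shows "uminus ` diag ` K = (block_body K (\<lambda>b. of_bool (b = None)) :: (real ^ 'n ^ 'p) set)"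
proof -
  have "(\<chi> i. of_bool (Some i = None) *\<^sub>R y (Some i) - of_bool (None = (None :: 'p option)) *\<^sub>R y None) = - (diag (y None) :: real ^ 'n ^ 'p)" for y :: "'p option \<Rightarrow> real ^ 'n"
    by (simp add: diag_def vec_eq_iff)
  then have "(block_body K (\<lambda>b. of_bool (b = None)) :: (real ^ 'n ^ 'p) set) = {- diag (y None) | y :: 'p option \<Rightarrow> real ^ 'n. \<forall>b. y b \<in> K}"
    by (simp only: block_body_def)
  also have "\<dots> = uminus ` diag ` K"
    by (auto intro!: exI[of _ "\<lambda>_. _"])
  finally show ?thesis ..
qed

lemma axis_image:
  fixes K :: "(real ^ 'n) set" and j :: "'p::finite"
  assumes "K \<noteq> {}"
  shows "axis j ` K = block_body K (\<lambda>b. of_bool (b = Some j))"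
proof -
  have "(\<chi> i. of_bool (Some i = Some j) *\<^sub>R y (Some i) - of_bool (None = Some j) *\<^sub>R y None) = axis j (y (Some j))" for y :: "'p option \<Rightarrow> real ^ 'n"
    by (simp add: axis_def vec_eq_iff)
  then have "block_body K (\<lambda>b. of_bool (b = Some j)) = {axis j (y (Some j)) | y. \<forall>b. y b \<in> K}"
    by (simp only: block_body_def)
  also have "\<dots> = axis j ` K"
    by (auto intro!: exI[of _ "\<lambda>_. _"])
  finally show ?thesis ..
qed

lemma body_power_eq:
  fixes K :: "(real ^ 'n) set"
  assumes "K \<noteq> {}"
  shows "body_power K = (block_body K (\<lambda>b. of_bool (b \<noteq> None)) :: (real ^ 'n ^ 'p) set)"
proof -
  have "(\<chi> i. of_bool (Some i \<noteq> None) *\<^sub>R y (Some i) - of_bool (None \<noteq> (None :: 'p option)) *\<^sub>R y None) = (\<chi> i. y (Some i))" for y :: "'p option \<Rightarrow> real ^ 'n"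
    by (simp add: vec_eq_iff)
  then have eq: "(block_body K (\<lambda>b. of_bool (b \<noteq> None)) :: (real ^ 'n ^ 'p) set) = {\<chi> i. y (Some i) | y. \<forall>b. y b \<in> K}"
    by (simp only: block_body_def)
  obtain x0 where x0: "x0 \<in> K" using assms by auto
  have "v \<in> {\<chi> i. y (Some i) | y. \<forall>b. y b \<in> K}" if "\<forall>j. v $ j \<in> K" for v :: "real ^ 'n ^ 'p"
    using that x0 by (intro CollectI exI[of _ "\<lambda>b. case b of None \<Rightarrow> x0 | Some i \<Rightarrow> v $ i"]) (auto simp: vec_eq_iff split: option.splits)
  then show ?thesis unfolding eq body_power_def by auto
qed

lemma coord_set_block_body:
  fixes K :: "(real ^ 'n::finite) set" and r :: "'p::finite option \<Rightarrow> real"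
  shows "v \<in> block_body K r \<longleftrightarrow>
    (\<lambda>(i, j). v $ i $ j) \<in> diagonal_sum (scale_set (r None) (coord_set K)) (\<lambda>i. scale_set (r (Some i)) (coord_set K))"
proof
  assume "v \<in> block_body K r"
  then obtain y where y: "\<And>b. y b \<in> K" and v: "v = (\<chi> i. r (Some i) *\<^sub>R y (Some i) - r None *\<^sub>R y None)"
    by (auto simp: block_body_def)
  have mem: "(\<lambda>j. r b * y b $ j) \<in> scale_set (r b) (coord_set K)" for b
    unfolding scale_set_def using y by (intro image_eqI[of _ _ "\<lambda>j. y b $ j"]) (auto simp: coord_set_def)
  show "(\<lambda>(i, j). v $ i $ j) \<in> diagonal_sum (scale_set (r None) (coord_set K)) (\<lambda>i. scale_set (r (Some i)) (coord_set K))"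
    unfolding diagonal_sum_def
    by (intro CollectI bexI[OF _ mem[of None]] allI) (use mem[of "Some _"] in \<open>simp add: v\<close>)
next
  assume "(\<lambda>(i, j). v $ i $ j) \<in> diagonal_sum (scale_set (r None) (coord_set K)) (\<lambda>i. scale_set (r (Some i)) (coord_set K))"
  then obtain x where x: "x \<in> coord_set K" and "\<And>i. (\<lambda>j. v $ i $ j + r None * x j) \<in> scale_set (r (Some i)) (coord_set K)"
    by (auto simp: diagonal_sum_def scale_set_def)
  then have "\<exists>z. z \<in> coord_set K \<and> (\<forall>j. v $ i $ j + r None * x j = r (Some i) * z j)" for i
    by (force simp: scale_set_def fun_eq_iff)
  then obtain z where z: "\<And>i. z i \<in> coord_set K" "\<And>i j. v $ i $ j + r None * x j = r (Some i) * z i j" by metis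
  define y where "y = (\<lambda>b. case b of None \<Rightarrow> (\<chi> j. x j) | Some i \<Rightarrow> (\<chi> j. z i j))"
  have "v = (\<chi> i. r (Some i) *\<^sub>R y (Some i) - r None *\<^sub>R y None)"
    by (simp add: vec_eq_iff y_def z(2)[symmetric])
  moreover have "\<forall>b. y b \<in> K" using x z(1) by (auto simp: y_def coord_set_def split: option.splits)
  ultimately show "v \<in> block_body K r" by (auto simp: block_body_def)
qed

definition coord_volume :: "(real ^ 'n::finite) set \<Rightarrow> 'n set \<Rightarrow> real" where
  "coord_volume K S = enn2real (section_volume (coord_set K) S)"

lemma coord_volume_nonneg: "0 \<le> coord_volume K S"
  by (simp add: coord_volume_def)

text \<open>The volume polynomial: its terms are indexed by the maps c, and the exponent of
  \<open>r b\<close> is the dimension of the section contributed by body b.\<close>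

lemma measure_block_body:
  fixes K :: "(real ^ 'n::finite) set" and r :: "'p::{finite,linorder} option \<Rightarrow> real"
  assumes K: "convex_body K" "anti_blocking K" and r: "\<And>b. 0 \<le> r b"
  shows "measure lebesgue (block_body K r)
    = (\<Sum>c\<in>UNIV. (\<Prod>b\<in>UNIV. coord_volume K (- (c -` {b}))) * (\<Prod>b\<in>UNIV. r b ^ card (- (c -` {b}))))"
proof -
  interpret L: antiblocking_body "coord_set K" by (rule anti_blocking_coord_set[OF K])
  let ?L = "scale_set (r None) (coord_set K)" and ?M = "\<lambda>i. scale_set (r (Some i)) (coord_set K)"
  have dc: "down_closed ?L" "\<And>i. down_closed (?M i)" by (auto intro: L.down_closed_scale_set r)
  have ds: "diagonal_sum ?L ?M \<in> sets (PiM UNIV (\<lambda>_. borel))" by (rule diagonal_sum_measurable[OF dc])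
  have flat: "(\<lambda>v :: real ^ 'n ^ 'p::{finite,linorder}. \<lambda>(i, j). v $ i $ j) \<in> measurable borel (PiM UNIV (\<lambda>_. borel))"
    by (rule measurable_PiM_single') (auto simp: space_PiM intro!: borel_measurable_continuous_onI continuous_intros)
  have "block_body K r = (\<lambda>v. \<lambda>(i, j). v $ i $ j) -` diagonal_sum ?L ?M \<inter> space borel"
    by (auto simp: coord_set_block_body)
  then have W [measurable]: "block_body K r \<in> sets borel" using measurable_sets[OF flat ds] by simp
  have "emeasure lborel (block_body K r) = (\<integral>\<^sup>+v. indicator (block_body K r) v \<partial>lborel)" by simp
  also have "\<dots> = (\<integral>\<^sup>+x. indicator (block_body K r) (\<chi> i j. x (i, j)) \<partial>PiM UNIV (\<lambda>_. lborel))"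
    by (rule nn_integral_lborel_matrix) simp
  also have "\<dots> = (\<integral>\<^sup>+x. indicator (diagonal_sum ?L ?M) x \<partial>PiM UNIV (\<lambda>_. lborel))"
    by (intro nn_integral_cong) (simp add: indicator_def coord_set_block_body case_prod_eta)
  also have "\<dots> = (\<Sum>c\<in>UNIV. \<Prod>b\<in>UNIV. section_volume (case b of None \<Rightarrow> ?L | Some i \<Rightarrow> ?M i) (- (c -` {b})))"
    by (rule volume_diagonal_sum[OF dc])
  also have "\<dots> = (\<Sum>c\<in>UNIV. ennreal ((\<Prod>b\<in>UNIV. coord_volume K (- (c -` {b}))) * (\<Prod>b\<in>UNIV. r b ^ card (- (c -` {b})))))"
  proof (rule sum.cong[OF refl])
    fix c :: "'n \<Rightarrow> 'p option"
    have "section_volume (case b of None \<Rightarrow> ?L | Some i \<Rightarrow> ?M i) (- (c -` {b})) = ennreal (coord_volume K (- (c -` {b})) * r b ^ card (- (c -` {b})))" for b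
    proof -
      have "section_volume (case b of None \<Rightarrow> ?L | Some i \<Rightarrow> ?M i) (- (c -` {b})) = section_volume (scale_set (r b) (coord_set K)) (- (c -` {b}))"
        by (cases b) auto
      also have "\<dots> = ennreal (r b ^ card (- (c -` {b}))) * section_volume (coord_set K) (- (c -` {b}))"
        by (rule L.section_volume_scale[OF r])
      also have "section_volume (coord_set K) (- (c -` {b})) = ennreal (coord_volume K (- (c -` {b})))"
        using L.section_volume_finite[of "- (c -` {b})"] by (simp add: coord_volume_def)
      finally show ?thesis using r[of b] by (simp add: ennreal_mult coord_volume_nonneg mult.commute)
    qed
    then show "(\<Prod>b\<in>UNIV. section_volume (case b of None \<Rightarrow> ?L | Some i \<Rightarrow> ?M i) (- (c -` {b})))
      = ennreal ((\<Prod>b\<in>UNIV. coord_volume K (- (c -` {b}))) * (\<Prod>b\<in>UNIV. r b ^ card (- (c -` {b}))))"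
      by (simp add: prod_ennreal coord_volume_def r prod.distrib)
  qed
  also have "\<dots> = ennreal (\<Sum>c\<in>UNIV. (\<Prod>b\<in>UNIV. coord_volume K (- (c -` {b}))) * (\<Prod>b\<in>UNIV. r b ^ card (- (c -` {b}))))"
    by (rule sum_ennreal) (auto simp: coord_volume_def r intro!: mult_nonneg_nonneg prod_nonneg)
  finally have "emeasure lborel (block_body K r) = ennreal (\<Sum>c\<in>UNIV. (\<Prod>b\<in>UNIV. coord_volume K (- (c -` {b}))) * (\<Prod>b\<in>UNIV. r b ^ card (- (c -` {b}))))" .
  moreover have "0 \<le> (\<Sum>c\<in>(UNIV :: ('n \<Rightarrow> 'p option) set). (\<Prod>b\<in>UNIV. coord_volume K (- (c -` {b}))) * (\<Prod>b\<in>UNIV. r b ^ card (- (c -` {b}))))"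
    by (auto simp: coord_volume_def r intro!: sum_nonneg mult_nonneg_nonneg prod_nonneg)
  ultimately show ?thesis by (simp add: measure_def)
qed

lemma coord_volume_UNIV:
  fixes K :: "(real ^ 'n::finite) set"
  assumes K: "convex_body K" "anti_blocking K"
  shows "coord_volume K UNIV = measure lebesgue K"
proof -
  interpret L: antiblocking_body "coord_set K" by (rule anti_blocking_coord_set[OF K])
  have [measurable]: "K \<in> sets borel" using K(1) by (simp add: convex_body_def borel_compact)
  have sets_eq: "sets (PiM UNIV (\<lambda>_::'n. lborel)) = sets (PiM UNIV (\<lambda>_. borel :: real measure))"
    by (intro sets_PiM_cong) auto
  have "emeasure lborel K = (\<integral>\<^sup>+v. indicator K v \<partial>lborel)" by simp
  also have "\<dots> = (\<integral>\<^sup>+x. indicator K (\<chi> j. x j) \<partial>PiM UNIV (\<lambda>_. lborel))"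
    by (rule nn_integral_lborel_vec) simp
  also have "\<dots> = (\<integral>\<^sup>+x. indicator (coord_set K) x * (\<Prod>j\<in>UNIV. indicator {0..} (x j)) \<partial>PiM UNIV (\<lambda>_. lborel))"
  proof (rule nn_integral_cong)
    fix x :: "'n \<Rightarrow> real"
    show "indicator K (\<chi> j. x j) = indicator (coord_set K) x * (\<Prod>j\<in>UNIV. indicator {0..} (x j) :: ennreal)"
    proof (cases "x \<in> coord_set K")
      case True
      then have "(\<Prod>j\<in>UNIV. indicator {0..} (x j) :: ennreal) = 1"
        using L.orthant by (intro prod.neutral) auto
      then show ?thesis using True by (simp add: coord_set_def)
    qed (simp add: coord_set_def)
  qed
  also have "\<dots> = (\<integral>\<^sup>+x. indicator (coord_set K) x \<partial>orthant_measure UNIV)"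
    by (rule nn_integral_PiM_half_lborel[symmetric]) (use L.sets_L in \<open>auto simp: measurable_cong_sets[OF sets_eq refl]\<close>)
  also have "\<dots> = section_volume (coord_set K) UNIV"
    by (simp add: section_volume_def override_def)
  finally show ?thesis by (simp add: coord_volume_def measure_def)
qed

section \<open>Counting maps by their fibers\<close>

lemma falling_eq_prod_step:
  "falling N (m + (if P then 1 else 0)) = falling N m * (if P then real N - real m else 1)"
  by (simp add: falling_Suc)

text \<open>Vandermonde's identity for falling factorials: both sides count the injections of A into
  a disjoint union of sets of sizes N b, with c recording the set that is hit. In the induction a
  new element has N y minus the size of the fiber over y places in set y, which sums to the total
  size minus |A|.\<close>

lemma sum_falling_fibers:
  fixes N :: "'b::finite \<Rightarrow> nat"
  assumes "finite A"
  shows "(\<Sum>c\<in>A \<rightarrow>\<^sub>E UNIV. \<Prod>b\<in>UNIV. falling (N b) (card {a \<in> A. c a = b})) = falling (\<Sum>b\<in>UNIV. N b) (card A)"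
  using assms
proof (induction A rule: finite_induct)
  case empty
  then show ?case by (simp add: falling_def)
next
  case (insert a A)
  let ?F = "\<lambda>c. \<Prod>b\<in>UNIV. falling (N b) (card {a \<in> A. c a = b})"
  have inj: "inj_on (\<lambda>(y, g). g(a := y)) (UNIV \<times> (A \<rightarrow>\<^sub>E (UNIV :: 'b set)))"
    using insert.hyps(2) by (rule inj_combinator)
  have fib: "(\<Prod>b\<in>UNIV. falling (N b) (card {x \<in> insert a A. (c(a := y)) x = b})) = ?F c * (real (N y) - real (card {x \<in> A. c x = y}))" for c y
  proof -
    have "{x \<in> insert a A. (c(a := y)) x = b} = (if y = b then insert a {x \<in> A. c x = b} else {x \<in> A. c x = b})" for b
      using insert.hyps by auto
    then have "card {x \<in> insert a A. (c(a := y)) x = b} = card {x \<in> A. c x = b} + (if y = b then 1 else 0)" for b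
      using insert.hyps by simp
    then show ?thesis by (simp only: falling_eq_prod_step prod.distrib) (simp add: prod.delta)
  qed
  have tot: "(\<Sum>y\<in>UNIV. real (card {x \<in> A. c x = y})) = real (card A)" for c :: "'a \<Rightarrow> 'b"
  proof -
    have "(\<Sum>y\<in>UNIV. card {x \<in> A. c x = y}) = card (\<Union>y\<in>UNIV. {x \<in> A. c x = y})"
      using insert.hyps(1) by (intro card_UN_disjoint[symmetric]) auto
    also have "(\<Union>y\<in>UNIV. {x \<in> A. c x = y}) = A" by auto
    finally show ?thesis by (simp flip: of_nat_sum)
  qed
  have "(\<Sum>c\<in>insert a A \<rightarrow>\<^sub>E UNIV. \<Prod>b\<in>UNIV. falling (N b) (card {x \<in> insert a A. c x = b}))
    = (\<Sum>(y, c)\<in>UNIV \<times> (A \<rightarrow>\<^sub>E UNIV). ?F c * (real (N y) - real (card {x \<in> A. c x = y})))"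
    unfolding PiE_insert_eq sum.reindex[OF inj] by (intro sum.cong refl) (simp only: comp_apply split_beta fib)
  also have "\<dots> = (\<Sum>c\<in>A \<rightarrow>\<^sub>E UNIV. \<Sum>y\<in>UNIV. ?F c * (real (N y) - real (card {x \<in> A. c x = y})))"
    by (simp add: sum.cartesian_product[symmetric]) (rule sum.swap)
  also have "\<dots> = (\<Sum>c\<in>A \<rightarrow>\<^sub>E UNIV. ?F c * (real (\<Sum>b\<in>UNIV. N b) - real (card A)))"
    by (simp add: sum_distrib_left[symmetric] sum_subtractf tot)
  also have "\<dots> = falling (\<Sum>b\<in>UNIV. N b) (card A) * (real (\<Sum>b\<in>UNIV. N b) - real (card A))"
    using insert.IH by (simp add: sum_distrib_right[symmetric])
  finally show ?case using insert.hyps by (simp add: falling_Suc)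
qed

lemma sum_card_fibers: "(\<Sum>b\<in>UNIV. card ((c :: 'n::finite \<Rightarrow> 'b::finite) -` {b})) = CARD('n)"
proof -
  have "(\<Sum>b\<in>UNIV. card (c -` {b})) = card (\<Union>b\<in>UNIV. c -` {b})"
    by (intro card_UN_disjoint[symmetric]) auto
  also have "(\<Union>b\<in>UNIV. c -` {b}) = UNIV" by auto
  finally show ?thesis .
qed

text \<open>Takes the required fiber sizes as set sizes in \<open>sum_falling_fibers\<close>. A map
  with other fibers has one that is too large, and its term is 0; each remaining term is the product
  of the factorials.\<close>

lemma card_fibers:
  fixes e :: "'b::finite \<Rightarrow> nat"
  assumes "(\<Sum>b\<in>UNIV. e b) = CARD('n::finite)"
  shows "real (card {c :: 'n \<Rightarrow> 'b. \<forall>b. card (c -` {b}) = e b}) * (\<Prod>b\<in>UNIV. fact (e b)) = fact CARD('n)"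
proof -
  have "fact CARD('n) = falling (\<Sum>b\<in>UNIV. e b) (card (UNIV :: 'n set))"
    using assms by (simp add: falling_eq)
  also have "\<dots> = (\<Sum>c\<in>(UNIV :: 'n set) \<rightarrow>\<^sub>E UNIV. \<Prod>b\<in>UNIV. falling (e b) (card {a \<in> UNIV. c a = b}))"
    by (rule sum_falling_fibers[symmetric]) simp
  also have "\<dots> = (\<Sum>c\<in>(UNIV :: ('n \<Rightarrow> 'b) set). \<Prod>b\<in>UNIV. falling (e b) (card (c -` {b})))"
    by (simp add: PiE_UNIV_domain vimage_def)
  also have "\<dots> = (\<Sum>c\<in>(UNIV :: ('n \<Rightarrow> 'b) set). if \<forall>b. card (c -` {b}) = e b then \<Prod>b\<in>UNIV. fact (e b) else 0)"
  proof (rule sum.cong[OF refl])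
    fix c :: "'n \<Rightarrow> 'b"
    show "(\<Prod>b\<in>UNIV. falling (e b) (card (c -` {b}))) = (if \<forall>b. card (c -` {b}) = e b then \<Prod>b\<in>UNIV. fact (e b) else 0)"
    proof (cases "\<forall>b. card (c -` {b}) = e b")
      case True
      then show ?thesis by (simp add: falling_eq)
    next
      case False
      have "\<exists>b. e b < card (c -` {b})"
      proof (rule ccontr)
        assume "\<nexists>b. e b < card (c -` {b})"
        then have le: "card (c -` {b}) \<le> e b" for b by (simp add: not_less)
        obtain b where "card (c -` {b}) \<noteq> e b" using False by auto
        then have "(\<Sum>b\<in>UNIV. card (c -` {b})) < (\<Sum>b\<in>UNIV. e b)"
          using le by (intro sum_strict_mono_ex1) (auto simp: le_less)
        then show False using sum_card_fibers[of c] assms by simp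
      qed
      then obtain b where "falling (e b) (card (c -` {b})) = 0" using falling_eq_0 by blast
      then have "(\<Prod>b\<in>UNIV. falling (e b) (card (c -` {b}))) = 0" by (intro prod_zero) auto
      then show ?thesis unfolding if_not_P[OF False] .
    qed
  qed
  also have "\<dots> = real (card {c :: 'n \<Rightarrow> 'b. \<forall>b. card (c -` {b}) = e b}) * (\<Prod>b\<in>UNIV. fact (e b))"
    by (simp add: sum.If_cases)
  finally show ?thesis ..
qed

text \<open>The total weight of the maps in (ii). Grouped by the set A of coordinates where c is not
  \<open>None\<close>, each group is an instance of \<open>sum_falling_fibers\<close> with p sets of
  size N.\<close>

lemma sum_falling_partial:
  fixes N :: nat
  assumes "k \<le> CARD('n::finite)"
  shows "(\<Sum>c | card (- ((c :: 'n \<Rightarrow> 'p::finite option) -` {None})) = k. \<Prod>i\<in>UNIV. falling N (card (c -` {Some i})))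
     = real (CARD('n) choose k) * falling (CARD('p) * N) k"
proof -
  define \<A> where "\<A> = {A :: 'n set. card A = k}"
  let ?dom = "\<lambda>c :: 'n \<Rightarrow> 'p option. - (c -` {None})"
  have "(\<Sum>c | card (?dom c) = k. \<Prod>i\<in>UNIV. falling N (card (c -` {Some i})))
    = (\<Sum>A\<in>\<A>. \<Sum>c | c \<in> {c. card (?dom c) = k} \<and> ?dom c = A. \<Prod>i\<in>UNIV. falling N (card (c -` {Some i})))"
    by (rule sum.group[symmetric]) (auto simp: \<A>_def)
  also have "\<dots> = (\<Sum>A\<in>\<A>. falling (CARD('p) * N) k)"
  proof (rule sum.cong[OF refl])
    fix A assume A: "A \<in> \<A>"
    have "(\<Sum>c | c \<in> {c. card (?dom c) = k} \<and> ?dom c = A. \<Prod>i\<in>UNIV. falling N (card (c -` {Some i})))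
      = (\<Sum>g\<in>A \<rightarrow>\<^sub>E (UNIV :: 'p set). \<Prod>i\<in>UNIV. falling N (card {a \<in> A. g a = i}))"
    proof (rule sum.reindex_bij_witness[where i = "\<lambda>g a. if a \<in> A then Some (g a) else None" and j = "\<lambda>c. \<lambda>a\<in>A. the (c a)"])
      fix c :: "'n \<Rightarrow> 'p option" assume c: "c \<in> {c. c \<in> {c. card (?dom c) = k} \<and> ?dom c = A}"
      then have dom: "a \<in> A \<longleftrightarrow> c a \<noteq> None" for a by auto
      show "(\<lambda>a. if a \<in> A then Some ((\<lambda>a\<in>A. the (c a)) a) else None) = c"
        by (auto simp: fun_eq_iff dom)
      show "(\<lambda>a\<in>A. the (c a)) \<in> A \<rightarrow>\<^sub>E UNIV" by auto
      have "{a \<in> A. (\<lambda>a\<in>A. the (c a)) a = i} = c -` {Some i}" for i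
        by (auto simp: dom)
      then show "(\<Prod>i\<in>UNIV. falling N (card {a \<in> A. (\<lambda>a\<in>A. the (c a)) a = i})) = (\<Prod>i\<in>UNIV. falling N (card (c -` {Some i})))"
        by simp
    next
      fix g :: "'n \<Rightarrow> 'p" assume g: "g \<in> A \<rightarrow>\<^sub>E UNIV"
      show "(\<lambda>a\<in>A. the (if a \<in> A then Some (g a) else None)) = g"
        using g by (auto simp: fun_eq_iff PiE_iff extensional_def)
      have "?dom (\<lambda>a. if a \<in> A then Some (g a) else None) = A" by auto
      then show "(\<lambda>a. if a \<in> A then Some (g a) else None) \<in> {c. c \<in> {c. card (?dom c) = k} \<and> ?dom c = A}"
        using A by (simp add: \<A>_def)
    qed
    also have "\<dots> = falling (CARD('p) * N) k"
      using A sum_falling_fibers[of A "\<lambda>_::'p. N"] by (simp add: \<A>_def)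
    finally show "(\<Sum>c | c \<in> {c. card (?dom c) = k} \<and> ?dom c = A. \<Prod>i\<in>UNIV. falling N (card (c -` {Some i}))) = falling (CARD('p) * N) k" .
  qed
  also have "\<dots> = real (CARD('n) choose k) * falling (CARD('p) * N) k"
    using n_subsets[of "UNIV :: 'n set" k] by (simp add: \<A>_def)
  finally show ?thesis .
qed

section \<open>The dual Loomis-Whitney inequality for a body\<close>

text \<open>The coefficient belonging to c in the volume polynomial, rescaled by factorials so that
  its factors become \<open>total\<close>s of the gauge and one bound serves all c.\<close>

definition normalized_product :: "(real ^ 'n::finite) set \<Rightarrow> ('n \<Rightarrow> 'b::finite) \<Rightarrow> real" where
  "normalized_product K c = (\<Prod>b\<in>UNIV. fact (card (- (c -` {b}))) * coord_volume K (- (c -` {b})))"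

context
  fixes K :: "(real ^ 'n::finite) set"
  assumes K: "convex_body K" "anti_blocking K"
begin

interpretation L: antiblocking_body "coord_set K" by (rule anti_blocking_coord_set[OF K])

text \<open>If no coordinate vanishes identically on K, averaging points with a positive coordinate
  each gives a point with all coordinates positive, and \<open>down\<close> reduces it to a constant
  vector.\<close>

lemma full_or_flat:
  "full_antiblocking_body (coord_set K) \<or> (\<exists>i. \<forall>x\<in>coord_set K. x i = 0)"
proof (rule disjCI)
  assume "\<not> (\<exists>i. \<forall>x\<in>coord_set K. x i = 0)"
  then have ex: "\<exists>x\<in>coord_set K. 0 < x i" for i using L.orthant by (metis order_le_less)
  have "\<exists>x\<in>coord_set K. \<forall>i\<in>S. 0 < x i" for S :: "'n set"
    using finite[of S]
  proof (induction S rule: finite_induct)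
    case empty
    then show ?case using L.zero_mem by auto
  next
    case (insert i S)
    obtain x y where x: "x \<in> coord_set K" "\<forall>i\<in>S. 0 < x i" and y: "y \<in> coord_set K" "0 < y i"
      using insert.IH ex by blast
    have "(\<lambda>k. (1 - 1/2) * x k + 1/2 * y k) \<in> coord_set K"
      by (rule L.convex_comb[OF x(1) y(1)]) auto
    moreover have "\<forall>k\<in>insert i S. 0 < (1 - 1/2) * x k + 1/2 * y k"
      using x y L.orthant[OF x(1)] L.orthant[OF y(1)] by (auto intro: add_pos_nonneg add_nonneg_pos)
    ultimately show ?case by (intro bexI[of _ "\<lambda>k. (1 - 1/2) * x k + 1/2 * y k"])
  qed
  from this[of UNIV] obtain x where x: "x \<in> coord_set K" "\<And>i. 0 < x i" by auto
  have "(\<lambda>_. Min (range x)) \<in> coord_set K"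
    by (rule L.down[OF x(1)]) (auto simp: x(2) less_imp_le)
  moreover have "0 < Min (range x)" by (simp add: x(2))
  ultimately show "full_antiblocking_body (coord_set K)" by unfold_locales blast
qed

lemma full_if_interior:
  assumes "interior K \<noteq> {}"
  shows "full_antiblocking_body (coord_set K)"
proof -
  obtain v e where e: "0 < e" "cball v e \<subseteq> K"
    using assms by (auto simp: mem_interior_cball)
  have "\<not> (\<exists>i. \<forall>x\<in>coord_set K. x i = 0)"
  proof
    assume "\<exists>i. \<forall>x\<in>coord_set K. x i = 0"
    then obtain i where i: "\<And>x. x \<in> coord_set K \<Longrightarrow> x i = 0" by auto
    have "axis i e = e *\<^sub>R axis i (1::real)" by (simp add: vec_eq_iff axis_def)
    then have "v + axis i e \<in> K" using e(1) by (auto simp: dist_norm norm_axis_1 intro!: subsetD[OF e(2)])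
    then have "(v + axis i e) $ i = 0" using i[of "\<lambda>j. (v + axis i e) $ j"] by (simp add: coord_set_def del: vector_add_component)
    moreover have "v \<in> K" using e by (intro subsetD[OF e(2)]) simp
    then have "v $ i = 0" using i[of "\<lambda>j. v $ j"] by (simp add: coord_set_def)
    ultimately show False using e by simp
  qed
  then show ?thesis using full_or_flat by blast
qed

lemma total_eq_coord_volume:
  assumes "full_antiblocking_body (coord_set K)"
  shows "orthant_gauge.total (full_antiblocking_body.gauge (coord_set K)) S = fact (card S) * coord_volume K S"
proof -
  interpret F: full_antiblocking_body "coord_set K" by fact
  have "ennreal (F.total S) = ennreal (fact (card S) * coord_volume K S)"
    unfolding F.total_eq_section_volume using L.section_volume_finite[of S]
    by (simp add: coord_volume_def ennreal_mult)
  then show ?thesis using F.total_pos[of S] by (simp add: coord_volume_nonneg)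
qed

text \<open>With \<open>'p option\<close> as the set of blocks the exponent is p + 1, and one factor
  \<open>total UNIV\<close> cancels. Inside a coordinate hyperplane there is no gauge, but the
  product is 0.\<close>

lemma normalized_product_le:
  fixes c :: "'n \<Rightarrow> 'p::finite option"
  shows "normalized_product K c \<le> (fact CARD('n) * measure lebesgue K) ^ CARD('p)"
  using full_or_flat
proof
  assume F: "full_antiblocking_body (coord_set K)"
  interpret F: full_antiblocking_body "coord_set K" by (rule F)
  have "F.total UNIV * normalized_product K c \<le> F.total UNIV ^ CARD('p option)"
    using F.dual_Loomis_Whitney[of c] by (simp add: normalized_product_def total_eq_coord_volume[OF F])
  then have "F.total UNIV * normalized_product K c \<le> F.total UNIV * F.total UNIV ^ CARD('p)"
    by (simp add: card_UNIV_option)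
  then have "normalized_product K c \<le> F.total UNIV ^ CARD('p)"
    using F.total_pos[of UNIV] by simp
  then show ?thesis by (simp add: total_eq_coord_volume[OF F] coord_volume_UNIV[OF K])
next
  assume "\<exists>i. \<forall>x\<in>coord_set K. x i = 0"
  then obtain i where i: "\<And>x. x \<in> coord_set K \<Longrightarrow> x i = 0" by auto
  have flat: "coord_volume K S = 0" if S: "i \<in> S" for S
  proof -
    have "AE x in PiM S (\<lambda>_::'n. half_lborel). x i \<noteq> 0"
      by (rule AE_PiM_coordinate[OF sigma_finite_half_lborel finite S AE_half_lborel_neq_0]) measurable
    then have "section_volume (coord_set K) S = (\<integral>\<^sup>+x. 0 \<partial>PiM S (\<lambda>_::'n. half_lborel))"
      unfolding section_volume_def
    proof (intro nn_integral_cong_AE, eventually_elim)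
      fix x :: "'n \<Rightarrow> real" assume "x i \<noteq> 0"
      then show "indicator (coord_set K) (zero_ext S x) = (0 :: ennreal)"
        using i[of "zero_ext S x"] S by (auto simp: indicator_def override_def)
    qed
    then show ?thesis by (simp add: coord_volume_def)
  qed
  \<comment> \<open>Coordinate i lies in the complement of every fiber but one, and
    \<open>'p option\<close> has at least two elements.\<close>
  obtain b where "c i \<noteq> b"
    by (cases "c i") auto
  then have "coord_volume K (- (c -` {b})) = 0" by (intro flat) auto
  then have "normalized_product K c = 0"
    unfolding normalized_product_def by (intro prod_zero) auto
  then show ?thesis by simp
qed

lemma gauge_additive_if_normalized_product_eq:
  fixes c :: "'n \<Rightarrow> 'p::finite option"
  assumes F: "full_antiblocking_body (coord_set K)"
    and eq: "normalized_product K c = (fact CARD('n) * measure lebesgue K) ^ CARD('p)" and x: "\<And>i. 0 \<le> x i"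
  shows "full_antiblocking_body.gauge (coord_set K) x
     = (\<Sum>b\<in>UNIV. full_antiblocking_body.gauge (coord_set K) (zero_ext (c -` {b}) x))"
proof -
  interpret F: full_antiblocking_body "coord_set K" by (rule F)
  have "F.total UNIV * (\<Prod>b\<in>UNIV. F.total (- (c -` {b}))) = F.total UNIV ^ CARD('p option)"
    using eq by (simp add: normalized_product_def total_eq_coord_volume[OF F] coord_volume_UNIV[OF K] card_UNIV_option)
  from F.dual_Loomis_Whitney_eq[OF this x] show ?thesis .
qed

end

section \<open>Anti-blocking simplices\<close>

definition corner_simplex :: "('n \<Rightarrow> real) \<Rightarrow> (real ^ 'n::finite) set" where
  "corner_simplex a = {v. (\<forall>i. 0 \<le> v $ i) \<and> (\<Sum>i\<in>UNIV. v $ i / a i) \<le> 1}"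

definition corner_vertices :: "('n \<Rightarrow> real) \<Rightarrow> (real ^ 'n::finite) set" where
  "corner_vertices a = insert 0 (range (\<lambda>i. axis i (a i)))"

lemma corner_simplex_eq_hull:
  fixes a :: "'n::finite \<Rightarrow> real"
  assumes a: "\<And>i. 0 < a i"
  shows "corner_simplex a = convex hull (corner_vertices a)"
proof
  have "convex (corner_simplex a)"
  proof (rule convexI)
    fix x y :: "real ^ 'n" and u v :: real
    assume x: "x \<in> corner_simplex a" and y: "y \<in> corner_simplex a" and uv: "0 \<le> u" "0 \<le> v" "u + v = 1"
    have "(\<Sum>i\<in>UNIV. (u *\<^sub>R x + v *\<^sub>R y) $ i / a i) = u * (\<Sum>i\<in>UNIV. x $ i / a i) + v * (\<Sum>i\<in>UNIV. y $ i / a i)"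
      by (simp add: sum_distrib_left sum.distrib add_divide_distrib)
    also have "\<dots> \<le> u * 1 + v * 1"
      using x y uv by (intro add_mono mult_left_mono) (auto simp: corner_simplex_def)
    finally show "u *\<^sub>R x + v *\<^sub>R y \<in> corner_simplex a"
      using x y uv by (simp add: corner_simplex_def)
  qed
  moreover have "corner_vertices a \<subseteq> corner_simplex a"
  proof -
    have "(\<Sum>j\<in>UNIV. axis i (a i) $ j / a j) = (1::real)" for i
    proof -
      have "(\<Sum>j\<in>UNIV. axis i (a i) $ j / a j) = (\<Sum>j\<in>UNIV. if j = i then 1 else 0)"
        using a by (intro sum.cong refl) (auto simp: axis_def less_imp_neq[symmetric])
      then show ?thesis by simp
    qed
    then show ?thesis using a by (auto simp: corner_vertices_def corner_simplex_def axis_def less_imp_le)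
  qed
  ultimately show "convex hull (corner_vertices a) \<subseteq> corner_simplex a" by (rule hull_minimal[rotated])
next
  show "corner_simplex a \<subseteq> convex hull (corner_vertices a)"
  proof
    fix v assume v: "v \<in> corner_simplex a"
    define w where "w = (\<lambda>b. case b of None \<Rightarrow> 1 - (\<Sum>i\<in>UNIV. v $ i / a i) | Some i \<Rightarrow> v $ i / a i)"
    define p where "p = (\<lambda>b. case b of None \<Rightarrow> 0 | Some i \<Rightarrow> axis i (a i))"
    have U: "(UNIV :: 'n option set) = insert None (range Some)" by (auto simp: UNIV_option_conv)
    have split: "(\<Sum>b\<in>UNIV. f b) = f None + (\<Sum>i\<in>UNIV. f (Some i))" for f :: "'n option \<Rightarrow> 'z::comm_monoid_add"
      unfolding U by (simp add: sum.reindex)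
    have "(\<Sum>b\<in>UNIV. w b *\<^sub>R p b) \<in> convex hull (corner_vertices a)"
    proof (rule convex_sum)
      show "(\<Sum>b\<in>UNIV. w b) = 1" by (simp add: split w_def)
      show "0 \<le> w b" for b using v a by (auto simp: w_def corner_simplex_def less_imp_le split: option.splits)
      show "p b \<in> convex hull (corner_vertices a)" for b
        by (rule hull_inc) (auto simp: p_def corner_vertices_def split: option.splits)
    qed auto
    also have "(\<Sum>b\<in>UNIV. w b *\<^sub>R p b) = v"
    proof -
      have "(\<Sum>i\<in>UNIV. (v $ i / a i) *\<^sub>R axis i (a i)) $ k = v $ k" for k
      proof -
        have "(\<Sum>i\<in>UNIV. (v $ i / a i) *\<^sub>R axis i (a i)) $ k = (\<Sum>i\<in>UNIV. if i = k then v $ k else 0)"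
          unfolding sum_component using a by (intro sum.cong refl) (auto simp: axis_def less_imp_neq[symmetric])
        then show ?thesis by simp
      qed
      then show ?thesis by (simp add: split w_def p_def vec_eq_iff)
    qed
    finally show "v \<in> convex hull (corner_vertices a)" .
  qed
qed

lemma corner_vertices_independent:
  fixes a :: "'n::finite \<Rightarrow> real"
  assumes a: "\<And>i. 0 < a i"
  shows "\<not> affine_dependent (corner_vertices a)" "card (corner_vertices a) = Suc CARD('n)"
proof -
  have inj: "inj (\<lambda>i. axis i (a i))" using a by (auto simp: inj_on_def axis_eq_axis less_imp_neq[symmetric])
  have nz: "0 \<notin> range (\<lambda>i. axis i (a i))"
    using a by (auto simp: axis_eq_0_iff[symmetric] less_imp_neq[symmetric] dest: sym)
  show "card (corner_vertices a) = Suc CARD('n)"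
    using nz by (simp add: corner_vertices_def card_image[OF inj])
  have "independent (range (\<lambda>i. axis i (a i)))"
  proof (rule pairwise_orthogonal_independent[OF _ nz])
    show "pairwise orthogonal (range (\<lambda>i. axis i (a i)))"
      by (auto simp: pairwise_def orthogonal_def inner_axis_axis)
  qed
  then show "\<not> affine_dependent (corner_vertices a)"
    unfolding corner_vertices_def using affine_dependent_iff_dependent[OF nz] by simp
qed

lemma simplex_corner_simplex:
  fixes a :: "'n::finite \<Rightarrow> real"
  assumes "\<And>i. 0 < a i"
  shows "int CARD('n) simplex corner_simplex a"
  unfolding simplex_def using corner_vertices_independent[of a] corner_simplex_eq_hull[of a] assms
  by (intro exI[of _ "corner_vertices a"]) auto

definition single :: "'n \<Rightarrow> real \<Rightarrow> 'n \<Rightarrow> real" where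
  "single i t = (\<lambda>k. if k = i then t else 0)"

context
  fixes K :: "(real ^ 'n::finite) set"
  assumes K: "convex_body K" "anti_blocking K" and F: "full_antiblocking_body (coord_set K)"
begin

interpretation F: full_antiblocking_body "coord_set K" by (rule F)

lemma gauge_single_pos: "0 < F.gauge (single i 1)"
proof -
  obtain c where c: "0 < c" "\<And>x. c * (\<Sum>i\<in>UNIV. x i) \<le> F.gauge x" using F.coercive by auto
  have "c * 1 \<le> F.gauge (single i 1)" using c(2)[of "single i 1"] by (simp add: single_def)
  then show ?thesis using c(1) by simp
qed

lemma gauge_single: "0 \<le> t \<Longrightarrow> F.gauge (single i t) = t * F.gauge (single i 1)"
  using F.homog[of t "single i 1"] by (simp add: single_def if_distrib[of "(*) _"] cong: if_cong)

lemma mem_iff_gauge: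
  assumes "\<And>i. 0 \<le> v $ i"
  shows "v \<in> K \<longleftrightarrow> F.gauge (\<lambda>i. v $ i) \<le> 1"
  using assms by (subst F.gauge_le_iff) (auto simp: coord_set_def max_def vec_nth_inverse)

lemma nonneg_if_mem: "v \<in> K \<Longrightarrow> 0 \<le> v $ i"
  using F.orthant[of "\<lambda>i. v $ i"] by (simp add: coord_set_def)

lemma axis_mem_iff:
  assumes "0 \<le> t"
  shows "axis i t \<in> K \<longleftrightarrow> t \<le> 1 / F.gauge (single i 1)"
proof -
  have "(\<lambda>j. axis i t $ j) = single i t" by (auto simp: axis_def single_def)
  moreover have "0 \<le> axis i t $ j" for j using assms by (simp add: axis_def)
  ultimately have "axis i t \<in> K \<longleftrightarrow> F.gauge (single i t) \<le> 1" by (simp add: mem_iff_gauge)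
  also have "\<dots> \<longleftrightarrow> t \<le> 1 / F.gauge (single i 1)"
    using gauge_single_pos[of i] by (simp add: gauge_single[OF assms] pos_le_divide_eq)
  finally show ?thesis .
qed

text \<open>Nonnegativity forces both ends of a segment through p to vanish wherever p does. Hence
  the ends are at the origin or on one axis, of which p is the farthest point in K.\<close>

lemma corner_vertices_extreme:
  assumes p: "p \<in> corner_vertices (\<lambda>i. 1 / F.gauge (single i 1))"
  shows "p extreme_point_of K"
  unfolding extreme_point_of_def
proof (intro conjI ballI notI)
  define a where "a = (\<lambda>i. 1 / F.gauge (single i 1))"
  have a: "0 < a i" for i by (simp add: a_def gauge_single_pos)
  have "0 \<in> K" using F.zero_mem by (simp add: coord_set_def zero_vec_def)
  moreover have "axis i (a i) \<in> K" for i using a[of i] by (subst axis_mem_iff) (auto simp: a_def)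
  ultimately show "p \<in> K" using p by (auto simp: corner_vertices_def a_def)
  fix x y assume x: "x \<in> K" and y: "y \<in> K" and seg: "p \<in> open_segment x y"
  then obtain u where u: "0 < u" "u < 1" "p = (1 - u) *\<^sub>R x + u *\<^sub>R y" and ne: "x \<noteq> y"
    by (auto simp: in_segment)
  have zero: "x $ k = 0 \<and> y $ k = 0" if "p $ k = 0" for k
  proof -
    have "(1 - u) * x $ k + u * y $ k = 0" using that u by simp
    moreover have "0 \<le> (1 - u) * x $ k" "0 \<le> u * y $ k" using u nonneg_if_mem[OF x, of k] nonneg_if_mem[OF y, of k] by auto
    ultimately have "(1 - u) * x $ k = 0" "u * y $ k = 0" by linarith+
    then show ?thesis using u by simp
  qed
  consider "p = 0" | i where "p = axis i (a i)" using p by (auto simp: corner_vertices_def a_def)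
  then show False
  proof cases
    case 1
    then have "x = y" using zero by (simp add: vec_eq_iff)
    then show False using ne by simp
  next
    case (2 i)
    have sup: "z = axis i (z $ i) \<and> z $ i \<le> a i" if z: "z \<in> K" and "\<And>k. k \<noteq> i \<Longrightarrow> z $ k = 0" for z
    proof -
      have eq: "z = axis i (z $ i)" using that(2) by (simp add: vec_eq_iff axis_def)
      then have "axis i (z $ i) \<in> K" using z by simp
      then have "z $ i \<le> a i" using axis_mem_iff[OF nonneg_if_mem[OF z], of i i] by (simp add: a_def)
      then show ?thesis using eq by blast
    qed
    have pz: "p $ k = 0" if "k \<noteq> i" for k using that 2 by (simp add: axis_def)
    have "x $ k = 0" "y $ k = 0" if "k \<noteq> i" for k using zero[OF pz[OF that]] by auto
    note xs = sup[OF x this(1), THEN conjunct1] sup[OF x this(1), THEN conjunct2]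
      and ys = sup[OF y this(2), THEN conjunct1] sup[OF y this(2), THEN conjunct2]
    have "p $ i = a i" using 2 by (simp add: axis_def)
    then have eq: "(1 - u) * x $ i + u * y $ i = a i" using u by simp
    have "(1 - u) * (a i - x $ i) + u * (a i - y $ i) = 0" using eq by (simp add: algebra_simps)
    moreover have "0 \<le> (1 - u) * (a i - x $ i)" "0 \<le> u * (a i - y $ i)" using u xs ys by auto
    ultimately have "(1 - u) * (a i - x $ i) = 0" "u * (a i - y $ i) = 0" by linarith+
    then have "x $ i = y $ i" using u by simp
    then show False using ne xs(1) ys(1) by metis
  qed
qed

text \<open>The extreme points of a simplex are among its n + 1 vertices, and K already has the n +
  1 extreme points \<open>corner_vertices a\<close>; counting identifies the two sets.\<close>

lemma simplex_imp_corner_simplex: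
  assumes "int CARD('n) simplex K"
  shows "\<exists>a. (\<forall>i. 0 < a i) \<and> K = corner_simplex a"
proof -
  define a where "a = (\<lambda>i. 1 / F.gauge (single i 1))"
  have a: "0 < a i" for i by (simp add: a_def gauge_single_pos)
  obtain C where C: "\<not> affine_dependent C" "int (card C) = int CARD('n) + 1" "K = convex hull C"
    using assms by (auto simp: simplex_def)
  have fin: "finite C" using C(1) by (rule aff_independent_finite)
  have "corner_vertices a \<subseteq> C"
  proof
    fix p assume "p \<in> corner_vertices a"
    then have "p extreme_point_of convex hull C" using corner_vertices_extreme[of p] C(3) by (simp add: a_def)
    then show "p \<in> C" by (rule extreme_point_of_convex_hull)
  qed
  then have "corner_vertices a = C"
    using C(2) corner_vertices_independent(2)[of a] a by (intro card_subset_eq fin) auto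
  then have "K = corner_simplex a" using C(3) corner_simplex_eq_hull[of a] a by simp
  then show ?thesis using a by blast
qed

text \<open>The gauge is linear on the orthant, so the integral factors and \<open>total S\<close>
  is the product of the a i over S. Every a i occurs in all but one of the complements of fibers,
  that is, p times.\<close>

lemma normalized_product_corner_simplex:
  fixes c :: "'n \<Rightarrow> 'p::finite option"
  assumes a: "\<And>i. 0 < a i" and Ka: "K = corner_simplex a"
  shows "normalized_product K c = (fact CARD('n) * measure lebesgue K) ^ CARD('p)"
proof -
  have mem: "y \<in> coord_set K \<longleftrightarrow> (\<forall>i. 0 \<le> y i) \<and> (\<Sum>i\<in>UNIV. y i / a i) \<le> 1" for y
    by (simp add: coord_set_def Ka corner_simplex_def)
  have gauge: "F.gauge x = (\<Sum>i\<in>UNIV. max 0 (x i) / a i)" (is "_ = ?s x") for x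
  proof -
    have s0: "0 \<le> ?s x" using a by (intro sum_nonneg) (auto simp: less_imp_le)
    have iff: "F.gauge x \<le> r \<longleftrightarrow> ?s x \<le> r" if r: "0 < r" for r
    proof -
      have "(\<Sum>i\<in>UNIV. max 0 (x i) / r / a i) = ?s x / r"
        by (simp add: sum_divide_distrib mult.commute)
      then show ?thesis
        using r a by (simp add: F.gauge_le_iff mem pos_divide_le_eq)
    qed
    show ?thesis
    proof (rule antisym)
      show "F.gauge x \<le> ?s x" by (rule field_le_epsilon) (use s0 in \<open>simp add: iff\<close>)
      show "?s x \<le> F.gauge x" by (rule field_le_epsilon) (use F.gauge_nonneg[of x] in \<open>simp add: iff[symmetric]\<close>)
    qed
  qed
  have total: "F.total S = (\<Prod>i\<in>S. a i)" for S
  proof -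
    have one: "(\<integral>\<^sup>+s. ennreal (exp (- (max 0 s / a i))) \<partial>half_lborel) = ennreal (a i)" for i
    proof -
      have "(\<integral>\<^sup>+s. ennreal (exp (- (max 0 s / a i))) \<partial>half_lborel) = (\<integral>\<^sup>+s. ennreal (exp (- (1 / a i) * s)) \<partial>half_lborel)"
        by (rule nn_integral_cong_AE, rule eventually_mono[OF AE_half_lborel]) auto
      also have "\<dots> = ennreal (1 / (1 / a i))" using a[of i] by (intro nn_integral_half_lborel_exp) simp
      finally show ?thesis by simp
    qed
    have "ennreal (F.total S) = (\<integral>\<^sup>+x. (\<Prod>i\<in>S. ennreal (exp (- (max 0 (x i) / a i)))) \<partial>orthant_measure S)"
      unfolding F.total_eq
    proof (rule nn_integral_cong)
      fix x :: "'n \<Rightarrow> real"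
      have "(\<Sum>i\<in>UNIV. max 0 (zero_ext S x i) / a i) = (\<Sum>i\<in>S. max 0 (x i) / a i)"
        by (rule sum.mono_neutral_cong_right) (auto simp: override_def)
      then show "ennreal (exp (- F.gauge (zero_ext S x))) = (\<Prod>i\<in>S. ennreal (exp (- (max 0 (x i) / a i))))"
        by (simp add: gauge prod_ennreal exp_sum sum_negf[symmetric] del: sum_negf)
    qed
    also have "\<dots> = (\<Prod>i\<in>S. ennreal (a i))"
      by (subst half.product_nn_integral_prod) (auto simp: one)
    also have "\<dots> = ennreal (\<Prod>i\<in>S. a i)" using a by (simp add: prod_ennreal less_imp_le)
    finally show ?thesis using F.total_pos[of S] a by (simp add: prod_nonneg less_imp_le)
  qed
  have "(\<Prod>b\<in>UNIV. F.total (c -` {b})) = (\<Prod>b\<in>UNIV. \<Prod>i | i \<in> UNIV \<and> c i = b. a i)"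
    by (simp add: total vimage_def)
  also have "\<dots> = F.total UNIV" unfolding total by (rule prod.group) auto
  finally have fib: "(\<Prod>b\<in>UNIV. F.total (c -` {b})) = F.total UNIV" .
  \<comment> \<open>Pairing each complement with its fiber gives p + 1 copies of
    \<open>total UNIV\<close>, and the fibers together account for one of them.\<close>
  have "F.total UNIV * (\<Prod>b\<in>UNIV. F.total (- (c -` {b}))) = (\<Prod>b\<in>UNIV. F.total (c -` {b}) * F.total (- (c -` {b})))"
    by (simp add: prod.distrib fib)
  also have "\<dots> = (\<Prod>b\<in>(UNIV :: 'p option set). F.total UNIV)"
  proof (rule prod.cong[OF refl])
    fix b
    have "prod a (c -` {b}) * prod a (- (c -` {b})) = prod a (c -` {b} \<union> - (c -` {b}))"
      by (rule prod.union_disjoint[symmetric]) auto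
    then show "F.total (c -` {b}) * F.total (- (c -` {b})) = F.total UNIV" by (simp add: total)
  qed
  also have "\<dots> = F.total UNIV * F.total UNIV ^ CARD('p)" by (simp add: card_UNIV_option)
  finally have "(\<Prod>b\<in>UNIV. F.total (- (c -` {b}))) = F.total UNIV ^ CARD('p)"
    using F.total_pos[of UNIV] by simp
  then show ?thesis
    by (simp add: normalized_product_def total_eq_coord_volume[OF K F] coord_volume_UNIV[OF K])
qed

text \<open>Induction on the size of the support. A map that separates two coordinates of the
  support splits x into block components with strictly smaller supports.\<close>

lemma gauge_additive:
  fixes C :: "('n \<Rightarrow> 'p::finite option) set"
  assumes eq: "\<And>c. c \<in> C \<Longrightarrow> normalized_product K c = (fact CARD('n) * measure lebesgue K) ^ CARD('p)"
    and sep: "\<And>i j. i \<noteq> j \<Longrightarrow> \<exists>c\<in>C. c i \<noteq> c j"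
    and x: "\<And>i. 0 \<le> x i"
  shows "F.gauge x = (\<Sum>i\<in>UNIV. F.gauge (single i (x i)))"
  using x
proof (induction "card {i. x i \<noteq> 0}" arbitrary: x rule: less_induct)
  case less
  have g0: "F.gauge (single i 0) = 0" for i using gauge_single[of 0 i] by simp
  show ?case
  proof (cases "\<exists>i j. i \<noteq> j \<and> x i \<noteq> 0 \<and> x j \<noteq> 0")
    case True
    then obtain i j where ne: "i \<noteq> j" and ij: "x i \<noteq> 0" "x j \<noteq> 0" by blast
    from sep[OF ne] obtain c where c: "c \<in> C" "c i \<noteq> c j" by blast
    have "F.gauge x = (\<Sum>b\<in>UNIV. F.gauge (zero_ext (c -` {b}) x))"
      by (rule gauge_additive_if_normalized_product_eq[OF K F eq[OF c(1)] less.prems])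
    also have "\<dots> = (\<Sum>b\<in>UNIV. \<Sum>k | k \<in> UNIV \<and> c k = b. F.gauge (single k (x k)))"
    proof (rule sum.cong[OF refl])
      fix b
      let ?y = "zero_ext (c -` {b}) x"
      have "{k. ?y k \<noteq> 0} \<subset> {k. x k \<noteq> 0}"
      proof
        show "{k. ?y k \<noteq> 0} \<subseteq> {k. x k \<noteq> 0}" by (auto simp: override_def split: if_splits)
        obtain k where "c k \<noteq> b" "x k \<noteq> 0"
        proof (cases "c i = b")
          case True
          then show ?thesis using that[of j] ij c(2) by auto
        next
          case False
          then show ?thesis using that[of i] ij by auto
        qed
        then have "k \<notin> {k. ?y k \<noteq> 0}" "k \<in> {k. x k \<noteq> 0}" by (auto simp: override_def)
        then show "{k. ?y k \<noteq> 0} \<noteq> {k. x k \<noteq> 0}" by blast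
      qed
      then have "card {k. ?y k \<noteq> 0} < card {k. x k \<noteq> 0}" by (intro psubset_card_mono) auto
      then have "F.gauge ?y = (\<Sum>k\<in>UNIV. F.gauge (single k (?y k)))"
        by (rule less.hyps) (simp add: override_def less.prems)
      also have "\<dots> = (\<Sum>k | k \<in> UNIV \<and> c k = b. F.gauge (single k (x k)))"
        by (rule sum.mono_neutral_cong_right) (auto simp: override_def g0)
      finally show "F.gauge ?y = (\<Sum>k | k \<in> UNIV \<and> c k = b. F.gauge (single k (x k)))" .
    qed
    also have "\<dots> = (\<Sum>k\<in>UNIV. F.gauge (single k (x k)))" by (rule sum.group) auto
    finally show ?thesis .
  next
    case False
    show ?thesis
    proof (cases "\<exists>i. x i \<noteq> 0")
      case True
      then obtain i where i: "x i \<noteq> 0" by auto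
      have z: "x k = 0" if "k \<noteq> i" for k using False i that by blast
      then have "x = single i (x i)" by (auto simp: single_def)
      moreover have "(\<Sum>k\<in>UNIV. F.gauge (single k (x k))) = (\<Sum>k\<in>{i}. F.gauge (single k (x k)))"
        by (rule sum.mono_neutral_right) (auto simp: z g0)
      ultimately show ?thesis by simp
    next
      case False
      then have "x = (\<lambda>_. 0)" by auto
      then show ?thesis by (simp add: F.zero g0)
    qed
  qed
qed

text \<open>Closure under transpositions turns one nonconstant map into maps separating any two
  coordinates. Then the gauge is linear on the orthant, and its unit ball there is a corner
  simplex.\<close>

lemma simplex_if_normalized_product_eq:
  fixes C :: "('n \<Rightarrow> 'p::finite option) set"
  assumes eq: "\<And>c. c \<in> C \<Longrightarrow> normalized_product K c = (fact CARD('n) * measure lebesgue K) ^ CARD('p)"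
    and perm: "\<And>c i j. c \<in> C \<Longrightarrow> c \<circ> Transposition.transpose i j \<in> C"
    and nonconst: "c0 \<in> C" "c0 a \<noteq> c0 b"
  shows "int CARD('n) simplex K"
proof -
  have sep: "\<exists>c\<in>C. c i \<noteq> c j" if ij: "i \<noteq> j" for i j
  proof -
    \<comment> \<open>The first transposition moves the value c0 a to i, the second moves c0 b to j;
      \<open>b'\<close> is the place of c0 b after the first.\<close>
    define c1 where "c1 = c0 \<circ> Transposition.transpose i a"
    define b' where "b' = Transposition.transpose i a b"
    have c1: "c1 \<in> C" unfolding c1_def by (rule perm[OF nonconst(1)])
    have "c1 i = c0 a" "c1 b' = c0 b" by (simp_all add: c1_def b'_def)
    then have ne: "c1 i \<noteq> c1 b'" using nonconst(2) by simp
    then have "i \<noteq> b'" by metis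
    have "(c1 \<circ> Transposition.transpose j b') i = c1 i" "(c1 \<circ> Transposition.transpose j b') j = c1 b'"
      using ij \<open>i \<noteq> b'\<close> by simp_all
    then have "(c1 \<circ> Transposition.transpose j b') i \<noteq> (c1 \<circ> Transposition.transpose j b') j" using ne by simp
    then show ?thesis by (rule bexI[where P = "\<lambda>c. c i \<noteq> c j" and x = "c1 \<circ> Transposition.transpose j b'", OF _ perm[OF c1]])
  qed
  define \<alpha> where "\<alpha> = (\<lambda>i. 1 / F.gauge (single i 1))"
  have \<alpha>: "0 < \<alpha> i" for i by (simp add: \<alpha>_def gauge_single_pos)
  have "v \<in> K \<longleftrightarrow> v \<in> corner_simplex \<alpha>" for v
  proof (cases "\<forall>i. 0 \<le> v $ i")
    case True
    have "F.gauge (\<lambda>i. v $ i) = (\<Sum>i\<in>UNIV. F.gauge (single i (v $ i)))"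
    proof (rule gauge_additive)
      show "normalized_product K c = (fact CARD('n) * measure lebesgue K) ^ CARD('p)" if "c \<in> C" for c
        by (rule eq[OF that])
      show "\<exists>c\<in>C. c i \<noteq> c j" if "i \<noteq> j" for i j
        by (rule sep[OF that])
      show "0 \<le> v $ i" for i using True by simp
    qed
    also have "\<dots> = (\<Sum>i\<in>UNIV. v $ i / \<alpha> i)"
    proof (rule sum.cong[OF refl])
      fix i
      show "F.gauge (single i (v $ i)) = v $ i / \<alpha> i"
        using gauge_single[of "v $ i" i] True by (simp add: \<alpha>_def)
    qed
    finally show ?thesis using True by (simp add: mem_iff_gauge corner_simplex_def)
  next
    case False
    then show ?thesis using nonneg_if_mem[of v] by (auto simp: corner_simplex_def)
  qed
  then have "K = corner_simplex \<alpha>" by (rule set_eqI)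
  then show ?thesis using simplex_corner_simplex[of \<alpha>] \<alpha> by simp
qed

end

section \<open>The mixed volumes\<close>

text \<open>The deficits M - g c have positive weights, so their weighted sum is nonnegative and
  vanishes only if every deficit does.\<close>

lemma weighted_sum_le_max:
  fixes g F :: "'c \<Rightarrow> real"
  assumes "finite C" "\<And>c. c \<in> C \<Longrightarrow> g c \<le> M" "\<And>c. c \<in> C \<Longrightarrow> 0 < F c"
  shows "(\<Sum>c\<in>C. F c * g c) \<le> (\<Sum>c\<in>C. F c) * M"
    and "(\<Sum>c\<in>C. F c * g c) = (\<Sum>c\<in>C. F c) * M \<longleftrightarrow> (\<forall>c\<in>C. g c = M)"
proof -
  have nn: "0 \<le> F c * (M - g c)" if "c \<in> C" for c
    using assms(2,3)[OF that] by simp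
  have diff: "(\<Sum>c\<in>C. F c) * M - (\<Sum>c\<in>C. F c * g c) = (\<Sum>c\<in>C. F c * (M - g c))"
    by (simp add: sum_distrib_right sum_subtractf right_diff_distrib)
  show "(\<Sum>c\<in>C. F c * g c) \<le> (\<Sum>c\<in>C. F c) * M"
    using diff sum_nonneg[of C "\<lambda>c. F c * (M - g c)", OF nn] by linarith
  have "(\<Sum>c\<in>C. F c * g c) = (\<Sum>c\<in>C. F c) * M \<longleftrightarrow> (\<Sum>c\<in>C. F c * (M - g c)) = 0"
    using diff by linarith
  also have "\<dots> \<longleftrightarrow> (\<forall>c\<in>C. F c * (M - g c) = 0)"
    by (rule sum_nonneg_eq_0_iff[OF assms(1) nn])
  also have "\<dots> \<longleftrightarrow> (\<forall>c\<in>C. g c = M)"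
    using assms(3) by force
  finally show "(\<Sum>c\<in>C. F c * g c) = (\<Sum>c\<in>C. F c) * M \<longleftrightarrow> (\<forall>c\<in>C. g c = M)" .
qed

lemma card_Compl_fiber: "card (- (c -` {b})) = CARD('n::finite) - card ((c :: 'n \<Rightarrow> 'b) -` {b})"
  by (simp add: Compl_eq_Diff_UNIV card_Diff_subset)

lemma card_fiber_le: "card ((c :: 'n::finite \<Rightarrow> 'b) -` {b}) \<le> CARD('n)"
  by (rule card_mono) auto

text \<open>Every coordinate lies in all but one of the p + 1 complements. The volume polynomial is
  therefore homogeneous of degree pn.\<close>

lemma sum_card_Compl_fibers:
  "(\<Sum>b\<in>UNIV. card (- ((c :: 'n::finite \<Rightarrow> 'p::finite option) -` {b}))) = CARD('p) * CARD('n)"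
proof -
  have "(\<Sum>b\<in>UNIV. card (- (c -` {b}))) + (\<Sum>b\<in>UNIV. card (c -` {b})) = (\<Sum>b\<in>(UNIV :: 'p option set). CARD('n))"
    unfolding sum.distrib[symmetric] by (intro sum.cong refl) (simp add: card_Compl_fiber card_fiber_le)
  also have "\<dots> = CARD('p) * CARD('n) + CARD('n)" by (simp add: card_UNIV_option)
  finally show ?thesis using sum_card_fibers[of c] by simp
qed

lemma UNIV_option_sum: "(\<Sum>b\<in>UNIV. f b) = f None + (\<Sum>i\<in>UNIV. f (Some i))" for f :: "'p::finite option \<Rightarrow> 'z::comm_monoid_add"
  by (simp add: UNIV_option_conv sum.reindex)

lemma UNIV_option_prod: "(\<Prod>b\<in>UNIV. f b) = f None * (\<Prod>i\<in>UNIV. f (Some i))" for f :: "'p::finite option \<Rightarrow> 'z::comm_monoid_mult"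
  by (simp add: UNIV_option_conv prod.reindex)

text \<open>Here \<open>q\<close> groups the summands \<open>- \<Delta> K\<close> (index \<open>None\<close>) and \<open>\<iota>\<^sub>i K\<close> (index \<open>Some i\<close>) that occur
  together as one body of the list.\<close>

lemma mixed_volume_block_bodies:
  fixes K :: "(real ^ 'n::finite) set" and q :: "'p::{finite,linorder} option \<Rightarrow> 'b::finite"
    and Ks :: "(real ^ 'n ^ 'p::{finite,linorder}) set list"
  defines "kk \<equiv> \<lambda>\<beta> b. card {i. i < length Ks \<and> \<beta> i = b}"
  assumes K: "convex_body K" "anti_blocking K"
    and Ks: "\<And>i. i < length Ks \<Longrightarrow> Ks ! i = block_body K (\<lambda>b. of_bool (q b = \<beta> i))"
    and len: "length Ks = CARD('p) * CARD('n)"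
  shows "mixed_volume Ks = (\<Prod>b\<in>UNIV. fact (kk \<beta> b))
     * (\<Sum>c | (\<lambda>b. \<Sum>b' | b' \<in> UNIV \<and> q b' = b. card (- (c -` {b'}))) = kk \<beta>. \<Prod>b\<in>UNIV. coord_volume K (- (c -` {b})))
     / fact (CARD('p) * CARD('n))"
proof -
  define e where "e = (\<lambda>(c :: 'n \<Rightarrow> 'p option) b. \<Sum>b' | b' \<in> UNIV \<and> q b' = b. card (- (c -` {b'})))"
  have K': "convex K" "K \<noteq> {}" using K(1) by (auto simp: convex_body_def)
  have "mixed_volume Ks = (\<Prod>b\<in>UNIV. fact (card {i. i < length Ks \<and> \<beta> i = b}))
      * (\<Sum>c | c \<in> UNIV \<and> e c = (\<lambda>b. card {i. i < length Ks \<and> \<beta> i = b}). \<Prod>b\<in>UNIV. coord_volume K (- (c -` {b}))) / fact (length Ks)"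
  proof (rule mixed_volume_block_polynomial)
    fix l :: "nat \<Rightarrow> real" assume l: "\<And>i. i < length Ks \<Longrightarrow> 0 < l i"
    have "minkowski_comb Ks l = block_body K (\<lambda>b. \<Sum>i<length Ks. l i * of_bool (q b = \<beta> i))"
      by (rule minkowski_comb_block_body[OF K' Ks]) (auto simp: l less_imp_le)
    \<comment> \<open>Ingredient b of the combined body collects the multipliers of all list entries
      labelled \<open>q b\<close>.\<close>
    also have "(\<lambda>b. \<Sum>i<length Ks. l i * of_bool (q b = \<beta> i)) = (\<lambda>b. block_sum \<beta> (length Ks) (q b) l)"
      unfolding block_sum_def
      by (intro ext sum.mono_neutral_cong_right) (auto simp: of_bool_def)
    finally have "measure lebesgue (minkowski_comb Ks l)
      = (\<Sum>c\<in>UNIV. (\<Prod>b\<in>UNIV. coord_volume K (- (c -` {b}))) * (\<Prod>b\<in>UNIV. block_sum \<beta> (length Ks) (q b) l ^ card (- (c -` {b}))))"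
    proof (simp only:, intro measure_block_body[OF K])
      show "0 \<le> block_sum \<beta> (length Ks) (q b) l" for b
        unfolding block_sum_def using l by (intro sum_nonneg) (simp add: less_imp_le)
    qed
    also have "\<dots> = (\<Sum>c\<in>UNIV. (\<Prod>b\<in>UNIV. coord_volume K (- (c -` {b}))) * (\<Prod>b\<in>UNIV. block_sum \<beta> (length Ks) b l ^ e c b))"
    proof (intro sum.cong refl arg_cong2[where f = "(*)"])
      fix c :: "'n \<Rightarrow> 'p option"
      have "(\<Prod>b\<in>UNIV. block_sum \<beta> (length Ks) b l ^ e c b)
        = (\<Prod>b\<in>UNIV. \<Prod>b' | b' \<in> UNIV \<and> q b' = b. block_sum \<beta> (length Ks) (q b') l ^ card (- (c -` {b'})))"
        unfolding e_def power_sum by (intro prod.cong refl) auto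
      also have "\<dots> = (\<Prod>b\<in>UNIV. block_sum \<beta> (length Ks) (q b) l ^ card (- (c -` {b})))"
        by (rule prod.group) auto
      finally show "(\<Prod>b\<in>UNIV. block_sum \<beta> (length Ks) (q b) l ^ card (- (c -` {b}))) = (\<Prod>b\<in>UNIV. block_sum \<beta> (length Ks) b l ^ e c b)" ..
    qed
    finally show "measure lebesgue (minkowski_comb Ks l)
      = (\<Sum>c\<in>UNIV. (\<Prod>b\<in>UNIV. coord_volume K (- (c -` {b}))) * (\<Prod>b\<in>UNIV. block_sum \<beta> (length Ks) b l ^ e c b))" .
  next
    fix c :: "'n \<Rightarrow> 'p option"
    have "(\<Sum>b\<in>UNIV. e c b) = (\<Sum>b\<in>UNIV. card (- (c -` {b})))"
      unfolding e_def by (rule sum.group) auto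
    then show "(\<Sum>b\<in>UNIV. e c b) = length Ks" by (simp add: sum_card_Compl_fibers len)
  qed simp
  then show ?thesis by (simp add: e_def kk_def len)
qed

lemma coord_volume_prod:
  "(\<Prod>b\<in>UNIV. coord_volume K (- (c -` {b}))) = normalized_product K c / (\<Prod>b\<in>UNIV. fact (card (- (c -` {b}))))"
  by (simp add: normalized_product_def prod.distrib)

lemma normalized_product_eq_iff_simplex:
  fixes K :: "(real ^ 'n::finite) set" and C :: "('n \<Rightarrow> 'p::finite option) set"
  assumes K: "convex_body K" "anti_blocking K" "interior K \<noteq> {}"
    and perm: "\<And>c i j. c \<in> C \<Longrightarrow> c \<circ> Transposition.transpose i j \<in> C"
    and nonconst: "c0 \<in> C" "c0 a \<noteq> c0 b"
  shows "(\<forall>c\<in>C. normalized_product K c = (fact CARD('n) * measure lebesgue K) ^ CARD('p)) \<longleftrightarrow> int CARD('n) simplex K"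
proof
  note F = full_if_interior[OF K]
  assume "\<forall>c\<in>C. normalized_product K c = (fact CARD('n) * measure lebesgue K) ^ CARD('p)"
  then show "int CARD('n) simplex K"
    by (intro simplex_if_normalized_product_eq[OF K(1,2) F _ perm nonconst]) auto
next
  note F = full_if_interior[OF K]
  assume "int CARD('n) simplex K"
  then obtain a where "\<forall>i. 0 < a i" "K = corner_simplex a"
    using simplex_imp_corner_simplex[OF K(1,2) F] by blast
  then show "\<forall>c\<in>C. normalized_product K c = (fact CARD('n) * measure lebesgue K) ^ CARD('p)"
    using normalized_product_corner_simplex[OF K(1,2) F] by blast
qed

lemma card_vimage_transpose:
  "card ((c \<circ> Transposition.transpose i j) -` B) = card ((c :: 'n::finite \<Rightarrow> 'b) -` B)"
proof -
  have "inj (Transposition.transpose i j)" by (metis inj_onI transpose_involutory)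
  moreover have "range (Transposition.transpose i j) = UNIV" by (metis surj_def transpose_involutory)
  ultimately show ?thesis unfolding vimage_comp[symmetric] by (intro card_vimage_inj) auto
qed

lemma ex_neq_if_card: "CARD('a::finite) \<noteq> 1 \<Longrightarrow> \<exists>i j :: 'a. i \<noteq> j"
proof (rule ccontr)
  assume 1: "CARD('a) \<noteq> 1" and "\<nexists>i j :: 'a. i \<noteq> j"
  then have "(UNIV :: 'a set) = {undefined}" by auto
  then have "CARD('a) = card {undefined :: 'a}" by (rule arg_cong)
  then show False using 1 by simp
qed

lemma card_le_card_mult: "k \<le> CARD('n::finite) \<Longrightarrow> k \<le> CARD('p::finite) * CARD('n)"
proof -
  assume k: "k \<le> CARD('n)"
  have "1 \<le> CARD('p)" by (simp add: Suc_le_eq)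
  then have "1 * CARD('n) \<le> CARD('p) * CARD('n)" by (rule mult_le_mono1)
  then show ?thesis using k by linarith
qed

text \<open>The list prescribes the exponents k for -\<Delta>K and n - k_j for the j-th factor. An
  exponent is the size of a complement of a fiber, which explains the sizes n - k and k_j in
  \<open>fib\<close>. The factorials from differentiation are those in
  \<open>normalized_product\<close>, so all maps have equal weight.\<close>

lemma mixed_volume_factors:
  fixes K :: "(real ^ 'n::finite) set" and ks :: "'p::{finite,linorder} \<Rightarrow> nat"
  assumes K: "convex_body K" "anti_blocking K" and ks: "\<And>j. ks j \<le> CARD('n)" "(\<Sum>j\<in>UNIV. ks j) = k" "k \<le> CARD('n)"
  defines "fib \<equiv> case_option (CARD('n) - k) ks"
  shows "mixed_volume (replicate k (uminus ` diag ` K) @ factor_copies K ks)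
     = (\<Sum>c | \<forall>b. card (c -` {b}) = fib b. normalized_product K c) / fact (CARD('p) * CARD('n))"
proof -
  define J where "J = concat (map (\<lambda>j. replicate (CARD('n) - ks j) j) (sorted_list_of_set (UNIV :: 'p set)))"
  define B where "B = replicate k None @ map Some J"
  define T where "T = (\<lambda>b. block_body K (\<lambda>b'. of_bool (b' = b)) :: (real ^ 'n ^ 'p::{finite,linorder}) set)"
  have ne: "K \<noteq> {}" using K(1) by (simp add: convex_body_def)
  have "factor_copies K ks = map (\<lambda>j. axis j ` K) J"
    by (simp add: factor_copies_def J_def map_concat comp_def)
  then have Ks: "replicate k (uminus ` diag ` K) @ factor_copies K ks = map T B"
    by (simp add: B_def T_def axis_image[OF ne] uminus_diag_image[OF ne] comp_def)
  have cJ: "count_list J j = CARD('n) - ks j" for j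
  proof -
    have "count_list J j = (\<Sum>i\<leftarrow>sorted_list_of_set UNIV. if i = j then CARD('n) - ks i else 0)"
      unfolding J_def count_list_concat map_map comp_def
      by (intro arg_cong[where f = sum_list] map_cong refl) (auto simp: count_list_eq_length_filter)
    also have "\<dots> = (\<Sum>i\<in>UNIV. if i = j then CARD('n) - ks i else 0)"
      by (subst sum_list_distinct_conv_sum_set) auto
    finally show ?thesis by simp
  qed
  have cB: "card {i. i < length B \<and> B ! i = b} = CARD('n) - fib b" for b
  proof -
    have "card {i. i < length B \<and> B ! i = b} = length (filter ((=) b) B)"
      by (simp add: length_filter_conv_card eq_commute)
    also have "\<dots> = count_list B b" by (simp add: count_list_eq_length_filter)
    also have "\<dots> = CARD('n) - fib b"
    proof (cases b)
      case None
      have "count_list (map Some J) (None :: 'p option) = 0" by (simp add: count_list_0_iff)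
      then show ?thesis using None ks(3) by (simp add: B_def fib_def count_list_eq_length_filter)
    next
      case (Some j)
      have "count_list (map Some J) (Some j) = count_list J j" by (induction J) auto
      moreover have "count_list (replicate k None) (Some j) = 0" by (auto simp: count_list_0_iff)
      ultimately show ?thesis using Some cJ by (simp add: B_def fib_def)
    qed
    finally show ?thesis .
  qed
  have fib_le: "fib b \<le> CARD('n)" for b using ks by (cases b) (auto simp: fib_def)
  have "length B = (\<Sum>b\<in>UNIV. card {i. i < length B \<and> B ! i = b})"
  proof -
    have "(\<Sum>b\<in>UNIV. card {i. i < length B \<and> B ! i = b}) = card (\<Union>b\<in>UNIV. {i. i < length B \<and> B ! i = b})"
      by (intro card_UN_disjoint[symmetric]) auto
    also have "(\<Union>b\<in>UNIV. {i. i < length B \<and> B ! i = b}) = {..<length B}" by auto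
    finally show ?thesis by simp
  qed
  also have "\<dots> = k + (\<Sum>j\<in>UNIV. CARD('n) - ks j)"
    using ks(3) by (simp add: cB UNIV_option_sum fib_def)
  also have "\<dots> = CARD('p) * CARD('n)"
  proof -
    have "(\<Sum>j\<in>UNIV. CARD('n) - ks j) + (\<Sum>j\<in>UNIV. ks j) = (\<Sum>j\<in>(UNIV :: 'p set). CARD('n))"
      unfolding sum.distrib[symmetric] using ks(1) by (intro sum.cong refl) simp
    then show ?thesis using ks(2) by simp
  qed
  finally have len: "length B = CARD('p) * CARD('n)" .
  have deg: "(\<lambda>b. \<Sum>b' | b' \<in> UNIV \<and> b' = b. card (- (c -` {b'}))) = (\<lambda>b. CARD('n) - fib b) \<longleftrightarrow> (\<forall>b. card (c -` {b}) = fib b)"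
    for c :: "'n \<Rightarrow> 'p option"
  proof -
    \<comment> \<open>Truncated subtraction from n is injective on numbers up to n, and both fiber
      sizes are in this range.\<close>
    have "CARD('n) - card (c -` {b}) = CARD('n) - fib b \<longleftrightarrow> card (c -` {b}) = fib b" for b
      using fib_le[of b] card_fiber_le[of c b] by auto
    then show ?thesis by (simp add: fun_eq_iff card_Compl_fiber)
  qed
  have "mixed_volume (map T B) = (\<Prod>b\<in>UNIV. fact (CARD('n) - fib b))
     * (\<Sum>c | \<forall>b. card (c -` {b}) = fib b. \<Prod>b\<in>UNIV. coord_volume K (- (c -` {b}))) / fact (CARD('p) * CARD('n))"
    using mixed_volume_block_bodies[OF K, of "map T B" "\<lambda>b. b" "\<lambda>i. B ! i"] len
    unfolding length_map cB deg by (simp add: T_def)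
  also have "(\<Prod>b\<in>UNIV. fact (CARD('n) - fib b)) * (\<Sum>c | \<forall>b. card (c -` {b}) = fib b. \<Prod>b\<in>UNIV. coord_volume K (- (c -` {b})))
     = (\<Sum>c | \<forall>b. card (c -` {b}) = fib b. normalized_product K c)"
    unfolding sum_distrib_left
    by (intro sum.cong refl) (simp add: coord_volume_prod card_Compl_fiber)
  finally show ?thesis by (simp add: Ks)
qed

text \<open>The p factors form one body, so only the exponent of -\<Delta>K is prescribed and the
  fibers over \<open>Some i\<close> are free. The factorials (n - f_i)!, with f_i the fiber sizes,
  are not matched by differentiation; written as n! over a falling factorial, they give the
  weights.\<close>

lemma mixed_volume_power:
  fixes K :: "(real ^ 'n::finite) set"
  assumes K: "convex_body K" "anti_blocking K" and k: "k \<le> CARD('n)"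
  shows "mixed_volume (replicate k (uminus ` diag ` K) @ replicate (CARD('p) * CARD('n) - k) (body_power K :: (real ^ 'n ^ 'p::{finite,linorder}) set))
     = fact (CARD('p) * CARD('n) - k) / (fact (CARD('p) * CARD('n)) * fact CARD('n) ^ CARD('p))
       * (\<Sum>c | card (- (c -` {None})) = k. (\<Prod>i\<in>UNIV. falling CARD('n) (card (c -` {Some (i :: 'p)}))) * normalized_product K c)"
proof -
  define m where "m = CARD('p) * CARD('n)"
  define Ks where "Ks = replicate k (uminus ` diag ` K) @ replicate (m - k) (body_power K :: (real ^ 'n ^ 'p::{finite,linorder}) set)"
  have ne: "K \<noteq> {}" using K(1) by (simp add: convex_body_def)
  have km: "k \<le> m" unfolding m_def by (rule card_le_card_mult[OF k])
  have len: "length Ks = m" using km by (simp add: Ks_def)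
  define \<beta> where "\<beta> = (\<lambda>i. i < k)"
  have nth: "Ks ! i = block_body K (\<lambda>b. of_bool ((b = None) = \<beta> i))" if "i < length Ks" for i
    using that by (auto simp: Ks_def nth_append \<beta>_def uminus_diag_image[OF ne] body_power_eq[OF ne])
  have cT: "card {i. i < m \<and> \<beta> i = True} = k"
  proof -
    have "{i. i < m \<and> \<beta> i = True} = {..<k}" using km by (auto simp: \<beta>_def)
    then show ?thesis by simp
  qed
  have cF: "card {i. i < m \<and> \<beta> i = False} = m - k"
  proof -
    have "{i. i < m \<and> \<beta> i = False} = {k..<m}" by (auto simp: \<beta>_def)
    then show ?thesis by simp
  qed
  have deg: "(\<lambda>b. \<Sum>b' | b' \<in> UNIV \<and> (b' = None) = b. card (- (c -` {b'}))) = (\<lambda>b. card {i. i < m \<and> \<beta> i = b}) \<longleftrightarrow> card (- (c -` {None})) = k"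
    for c :: "'n \<Rightarrow> 'p option"
  proof -
    have "(\<Sum>b' | b' \<in> UNIV \<and> (b' = None) = False. card (- (c -` {b'}))) + card (- (c -` {None})) = m"
    proof -
      have "{b' :: 'p option. b' \<in> UNIV \<and> (b' = None) = False} = UNIV - {None}" by auto
      then show ?thesis using sum_card_Compl_fibers[of c] sum.remove[of UNIV None "\<lambda>b'. card (- (c -` {b'}))"]
        by (simp add: m_def)
    qed
    moreover have "(\<Sum>b' | b' \<in> UNIV \<and> (b' = None) = True. card (- (c -` {b'}))) = card (- (c -` {None}))"
      by simp
    ultimately show ?thesis using cT cF km by (auto simp: fun_eq_iff all_bool_eq)
  qed
  have "mixed_volume Ks = (\<Prod>b\<in>UNIV. fact (card {i. i < m \<and> \<beta> i = b}))
     * (\<Sum>c | card (- ((c :: 'n \<Rightarrow> 'p option) -` {None})) = k. \<Prod>b\<in>UNIV. coord_volume K (- (c -` {b}))) / fact m"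
    using mixed_volume_block_bodies[OF K, of Ks "\<lambda>b. b = None" \<beta>, OF nth] len
    unfolding len deg by (simp add: m_def)
  also have "(\<Prod>b\<in>UNIV. fact (card {i. i < m \<and> \<beta> i = b})) = (fact k * fact (m - k) :: real)"
    using cT cF by (simp add: UNIV_bool mult.commute)
  also have "(\<Sum>c | card (- ((c :: 'n \<Rightarrow> 'p option) -` {None})) = k. \<Prod>b\<in>UNIV. coord_volume K (- (c -` {b})))
     = (\<Sum>c | card (- (c -` {None})) = k. (\<Prod>i\<in>UNIV. falling CARD('n) (card (c -` {Some (i :: 'p)}))) * normalized_product K c)
       / (fact k * fact CARD('n) ^ CARD('p))"
    unfolding sum_divide_distrib
  proof (intro sum.cong refl)
    fix c :: "'n \<Rightarrow> 'p option" assume c: "c \<in> {c. card (- (c -` {None})) = k}"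
    have "(\<Prod>i\<in>UNIV. falling CARD('n) (card (c -` {Some i}))) = (\<Prod>i\<in>UNIV. fact CARD('n) / fact (card (- (c -` {Some i}))))"
      by (intro prod.cong refl) (simp add: falling_eq card_fiber_le card_Compl_fiber)
    also have "\<dots> = fact CARD('n) ^ CARD('p) / (\<Prod>i\<in>UNIV. fact (card (- (c -` {Some i}))))"
      by (simp add: prod_dividef)
    finally have f: "(\<Prod>i\<in>UNIV. falling CARD('n) (card (c -` {Some i}))) = fact CARD('n) ^ CARD('p) / (\<Prod>i\<in>UNIV. fact (card (- (c -` {Some i}))))" .
    show "(\<Prod>b\<in>UNIV. coord_volume K (- (c -` {b})))
      = (\<Prod>i\<in>UNIV. falling CARD('n) (card (c -` {Some i}))) * normalized_product K c / (fact k * fact CARD('n) ^ CARD('p))"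
      unfolding coord_volume_prod f using c by (simp add: UNIV_option_prod)
  qed
  finally show ?thesis unfolding Ks_def m_def by (simp add: mult_ac)
qed

text \<open>For p = 1 and k = n the list in (ii) consists of n copies of -K, whose mixed volume is
  vol(K), so equality holds for every K; hence the exception in the equality clause. In (i) the
  condition k_i < n already rules this case out. Both bounds sum one inequality over a set of maps,
  and (ii) is read off from the volume polynomial directly.\<close>

theorem theorem1p4:
  fixes K :: "(real ^ 'n::finite) set"
  assumes "CARD('n) \<ge> 2" and "convex_body K" and "anti_blocking K"
  shows
    "(\<forall>k (ks :: 'p::{finite,linorder} \<Rightarrow> nat).
       k \<le> CARD('n) \<longrightarrow> (\<forall>j. ks j \<le> CARD('n)) \<longrightarrow> (\<Sum>j\<in>UNIV. ks j) = k \<longrightarrow>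
       (let
          V = mixed_volume (replicate k (uminus ` diag ` K) @ factor_copies K ks);
          B = real (CARD('n) choose k) * multinomial ks
                * (fact CARD('n) ^ CARD('p) / fact (CARD('p) * CARD('n)))
                * measure lebesgue K ^ CARD('p)
        in V \<le> B \<and>
           ((\<forall>j. ks j < CARD('n)) \<longrightarrow> 0 < k \<longrightarrow> interior K \<noteq> {} \<longrightarrow>
              (V = B \<longleftrightarrow> int CARD('n) simplex K))))
     \<and>
     (\<forall>k. k \<le> CARD('n) \<longrightarrow>
       (let
          V = mixed_volume
                (replicate k (uminus ` diag ` K)
                  @ replicate (CARD('p) * CARD('n) - k)
                      (body_power K :: (real ^ 'n ^ 'p::{finite,linorder}) set));
          B = real (CARD('n) choose k) * measure lebesgue K ^ CARD('p)
        in V \<le> B \<and>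
           (0 < k \<longrightarrow> \<not> (CARD('p) = 1 \<and> k = CARD('n)) \<longrightarrow> interior K \<noteq> {} \<longrightarrow>
              (V = B \<longleftrightarrow> int CARD('n) simplex K))))"
proof (intro conjI allI impI)
  note K = assms(2,3)
  define M where "M = (fact CARD('n) * measure lebesgue K) ^ CARD('p)"
  have le: "normalized_product K c \<le> M" for c :: "'n \<Rightarrow> 'p option"
    unfolding M_def by (rule normalized_product_le[OF K])
  {
    fix k and ks :: "'p \<Rightarrow> nat"
    assume k: "k \<le> CARD('n)" and ks: "\<forall>j. ks j \<le> CARD('n)" "(\<Sum>j\<in>UNIV. ks j) = k"
    define fib where "fib = case_option (CARD('n) - k) ks"
    define C where "C = {c :: 'n \<Rightarrow> 'p option. \<forall>b. card (c -` {b}) = fib b}"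
    define V where "V = mixed_volume (replicate k (uminus ` diag ` K) @ factor_copies K ks)"
    define B where "B = real (CARD('n) choose k) * multinomial ks
                * (fact CARD('n) ^ CARD('p) / fact (CARD('p) * CARD('n))) * measure lebesgue K ^ CARD('p)"
    have sum_fib: "(\<Sum>b\<in>UNIV. fib b) = CARD('n)"
      using k ks by (simp add: UNIV_option_sum fib_def)
    have card: "real (card C) * (fact (CARD('n) - k) * (\<Prod>j\<in>UNIV. fact (ks j))) = fact CARD('n)"
      using card_fibers[OF sum_fib] by (simp add: C_def UNIV_option_prod fib_def)
    have V: "V = (\<Sum>c\<in>C. 1 * normalized_product K c) / fact (CARD('p) * CARD('n))"
      unfolding V_def C_def fib_def mult_1 by (rule mixed_volume_factors[OF K spec[OF ks(1)] ks(2) k])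
    \<comment> \<open>Binomial times multinomial is the number of maps with fiber sizes
      \<open>fib\<close>, so B is V with every term replaced by its bound M.\<close>
    have B: "B = (\<Sum>c\<in>C. 1) * M / fact (CARD('p) * CARD('n))"
    proof -
      have pk: "0 < (\<Prod>j\<in>UNIV. fact (ks j) :: real)" by (rule prod_pos) simp
      have "real (card C) = fact CARD('n) / (fact (CARD('n) - k) * (\<Prod>j\<in>UNIV. fact (ks j)))"
        using card pk by (simp add: nonzero_eq_divide_eq)
      also have "\<dots> = real (CARD('n) choose k) * multinomial ks"
        using pk by (simp add: binomial_fact[OF k] multinomial_def ks(2))
      finally have "real (card C) = real (CARD('n) choose k) * multinomial ks" .
      then show ?thesis by (simp add: B_def M_def power_mult_distrib)
    qed
    have VB: "V \<le> B"
      unfolding V B by (intro divide_right_mono weighted_sum_le_max(1)[where F = "\<lambda>_. 1" and g = "normalized_product K"]) (auto simp: le)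
    have VB_eq: "V = B \<longleftrightarrow> int CARD('n) simplex K" if lt: "\<forall>j. ks j < CARD('n)" and k0: "0 < k" and int: "interior K \<noteq> {}"
    proof -
      have "card C \<noteq> 0" using card by (intro notI) simp
      then have "C \<noteq> {}" by auto
      then obtain c0 where c0: "c0 \<in> C" by blast
      \<comment> \<open>A constant map has a fiber of size n, but n - k < n and k_j < n.\<close>
      have "\<exists>a b. c0 a \<noteq> c0 b"
      proof (rule ccontr)
        assume "\<nexists>a b. c0 a \<noteq> c0 b"
        then have "c0 x = c0 undefined" for x by blast
        then have "c0 -` {c0 undefined} = UNIV" by (simp add: vimage_def)
        moreover have "card (c0 -` {c0 undefined}) = fib (c0 undefined)" using c0 by (simp add: C_def)
        ultimately have "fib (c0 undefined) = CARD('n)" by simp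
        moreover have "fib b < CARD('n)" for b
        proof (cases b)
          case None
          then show ?thesis using k0 by (simp add: fib_def)
        next
          case (Some j)
          then show ?thesis using lt by (simp add: fib_def)
        qed
        from this[of "c0 undefined"] have "fib (c0 undefined) < CARD('n)" .
        ultimately show False by simp
      qed
      then obtain a b where ab: "c0 a \<noteq> c0 b" by auto
      have perm: "c \<circ> Transposition.transpose i j \<in> C" if "c \<in> C" for c i j
        using that by (simp add: C_def card_vimage_transpose del: vimage_comp)
      have "V = B \<longleftrightarrow> (\<Sum>c\<in>C. 1 * normalized_product K c) = (\<Sum>c\<in>C. 1) * M"
        unfolding V B by simp
      also have "\<dots> \<longleftrightarrow> (\<forall>c\<in>C. normalized_product K c = M)"
        by (rule weighted_sum_le_max(2)[where F = "\<lambda>_. 1" and g = "normalized_product K"]) (auto simp: le)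
      also have "\<dots> \<longleftrightarrow> int CARD('n) simplex K"
        unfolding M_def by (rule normalized_product_eq_iff_simplex[OF K int _ c0 ab]) (rule perm)
      finally show ?thesis .
    qed
    show "let V = mixed_volume (replicate k (uminus ` diag ` K) @ factor_copies K ks);
          B = real (CARD('n) choose k) * multinomial ks
                * (fact CARD('n) ^ CARD('p) / fact (CARD('p) * CARD('n)))
                * measure lebesgue K ^ CARD('p)
        in V \<le> B \<and>
           ((\<forall>j. ks j < CARD('n)) \<longrightarrow> 0 < k \<longrightarrow> interior K \<noteq> {} \<longrightarrow>
              (V = B \<longleftrightarrow> int CARD('n) simplex K))"
      unfolding Let_def V_def[symmetric] B_def[symmetric] by (intro conjI impI VB VB_eq)
  }
  {
    fix k assume k: "k \<le> CARD('n)"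
    define m where "m = CARD('p) * CARD('n)"
    define C where "C = {c :: 'n \<Rightarrow> 'p option. card (- (c -` {None})) = k}"
    define F where "F = (\<lambda>c :: 'n \<Rightarrow> 'p option. \<Prod>i\<in>UNIV. falling CARD('n) (card (c -` {Some i})))"
    define q :: real where "q = fact (m - k) / (fact m * fact CARD('n) ^ CARD('p))"
    define V where "V = mixed_volume (replicate k (uminus ` diag ` K)
                  @ replicate (CARD('p) * CARD('n) - k) (body_power K :: (real ^ 'n ^ 'p::{finite,linorder}) set))"
    define B where "B = real (CARD('n) choose k) * measure lebesgue K ^ CARD('p)"
    have km: "k \<le> m" unfolding m_def by (rule card_le_card_mult[OF k])
    have q: "0 < q" by (simp add: q_def)
    have V: "V = q * (\<Sum>c\<in>C. F c * normalized_product K c)"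
      unfolding V_def q_def C_def F_def m_def by (rule mixed_volume_power[OF K k])
    \<comment> \<open>The factor \<open>falling m k\<close> is m! / (m - k)! and cancels against
      \<open>q\<close>, which leaves the binomial coefficient of the bound.\<close>
    have "(\<Sum>c\<in>C. F c) = real (CARD('n) choose k) * falling m k"
      unfolding C_def F_def m_def by (rule sum_falling_partial[OF k])
    then have B: "B = q * ((\<Sum>c\<in>C. F c) * M)"
      by (simp add: q_def B_def M_def falling_eq[OF km] power_mult_distrib)
    have F: "0 < F c" for c
      unfolding F_def by (rule prod_pos) (simp add: falling_eq card_fiber_le)
    have VB: "V \<le> B"
      unfolding V B using q by (intro mult_left_mono weighted_sum_le_max(1)[where F = F and g = "normalized_product K"]) (auto simp: le F)
    have VB_eq: "V = B \<longleftrightarrow> int CARD('n) simplex K"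
      if k0: "0 < k" and excl: "\<not> (CARD('p) = 1 \<and> k = CARD('n))" and int: "interior K \<noteq> {}"
    proof -
      have "\<exists>c0 a b. c0 \<in> C \<and> c0 a \<noteq> c0 b"
      proof (cases "k = CARD('n)")
        case True
        then have "CARD('p) \<noteq> 1" using excl by simp
        then obtain i j :: 'p where ij: "i \<noteq> j" using ex_neq_if_card by blast
        \<comment> \<open>The hypothesis n >= 2 enters here: for k = n the value \<open>None\<close>
          is not taken, so a nonconstant map requires two coordinates and two factors.\<close>
        have "CARD('n) \<noteq> 1" using assms(1) by simp
        then obtain a b :: 'n where ab: "a \<noteq> b" using ex_neq_if_card by blast
        define c0 where "c0 = (\<lambda>x. Some (if x = a then i else j))"
        have "- (c0 -` {None}) = UNIV" by (auto simp: c0_def)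
        then have "c0 \<in> C" using True by (simp add: C_def)
        moreover have "c0 a \<noteq> c0 b" using ij ab by (simp add: c0_def)
        ultimately show ?thesis by blast
      next
        case False
        obtain A :: "'n set" where A: "card A = k"
          using obtain_subset_with_card_n[OF k] by blast
        have "A \<noteq> {}" "A \<noteq> UNIV" using A k0 False by auto
        then obtain a b where ab: "a \<in> A" "b \<notin> A" by auto
        \<comment> \<open>For 0 < k < n the value \<open>None\<close> is both taken and avoided; the
          factor chosen on \<open>A\<close> is arbitrary.\<close>
        define c0 where "c0 = (\<lambda>x. if x \<in> A then Some (undefined :: 'p) else None)"
        have "- (c0 -` {None}) = A" by (auto simp: c0_def)
        then have "c0 \<in> C" using A by (simp add: C_def)
        moreover have "c0 a \<noteq> c0 b" using ab by (simp add: c0_def)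
        ultimately show ?thesis by blast
      qed
      then obtain c0 a b where c0: "c0 \<in> C" and ab: "c0 a \<noteq> c0 b" by blast
      have perm: "c \<circ> Transposition.transpose i j \<in> C" if "c \<in> C" for c i j
        using that by (simp add: C_def card_Compl_fiber card_vimage_transpose del: vimage_comp)
      have "V = B \<longleftrightarrow> (\<Sum>c\<in>C. F c * normalized_product K c) = (\<Sum>c\<in>C. F c) * M"
        unfolding V B using q by simp
      also have "\<dots> \<longleftrightarrow> (\<forall>c\<in>C. normalized_product K c = M)"
        by (rule weighted_sum_le_max(2)[where F = F and g = "normalized_product K"]) (auto simp: le F)
      also have "\<dots> \<longleftrightarrow> int CARD('n) simplex K"
        unfolding M_def by (rule normalized_product_eq_iff_simplex[OF K int _ c0 ab]) (rule perm)
      finally show ?thesis .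
    qed
    show "let V = mixed_volume
                (replicate k (uminus ` diag ` K)
                  @ replicate (CARD('p) * CARD('n) - k)
                      (body_power K :: (real ^ 'n ^ 'p::{finite,linorder}) set));
          B = real (CARD('n) choose k) * measure lebesgue K ^ CARD('p)
        in V \<le> B \<and>
           (0 < k \<longrightarrow> \<not> (CARD('p) = 1 \<and> k = CARD('n)) \<longrightarrow> interior K \<noteq> {} \<longrightarrow>
              (V = B \<longleftrightarrow> int CARD('n) simplex K))"
      unfolding Let_def V_def[symmetric] B_def[symmetric] by (intro conjI impI VB VB_eq)
  }
qed

end
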